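(* Let $0<\delta\le2$ and let $\gamma_\delta\in L^1(-1,1)$ be a truncated scalar kernel (vanishing at those $t$ with $\sqrt{2(1-t)}>\delta$) with $\sqrt{1-t^2}\,\gamma_\delta'\in L^1(-1,1)$ and $(1-t)\gamma_\delta'\in L^1(-1,1)$. For any smooth vector field $\boldsymbol V:\mathbb S^2\to\mathbb R^3$, define the averaging operator $\boldsymbol{\mathcal A}^\delta$ via $$\boldsymbol{\mathcal A}^\delta\{\boldsymbol V\}(\boldsymbol x)=\int_{\mathbb S^2}\gamma_\delta(\boldsymbol x\cdot\boldsymbol y)\boldsymbol V(\boldsymbol y)\,\mathrm d\Omega(\boldsymbol y),\qquad\boldsymbol x\in\mathbb S^2 .$$ Then, for every spherical patch $\Sigma\subset\mathbb S^2$ with boundary $\partial\Sigma$, $$\int_\Sigma\boldsymbol{\mathcal C}^\delta\{\boldsymbol V\}\cdot\boldsymbol x\,\mathrm d\Omega=\int_{\partial\Sigma}\boldsymbol{\mathcal A}^\delta\{\boldsymbol V\}\cdot\boldsymbol s\,\mathrm d\omega .$$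
   Context: $\mathbb S^2\subset\mathbb R^3$ is the unit sphere with standard measure $\mathrm d\Omega$; a point $\boldsymbol x\in\mathbb S^2$ is identified with the outward unit normal at $\boldsymbol x$; $|\boldsymbol x-\boldsymbol y|=\sqrt{2(1-\boldsymbol x\cdot\boldsymbol y)}$. The paper takes $\gamma_\delta(\boldsymbol x\cdot\boldsymbol y)=\gamma(\boldsymbol x\cdot\boldsymbol y)\chi_{[0,\delta]}(|\boldsymbol x-\boldsymbol y|)$ for a scalar kernel $\gamma$, with $\chi_{[0,\delta]}$ the indicator function of $[0,\delta]$; the prime is the (weak) derivative in $t=\boldsymbol x\cdot\boldsymbol y$. The weighted nonlocal curl is $$\boldsymbol{\mathcal C}^\delta\{\boldsymbol V\}(\boldsymbol x)=\int_{\mathbb S^2}\gamma_\delta'(\boldsymbol x\cdot\boldsymbol y)(\boldsymbol y-\boldsymbol x)\times[\boldsymbol V(\boldsymbol y)-\boldsymbol V(\boldsymbol x)]\,\mathrm d\Omega(\boldsymbol y).$$ A spherical patch $\Sigma$ is a closed region of $\mathbb S^2$ with (piecewise smooth) boundary curve $\partial\Sigma$; $\boldsymbol s$ is the unit tangent vector along $\partial\Sigma$, positively oriented with respect to the outward normal $\boldsymbol x$, and $\mathrm d\omega$ is arc length. That is, $\boldsymbol s$ is such that the classical Stokes theorem $\int_\Sigma(\nabla\times\boldsymbol W)\cdot\boldsymbol x\,\mathrm d\Omega=\int_{\partial\Sigma}\boldsymbol W\cdot\boldsymbol s\,\mathrm d\omega$ holds. *)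

theory Defs
  imports "HOL-Analysis.Analysis"
begin

section \<open>Differentiability classes\<close>

text \<open>\<open>C\<^sup>k\<close> on an open subset of a finite-dimensional space, by iterating directional derivatives.\<close>

primrec Ck_on :: "nat \<Rightarrow> ('a::euclidean_space \<Rightarrow> 'b::real_normed_vector) \<Rightarrow> 'a set \<Rightarrow> bool" where
  "Ck_on 0 f U \<longleftrightarrow> continuous_on U f"
| "Ck_on (Suc k) f U \<longleftrightarrow> (\<forall>x\<in>U. f differentiable (at x)) \<and>
     (\<forall>v. Ck_on k (\<lambda>x. frechet_derivative f (at x) v) U)"

definition smooth_on :: "('a::euclidean_space \<Rightarrow> 'b::real_normed_vector) \<Rightarrow> 'a set \<Rightarrow> bool" where
  "smooth_on f U \<longleftrightarrow> (\<forall>k. Ck_on k f U)"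

definition curl :: "(real^3 \<Rightarrow> real^3) \<Rightarrow> real^3 \<Rightarrow> real^3" where
  "curl W x = (let D = (\<lambda>j i. frechet_derivative W (at x) (axis j 1) $ i) in
     vector [D 2 3 - D 3 2, D 3 1 - D 1 3, D 1 2 - D 2 1])"

text \<open>\<open>g'\<close> is a weak derivative of \<open>g\<close> on the open interval \<open>(a, b)\<close>. As elements of
  \<open>L\<^sup>1\<^sub>l\<^sub>o\<^sub>c\<close>, both are given by arbitrary Lebesgue measurable representatives.\<close>

definition has_weak_derivative_on ::
    "(real \<Rightarrow> real) \<Rightarrow> (real \<Rightarrow> real) \<Rightarrow> real \<Rightarrow> real \<Rightarrow> bool" where
  "has_weak_derivative_on g g' a b \<longleftrightarrow>
     (\<forall>K. compact K \<and> K \<subseteq> {a<..<b} \<longrightarrow>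
        set_integrable lebesgue K g \<and> set_integrable lebesgue K g') \<and>
     (\<forall>\<phi>::real \<Rightarrow> real. smooth_on \<phi> UNIV \<and> compact (closure {t. \<phi> t \<noteq> 0}) \<and>
        closure {t. \<phi> t \<noteq> 0} \<subseteq> {a<..<b} \<longrightarrow>
        (LINT t:{a<..<b}|lebesgue. g t * deriv \<phi> t) = - (LINT t:{a<..<b}|lebesgue. g' t * \<phi> t))"


section \<open>The unit sphere\<close>

abbreviation S2 :: "(real^3) set" where
  "S2 \<equiv> sphere 0 1"

definition spherical_point :: "real \<times> real \<Rightarrow> real^3" where
  "spherical_point = (\<lambda>(\<theta>, \<phi>). vector [sin \<theta> * cos \<phi>, sin \<theta> * sin \<phi>, cos \<theta>])"

text \<open>The surface measure \<open>d\<Omega> = sin \<theta> d\<theta> d\<phi>\<close>. It lives on all of \<open>\<real>\<^sup>3\<close>, is concentrated on the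
  sphere, and is completed so that functions which are merely Lebesgue measurable in
  \<open>x \<bullet> y\<close> can be integrated.\<close>

definition sphere_measure :: "(real^3) measure" where
  "sphere_measure = completion (distr
     (density lborel (\<lambda>(\<theta>, \<phi>). indicator ({0..pi} \<times> {0..2 * pi}) (\<theta>, \<phi>) * ennreal (sin \<theta>)))
     borel spherical_point)"

definition smooth_field_on_sphere :: "(real^3 \<Rightarrow> real^3) \<Rightarrow> bool" where
  "smooth_field_on_sphere V \<longleftrightarrow>
     (\<exists>U F. open U \<and> S2 \<subseteq> U \<and> smooth_on F U \<and> (\<forall>x\<in>S2. F x = V x))"


section \<open>Nonlocal operators\<close>

definition truncated_kernel :: "real \<Rightarrow> (real \<Rightarrow> real) \<Rightarrow> real \<Rightarrow> real" where
  "truncated_kernel \<delta> \<gamma> t = \<gamma> t * indicator {0..\<delta>} (sqrt (2 * (1 - t)))"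

text \<open>The argument \<open>\<gamma>'\<close> is the weak derivative of the truncated kernel.\<close>

definition nonlocal_curl :: "(real \<Rightarrow> real) \<Rightarrow> (real^3 \<Rightarrow> real^3) \<Rightarrow> real^3 \<Rightarrow> real^3" where
  "nonlocal_curl \<gamma>' V x =
     (LINT y:S2|sphere_measure. \<gamma>' (x \<bullet> y) *\<^sub>R cross3 (y - x) (V y - V x))"

definition nonlocal_average :: "(real \<Rightarrow> real) \<Rightarrow> (real^3 \<Rightarrow> real^3) \<Rightarrow> real^3 \<Rightarrow> real^3" where
  "nonlocal_average \<gamma> V x = (LINT y:S2|sphere_measure. \<gamma> (x \<bullet> y) *\<^sub>R V y)"


section \<open>Spherical patches\<close>

text \<open>Piecewise regular \<open>C\<^sup>1\<close>. The derivative is required to extend continuously, without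
  zeros, to the end points of each piece; \<^const>\<open>piecewise_C1_differentiable_on\<close> does not
  require this and admits curves of infinite length.\<close>

definition piecewise_regular_curve :: "(real \<Rightarrow> real^3) \<Rightarrow> bool" where
  "piecewise_regular_curve c \<longleftrightarrow>
     (\<exists>n p. p 0 = 0 \<and> p n = 1 \<and>
        (\<forall>i<n. p i < p (Suc i) \<and>
           (\<exists>D. continuous_on {p i..p (Suc i)} D \<and>
              (\<forall>t\<in>{p i..p (Suc i)}. D t \<noteq> 0 \<and>
                 (c has_vector_derivative D t) (at t within {p i..p (Suc i)})))))"

definition unit_tangent :: "(real \<Rightarrow> real^3) \<Rightarrow> real \<Rightarrow> real^3" where
  "unit_tangent c t = sgn (vector_derivative c (at t))"

text \<open>\<open>\<integral> W \<bullet> s d\<omega>\<close> along a curve parametrised over \<open>[0, 1]\<close>, with arc length element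
  \<open>d\<omega> = |c'(t)| dt\<close>.\<close>

definition curve_circulation :: "(real \<Rightarrow> real^3) \<Rightarrow> (real^3 \<Rightarrow> real^3) \<Rightarrow> real" where
  "curve_circulation c W =
     integral {0..1} (\<lambda>t. (W (c t) \<bullet> unit_tangent c t) * norm (vector_derivative c (at t)))"

text \<open>The boundary of a patch is given by a set of parametrised curves, one for each of its
  components, so that patches bounded by several curves are included.\<close>

definition boundary_circulation :: "(real \<Rightarrow> real^3) set \<Rightarrow> (real^3 \<Rightarrow> real^3) \<Rightarrow> real" where
  "boundary_circulation C W = (\<Sum>c\<in>C. curve_circulation c W)"

text \<open>The parametrisation is positively oriented with respect to the outward normal \<open>x\<close> if its
  unit tangent is the one for which the classical Stokes theorem holds.\<close>

definition positively_oriented_boundary :: "(real^3) set \<Rightarrow> (real \<Rightarrow> real^3) set \<Rightarrow> bool" where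
  "positively_oriented_boundary \<Sigma> C \<longleftrightarrow>
     (\<forall>U W. open U \<and> \<Sigma> \<subseteq> U \<and> Ck_on 1 W U \<longrightarrow>
        (LINT x:\<Sigma>|sphere_measure. curl W x \<bullet> x) = boundary_circulation C W)"

definition spherical_patch :: "(real^3) set \<Rightarrow> (real \<Rightarrow> real^3) set \<Rightarrow> bool" where
  "spherical_patch \<Sigma> C \<longleftrightarrow>
     \<Sigma> \<subseteq> S2 \<and>
     (let R = top_of_set S2 interior_of \<Sigma> in R \<noteq> {} \<and> connected R \<and> \<Sigma> = closure R) \<and>
     finite C \<and> disjoint_family_on path_image C \<and>
     (\<forall>c\<in>C. simple_path c \<and> pathfinish c = pathstart c \<and> piecewise_regular_curve c) \<and>
     top_of_set S2 frontier_of \<Sigma> = (\<Union>c\<in>C. path_image c) \<and>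
     positively_oriented_boundary \<Sigma> C"

end

theory Submission
  imports Defs "HOL-Probability.Levy"
begin

text \<open>
  For a \<open>C\<^sup>1\<close> profile \<open>P\<close> with derivative \<open>p\<close>, the field \<open>W x = \<integral> P (x \<bullet> y) V y d\<Omega>(y)\<close> is \<open>C\<^sup>1\<close> on all of
  \<open>\<real>\<^sup>3\<close> and \<open>curl W x \<bullet> x = \<integral> p (x \<bullet> y) (x \<times> y) \<bullet> V y d\<Omega>(y)\<close>, so the classical Stokes theorem applies to it.
  The rotation generators applied to \<open>P (x \<bullet> y)\<close> are exact divergences in spherical coordinates; hence
  \<open>\<integral> p (x \<bullet> y) (x \<times> y) d\<Omega>(y) = 0\<close>. This removes the term with \<open>V x\<close> from the nonlocal curl, and it also
  shows that \<open>\<integral> P (x \<bullet> y) d\<Omega>(y)\<close> does not depend on \<open>x\<close>, i.e. that \<open>x \<bullet> y\<close> is distributed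
  as \<open>2\<pi> dt\<close> on \<open>[-1, 1]\<close>.

  Since \<open>|x \<times> y| = sqrt (1 - (x \<bullet> y)\<^sup>2)\<close>, both sides of the identity are continuous with respect to
  \<open>\<integral> |\<gamma>| dt\<close> and \<open>\<integral> sqrt (1 - t\<^sup>2) |\<gamma>'| dt\<close>. The kernel is the primitive of its weak derivative, so
  approximating \<open>\<gamma>'\<close> by continuous functions in the second norm and integrating gives approximations of \<open>\<gamma>\<close>
  in the first norm as well, because \<open>1 - |t| \<le> sqrt (1 - t\<^sup>2)\<close>.
\<close>

section \<open>The surface measure in spherical coordinates\<close>

text \<open>The orientation condition gives Stokes only for fields that are C^1 on a neighbourhood
  of the patch, while the kernel is just measurable and may blow up at both ends of the interval.
  Hence smoothed profiles, defined on all of \<real> because \<open>x \<bullet> y\<close> leaves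
  [-1, 1] off the sphere. The weights come from geometry. On the sphere |y - x|^2 = 2 (1 - x
  \<bullet> y), and V is Lipschitz at x, so the weight 1 - t makes the integrand of the nonlocal
  curl integrable. The inner product with x turns it into (x \<times> y) \<bullet> (V y - V x);
  separating its two terms costs the larger weight |x \<times> y| near t = 1. Approximating the
  derivative and integrating, instead of approximating the kernel, controls a profile and its
  derivative at once, with one constant of integration for the whole sequence. The law of
  \<open>x \<bullet> y\<close> is the same for all x, so all errors are uniform on the sphere. This
  uniformity is what carries the limit through the circulation: curves are null sets, and
  convergence in mean over the sphere would say nothing about them.\<close>

definition sphere_borel_measure :: "(real^3) measure" where
  "sphere_borel_measure = distr (density lborel
     (\<lambda>p. ennreal (indicator (cbox (0, 0) (pi, 2 * pi)) p * sin (fst p)))) borel spherical_point"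

text \<open>Densities, image measures and their integrals are computed for the Borel measure; the
  completion enters only when a merely Lebesgue measurable kernel is composed with
  \<open>x \<bullet> y\<close>.\<close>

lemma sphere_measure_eq_completion: "sphere_measure = completion sphere_borel_measure"
proof -
  have "(\<lambda>(\<theta>, \<phi>). indicator ({0..pi} \<times> {0..2 * pi}) (\<theta>, \<phi>) * ennreal (sin \<theta>))
      = (\<lambda>p. ennreal (indicator (cbox (0, 0) (pi, 2 * pi)) p * sin (fst p)))"
    by (auto simp: fun_eq_iff indicator_def cbox_Pair_eq cbox_interval)
  then show ?thesis
    unfolding sphere_measure_def sphere_borel_measure_def by simp
qed

lemma sets_sphere_borel_measure [simp, measurable_cong]: "sets sphere_borel_measure = sets borel"
  and space_sphere_borel_measure [simp]: "space sphere_borel_measure = UNIV"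
  by (simp_all add: sphere_borel_measure_def)

lemma spherical_point_nth [simp]:
  "spherical_point p $ 1 = sin (fst p) * cos (snd p)"
  "spherical_point p $ 2 = sin (fst p) * sin (snd p)"
  "spherical_point p $ 3 = cos (fst p)"
  by (simp_all add: spherical_point_def split_beta)

lemma continuous_on_spherical_point [continuous_intros]: "continuous_on A spherical_point"
proof -
  have "spherical_point = (\<lambda>p. \<chi> i. (if i = 1 then sin (fst p) * cos (snd p)
      else if i = 2 then sin (fst p) * sin (snd p) else cos (fst p)))"
    using exhaust_3 by (auto simp: fun_eq_iff vec_eq_iff spherical_point_def forall_3)
  moreover have "continuous_on A (\<lambda>p::real \<times> real. (\<chi> i. (if i = 1 then sin (fst p) * cos (snd p)
      else if i = 2 then sin (fst p) * sin (snd p) else cos (fst p)))::real^3)"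
  proof (rule continuous_on_vec_lambda)
    fix i :: 3
    show "continuous_on A (\<lambda>p::real \<times> real. if i = 1 then sin (fst p) * cos (snd p)
      else if i = 2 then sin (fst p) * sin (snd p) else cos (fst p))"
      by (cases "i = 1"; cases "i = 2"; simp; intro continuous_intros)
  qed
  ultimately show ?thesis by metis
qed

lemma borel_measurable_spherical_point [measurable]: "spherical_point \<in> borel_measurable borel"
  by (intro borel_measurable_continuous_onI continuous_intros)

lemma spherical_point_in_S2: "spherical_point p \<in> S2"
proof -
  have "(norm (spherical_point p))\<^sup>2 = 1"
  proof -
    have "(sin a * cos b)\<^sup>2 + (sin a * sin b)\<^sup>2 + (cos a)\<^sup>2 = 1" for a b :: real
    proof -
      have "(sin a * cos b)\<^sup>2 + (sin a * sin b)\<^sup>2 = (sin a)\<^sup>2 * ((sin b)\<^sup>2 + (cos b)\<^sup>2)"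
        by (simp only: power_mult_distrib distrib_left add.commute)
      then show ?thesis by (simp only: sin_cos_squared_add mult_1_right)
    qed
    then show ?thesis
      unfolding power2_norm_eq_inner by (simp add: inner_vec_def sum_3 power2_eq_square)
  qed
  then have "norm (spherical_point p) = 1"
    using norm_ge_zero[of "spherical_point p"] by (simp add: power2_eq_1_iff)
  then show ?thesis by simp
qed

lemma sin_box_nonneg: "0 \<le> indicator (cbox (0, 0) (pi, 2 * pi)) p * sin (fst p)"
  by (auto simp: indicator_def cbox_Pair_eq intro!: sin_ge_zero)

lemma borel_measurable_sphere_density [measurable]:
  "(\<lambda>p. indicator (cbox (0, 0) (pi, 2 * pi)) p * sin (fst p)) \<in> borel_measurable (borel :: (real \<times> real) measure)"
proof -
  have [measurable]: "(\<lambda>p::real \<times> real. sin (fst p)) \<in> borel_measurable borel"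
    by (intro borel_measurable_continuous_onI continuous_intros)
  show ?thesis by measurable
qed

lemma nn_integral_sphere_borel:
  assumes [measurable]: "f \<in> borel_measurable borel"
  shows "(\<integral>\<^sup>+y. f y \<partial>sphere_borel_measure) = (\<integral>\<^sup>+p. ennreal (indicator (cbox (0, 0) (pi, 2 * pi)) p * sin (fst p))
      * f (spherical_point p) \<partial>lborel)"
  unfolding sphere_borel_measure_def
  by (subst nn_integral_distr) (auto simp: nn_integral_density)

lemma integral_sphere_borel:
  fixes f :: "real^3 \<Rightarrow> 'a::{banach,second_countable_topology}"
  assumes [measurable]: "f \<in> borel_measurable borel"
  shows "integral\<^sup>L sphere_borel_measure f
      = (LINT p:cbox (0, 0) (pi, 2 * pi)|lborel. sin (fst p) *\<^sub>R f (spherical_point p))"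
  unfolding sphere_borel_measure_def set_lebesgue_integral_def
  using sin_box_nonneg by (subst integral_distr) (auto simp: integral_density)

lemma AE_sphere_borel: "AE y in sphere_borel_measure. y \<in> S2"
  unfolding sphere_borel_measure_def
  by (subst AE_distr_iff) (use spherical_point_in_S2 in \<open>auto simp: AE_density\<close>)

lemma integrable_rectangle_continuous:
  fixes F :: "real \<times> real \<Rightarrow> 'a::euclidean_space"
  assumes "continuous_on UNIV F"
  shows "set_integrable lborel (cbox a b) F"
  unfolding set_integrable_def
  by (intro borel_integrable_compact) (auto intro: continuous_on_subset[OF assms])

lemma finite_measure_sphere_borel: "finite_measure sphere_borel_measure"
proof (rule finite_measureI)
  have "continuous_on UNIV (\<lambda>p::real \<times> real. sin (fst p))"
    by (intro continuous_intros)
  from integrable_rectangle_continuous[OF this, of "(0, 0)" "(pi, 2 * pi)"]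
  have "integrable lborel (\<lambda>p. indicator (cbox (0, 0) (pi, 2 * pi)) p * sin (fst p))"
    by (simp add: set_integrable_def)
  then  have "(\<integral>\<^sup>+p. ennreal (indicator (cbox (0, 0) (pi, 2 * pi)) p * sin (fst p)) \<partial>lborel)
     = ennreal (LINT p:cbox (0, 0) (pi, 2 * pi)|lborel. sin (fst p))"
    unfolding set_lebesgue_integral_def
    using sin_box_nonneg by (subst nn_integral_eq_integral) auto
  then show "emeasure sphere_borel_measure (space sphere_borel_measure) \<noteq> \<infinity>"
    using nn_integral_sphere_borel[of "\<lambda>_. 1"] by simp
qed

text \<open>Fields on the sphere have arbitrary values elsewhere; the indicator of the closed set
  \<open>S2\<close> turns them into Borel functions on the whole space.\<close>

lemma continuous_on_sphere_measurable:
  fixes F :: "real^3 \<Rightarrow> 'a::euclidean_space"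
  assumes "continuous_on S2 F"
  shows "(\<lambda>y. indicator S2 y *\<^sub>R F y) \<in> borel_measurable borel"
  by (rule borel_measurable_continuous_on_indicator[OF _ assms]) auto

lemma continuous_on_compose_spherical_point:
  assumes "continuous_on S2 F"
  shows "continuous_on A (\<lambda>p. F (spherical_point p))"
  by (rule continuous_on_compose2[OF assms continuous_on_spherical_point])
     (use spherical_point_in_S2 in blast)

lemma integrable_sphere_continuous:
  fixes F :: "real^3 \<Rightarrow> 'a::euclidean_space"
  assumes F: "continuous_on S2 F"
  shows "set_integrable sphere_borel_measure S2 F"
proof -
  interpret finite_measure sphere_borel_measure by (rule finite_measure_sphere_borel)
  have "compact (F ` S2)" by (intro compact_continuous_image F) auto
  then obtain B where B: "\<And>y. y \<in> S2 \<Longrightarrow> norm (F y) \<le> B"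
    by (meson bounded_iff compact_imp_bounded imageI)
  have "0 \<le> B" using B[OF spherical_point_in_S2] norm_ge_zero order_trans by blast
  then show ?thesis
    unfolding set_integrable_def
    using continuous_on_sphere_measurable[OF F] B
    by (intro integrable_const_bound[of _ B]) (auto simp: indicator_def)
qed

text \<open>Leads from the completed surface measure to a gauge integral over a rectangle, where the
  Leibniz rule, Fubini for continuous functions and the fundamental theorem apply directly.\<close>

lemma integral_sphere_continuous:
  fixes F :: "real^3 \<Rightarrow> 'a::euclidean_space"
  assumes F: "continuous_on S2 F"
  shows "(LINT y:S2|sphere_measure. F y)
      = integral (cbox (0, 0) (pi, 2 * pi)) (\<lambda>p. sin (fst p) *\<^sub>R F (spherical_point p))"
proof -
  have "(LINT y:S2|sphere_measure. F y) = (LINT y:S2|sphere_borel_measure. F y)"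
    unfolding sphere_measure_eq_completion set_lebesgue_integral_def
    using continuous_on_sphere_measurable[OF F] by (subst integral_completion) auto
  also have "\<dots> = (LINT p:cbox (0, 0) (pi, 2 * pi)|lborel. sin (fst p) *\<^sub>R F (spherical_point p))"
    unfolding set_lebesgue_integral_def
    using integral_sphere_borel[OF continuous_on_sphere_measurable[OF F]] spherical_point_in_S2
    by (simp add: set_lebesgue_integral_def)
  also have "\<dots> = integral (cbox (0, 0) (pi, 2 * pi)) (\<lambda>p. sin (fst p) *\<^sub>R F (spherical_point p))"
    by (intro set_borel_integral_eq_integral integrable_rectangle_continuous
        continuous_intros continuous_on_compose_spherical_point F)
  finally show ?thesis .
qed

text \<open>Each summand is integrated first in its own variable, where the fundamental theorem
  leaves the difference of two equal boundary values. On the sphere the condition on A will hold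
  because of a factor sin \<theta>, which vanishes at both poles, and the condition on B by
  periodicity in \<phi>.\<close>

lemma integral_divergence_rectangle:
  fixes A A' B B' :: "real \<times> real \<Rightarrow> real"
  assumes A: "\<And>\<theta> \<phi>. ((\<lambda>\<theta>. A (\<theta>, \<phi>)) has_real_derivative A' (\<theta>, \<phi>)) (at \<theta>)"
    and B: "\<And>\<theta> \<phi>. ((\<lambda>\<phi>. B (\<theta>, \<phi>)) has_real_derivative B' (\<theta>, \<phi>)) (at \<phi>)"
    and "continuous_on UNIV A'" "continuous_on UNIV B'"
    and "\<And>\<phi>. A (a, \<phi>) = A (b, \<phi>)" "\<And>\<theta>. B (\<theta>, c) = B (\<theta>, d)" "a \<le> b" "c \<le> d"
  shows "integral (cbox (a, c) (b, d)) (\<lambda>p. A' p + B' p) = 0"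
proof -
  have cA: "continuous_on S A'" and cB: "continuous_on S B'" for S
    using assms(3,4) continuous_on_subset by blast+
  have "integral (cbox a b) (\<lambda>\<theta>. A' (\<theta>, \<phi>)) = 0" for \<phi>
    using fundamental_theorem_of_calculus[of a b "\<lambda>\<theta>. A (\<theta>, \<phi>)" "\<lambda>\<theta>. A' (\<theta>, \<phi>)"] A assms(5,7)
    by (simp add: integral_unique has_real_derivative_iff_has_vector_derivative has_vector_derivative_at_within)
  then have 1: "integral (cbox (a, c) (b, d)) A' = 0"
    using integral_prod_continuous[OF cA] integral_swap_continuous[of a c b d "\<lambda>x y. A' (x, y)"] cA
    by simp
  have "integral (cbox c d) (\<lambda>\<phi>. B' (\<theta>, \<phi>)) = 0" for \<theta>
    using fundamental_theorem_of_calculus[of c d "\<lambda>\<phi>. B (\<theta>, \<phi>)" "\<lambda>\<phi>. B' (\<theta>, \<phi>)"] B assms(6,8)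
    by (simp add: integral_unique has_real_derivative_iff_has_vector_derivative has_vector_derivative_at_within)
  then have 2: "integral (cbox (a, c) (b, d)) B' = 0"
    using integral_prod_continuous[OF cB] by simp
  show ?thesis
    using 1 2 by (subst integral_add) (auto intro!: integrable_continuous cA cB)
qed

section \<open>Zonal integrals with differentiable profiles\<close>

text \<open>Here \<open>u\<close> and \<open>v\<close> are the partial derivatives of \<open>x \<bullet> y\<close> with respect to \<open>\<theta>\<close> and \<open>\<phi>\<close>.\<close>

lemma cross3_spherical_point:
  fixes x :: "real^3" and \<theta> \<phi> :: real
  defines "u \<equiv> cos \<theta> * (cos \<phi> * x $ 1 + sin \<phi> * x $ 2) - sin \<theta> * x $ 3"
    and "v \<equiv> sin \<theta> * (cos \<phi> * x $ 2 - sin \<phi> * x $ 1)"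
  shows "sin \<theta> * cross3 (spherical_point (\<theta>, \<phi>)) x $ 1 = - (sin \<theta> * sin \<phi> * u + cos \<theta> * cos \<phi> * v)"
    and "sin \<theta> * cross3 (spherical_point (\<theta>, \<phi>)) x $ 2 = sin \<theta> * cos \<phi> * u - cos \<theta> * sin \<phi> * v"
    and "sin \<theta> * cross3 (spherical_point (\<theta>, \<phi>)) x $ 3 = sin \<theta> * v"
proof -
  \<comment> \<open>Polynomial identities with a = sin \<theta>, b = cos \<phi>, c = cos \<theta>, d
    = sin \<phi>; the relation between b and d suffices.\<close>
  have 1: "a * (a * (d * x3) - c * x2) = - (a * d * (c * (b * x1 + d * x2) - a * x3) + c * b * (a * (b * x2 - d * x1)))"
    and 2: "a * (c * x1 - a * (b * x3)) = a * b * (c * (b * x1 + d * x2) - a * x3) - c * d * (a * (b * x2 - d * x1))"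
    if "d\<^sup>2 + b\<^sup>2 = 1" for a b c d x1 x2 x3 :: real
    using that by algebra+
  note 3 = sin_cos_squared_add[of \<phi>]
  show "sin \<theta> * cross3 (spherical_point (\<theta>, \<phi>)) x $ 1 = - (sin \<theta> * sin \<phi> * u + cos \<theta> * cos \<phi> * v)"
    using 1[OF 3] unfolding u_def v_def by (simp add: cross3_def mult.assoc)
  show "sin \<theta> * cross3 (spherical_point (\<theta>, \<phi>)) x $ 2 = sin \<theta> * cos \<phi> * u - cos \<theta> * sin \<phi> * v"
    using 2[OF 3] unfolding u_def v_def by (simp add: cross3_def mult.assoc)
  show "sin \<theta> * cross3 (spherical_point (\<theta>, \<phi>)) x $ 3 = sin \<theta> * v"
    unfolding u_def v_def by (simp add: cross3_def algebra_simps)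
qed

text \<open>Component i of p (x \<bullet> y) (y \<times> x) is the derivative of P (x \<bullet> y)
  as y rotates about axis i. After multiplication with the surface density sin \<theta>, which
  removes the singularity of the coordinates at the poles, it is a divergence in \<theta> and
  \<phi>.\<close>

lemma integral_zonal_cross3_eq_0:
  fixes P p :: "real \<Rightarrow> real" and x :: "real^3"
  assumes P: "\<And>t. (P has_real_derivative p t) (at t)" and p: "continuous_on UNIV p"
  shows "(LINT y:S2|sphere_measure. p (x \<bullet> y) *\<^sub>R cross3 y x) = 0"
proof -
  define t where "t = (\<lambda>q. sin (fst q) * (cos (snd q) * x $ 1 + sin (snd q) * x $ 2) + cos (fst q) * x $ 3)"
  define u where "u = (\<lambda>q. cos (fst q) * (cos (snd q) * x $ 1 + sin (snd q) * x $ 2) - sin (fst q) * x $ 3)"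
  define v where "v = (\<lambda>q. sin (fst q) * (cos (snd q) * x $ 2 - sin (snd q) * x $ 1))"
  have t: "x \<bullet> spherical_point q = t q" for q
    unfolding t_def by (simp add: inner_vec_def sum_3 algebra_simps)
  have dP: "((\<lambda>s. P (f s)) has_real_derivative d * p (f s)) (at s)"
    if "(f has_real_derivative d) (at s)" for f d s
    using DERIV_chain2[OF P that] by (simp add: mult.commute)
  have du: "((\<lambda>\<theta>. t (\<theta>, \<phi>)) has_real_derivative u (\<theta>, \<phi>)) (at \<theta>)" for \<theta> \<phi>
    unfolding t_def u_def by (auto intro!: derivative_eq_intros)
  have dv: "((\<lambda>\<phi>. t (\<theta>, \<phi>)) has_real_derivative v (\<theta>, \<phi>)) (at \<phi>)" for \<theta> \<phi>
    unfolding t_def v_def by (auto intro!: derivative_eq_intros simp: algebra_simps)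
  have per: "t (\<theta>, 0) = t (\<theta>, 2 * pi)" for \<theta>
    by (simp add: t_def)
  have cP: "continuous_on UNIV P"
    using P DERIV_isCont continuous_at_imp_continuous_on by blast
  have ct: "continuous_on UNIV t" and cu: "continuous_on UNIV u" and cv: "continuous_on UNIV v"
    unfolding t_def u_def v_def by (intro continuous_intros)+
  have cPt: "continuous_on UNIV (\<lambda>q. P (t q))" and cpt: "continuous_on UNIV (\<lambda>q. p (t q))"
    by (auto intro: continuous_on_compose2[OF cP ct] continuous_on_compose2[OF p ct])
  note cts = ct cu cv cPt cpt
  let ?R = "cbox (0, 0) (pi, 2 * pi)"
  let ?F = "\<lambda>q. sin (fst q) *\<^sub>R (p (x \<bullet> spherical_point q) *\<^sub>R cross3 (spherical_point q) x)"
  have int: "?F integrable_on ?R"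
    unfolding t
    by (intro integrable_continuous continuous_intros continuous_on_cross
        continuous_on_subset[OF cpt]) auto
  have F: "?F q $ i = p (t q) * (sin (fst q) * cross3 (spherical_point q) x $ i)" for q i
    by (simp add: t)
  have c: "sin (fst q) * cross3 (spherical_point q) x $ 1
        = - (sin (fst q) * sin (snd q) * u q + cos (fst q) * cos (snd q) * v q)"
      "sin (fst q) * cross3 (spherical_point q) x $ 2
        = sin (fst q) * cos (snd q) * u q - cos (fst q) * sin (snd q) * v q"
      "sin (fst q) * cross3 (spherical_point q) x $ 3 = sin (fst q) * v q" for q
    using cross3_spherical_point[of "fst q" "snd q" x] by (simp_all add: u_def v_def)
  have 1: "integral ?R (\<lambda>q. ?F q $ 1) = 0"
  proof -
    \<comment> \<open>Obtained from c(1) by replacing p u and p v by P. Differentiating the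
      coefficients produces cos \<theta> sin \<phi> P with opposite signs, so that no term with P
      survives in the sum.\<close>
    let ?A = "\<lambda>q. - (sin (fst q) * sin (snd q) * P (t q))"
    let ?B = "\<lambda>q. - (cos (fst q) * cos (snd q) * P (t q))"
    have "integral ?R (\<lambda>q. - (cos (fst q) * sin (snd q) * P (t q) + sin (fst q) * sin (snd q) * (u q * p (t q)))
        + (cos (fst q) * sin (snd q) * P (t q) - cos (fst q) * cos (snd q) * (v q * p (t q)))) = 0"
      by (rule integral_divergence_rectangle[where A = ?A and B = ?B])
        (auto intro!: derivative_eq_intros dP[OF du] dP[OF dv] continuous_intros cts
          simp: per algebra_simps)
    moreover have "?F q $ 1 = - (cos (fst q) * sin (snd q) * P (t q) + sin (fst q) * sin (snd q) * (u q * p (t q)))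
        + (cos (fst q) * sin (snd q) * P (t q) - cos (fst q) * cos (snd q) * (v q * p (t q)))" for q
      unfolding F[of q] c(1) by (simp add: algebra_simps)
    ultimately show ?thesis by simp
  qed
  have 2: "integral ?R (\<lambda>q. ?F q $ 2) = 0"
  proof -
    let ?A = "\<lambda>q. sin (fst q) * cos (snd q) * P (t q)"
    let ?B = "\<lambda>q. - (cos (fst q) * sin (snd q) * P (t q))"
    have "integral ?R (\<lambda>q. (cos (fst q) * cos (snd q) * P (t q) + sin (fst q) * cos (snd q) * (u q * p (t q)))
        + (- (cos (fst q) * cos (snd q) * P (t q)) - cos (fst q) * sin (snd q) * (v q * p (t q)))) = 0"
      by (rule integral_divergence_rectangle[where A = ?A and B = ?B])
        (auto intro!: derivative_eq_intros dP[OF du] dP[OF dv] continuous_intros cts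
          simp: per algebra_simps)
    moreover have "?F q $ 2 = (cos (fst q) * cos (snd q) * P (t q) + sin (fst q) * cos (snd q) * (u q * p (t q)))
        + (- (cos (fst q) * cos (snd q) * P (t q)) - cos (fst q) * sin (snd q) * (v q * p (t q)))" for q
      unfolding F[of q] c(2) by (simp add: algebra_simps)
    ultimately show ?thesis by simp
  qed
  have 3: "integral ?R (\<lambda>q. ?F q $ 3) = 0"
  proof -
    \<comment> \<open>A rotation about the polar axis changes \<phi> alone, so there is no \<theta>
      part.\<close>
    let ?B = "\<lambda>q. sin (fst q) * P (t q)"
    have "integral ?R (\<lambda>q. 0 + sin (fst q) * (v q * p (t q))) = 0"
      by (rule integral_divergence_rectangle[where A = "\<lambda>_. 0" and B = ?B])
        (auto intro!: derivative_eq_intros dP[OF dv] continuous_intros cts simp: per)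
    moreover have "?F q $ 3 = 0 + sin (fst q) * (v q * p (t q))" for q
      unfolding F[of q] c(3) by simp
    ultimately show ?thesis by (simp only:)
  qed
  have "(LINT y:S2|sphere_measure. p (x \<bullet> y) *\<^sub>R cross3 y x) = integral ?R ?F"
    by (intro integral_sphere_continuous continuous_intros continuous_on_cross
        continuous_on_compose2[OF p]) auto
  also have "\<dots> = 0"
    unfolding vec_eq_iff forall_3 integral_component_eq_cart[OF int, symmetric]
    using 1 2 3 by (simp only: zero_index simp_thms)
  finally show ?thesis .
qed

section \<open>Zonal integrals as C^1 fields and their curl\<close>

text \<open>Differentiation under the integral sign over the coordinate rectangle, for every x in
  the ambient space: a curl needs derivatives in directions normal to the sphere as well.\<close>

lemma has_derivative_zonal_integral:
  fixes P p :: "real \<Rightarrow> real" and V :: "real^3 \<Rightarrow> real^3"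
  assumes P: "\<And>t. (P has_real_derivative p t) (at t)" and p: "continuous_on UNIV p"
    and V: "continuous_on S2 V"
  shows "((\<lambda>x. LINT y:S2|sphere_measure. P (x \<bullet> y) *\<^sub>R V y) has_derivative
      (\<lambda>v. LINT y:S2|sphere_measure. (p (x \<bullet> y) * (v \<bullet> y)) *\<^sub>R V y)) (at x)"
proof -
  have cP: "continuous_on UNIV P"
    using P DERIV_isCont continuous_at_imp_continuous_on by blast
  let ?R = "cbox (0, 0) (pi, 2 * pi)"
  let ?s = spherical_point
  define f where "f = (\<lambda>x q. sin (fst q) *\<^sub>R (P (x \<bullet> ?s q) *\<^sub>R V (?s q)))"
  \<comment> \<open>The Leibniz rule wants the derivative as a jointly continuous bounded linear
    function; written as a composition of two basic ones, its continuity follows factor by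
    factor.\<close>
  define f' where "f' = (\<lambda>x q. blinfun_scaleR_left (sin (fst q) *\<^sub>R (p (x \<bullet> ?s q) *\<^sub>R V (?s q)))
      o\<^sub>L blinfun_inner_left (?s q))"
  have f'_apply: "blinfun_apply (f' x q) v = sin (fst q) *\<^sub>R ((p (x \<bullet> ?s q) * (v \<bullet> ?s q)) *\<^sub>R V (?s q))" for x q v
    by (simp add: f'_def mult_ac inner_commute)
  have cV: "continuous_on A (\<lambda>q. V (?s q))" for A
    by (rule continuous_on_compose_spherical_point[OF V])
  have cV2: "continuous_on A (\<lambda>z::(real^3) \<times> real \<times> real. V (?s (snd z)))" for A
    by (rule continuous_on_compose2[OF cV[of UNIV]]) (auto intro!: continuous_intros)
  have cs2: "continuous_on A (\<lambda>z::(real^3) \<times> real \<times> real. ?s (snd z))" for A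
    by (rule continuous_on_compose2[OF continuous_on_spherical_point[of UNIV]]) (auto intro!: continuous_intros)
  have cf': "continuous_on A (\<lambda>(x, q). f' x q)" for A
    unfolding f'_def split_beta
    by (intro continuous_intros cV2 cs2 continuous_on_compose2[OF p]) auto
  have intf: "f x integrable_on ?R" for x
    unfolding f_def
    by (intro integrable_continuous continuous_intros cV continuous_on_compose2[OF cP]) auto
  have cf'x: "continuous_on ?R (f' x)" for x
  proof -
    have "continuous_on ?R (Pair x)" by (intro continuous_intros)
    from continuous_on_compose2[OF cf'[of UNIV] this] show ?thesis by simp
  qed
  have "((\<lambda>x. integral ?R (f x)) has_derivative blinfun_apply (integral ?R (f' x))) (at x within UNIV)"
  proof (rule leibniz_rule[OF _ intf cf'])
    fix x q
    have "((\<lambda>x. P (x \<bullet> ?s q)) has_derivative (\<lambda>v. p (x \<bullet> ?s q) * (v \<bullet> ?s q))) (at x)"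
      using has_derivative_compose[of "\<lambda>x. x \<bullet> ?s q" "\<lambda>v. v \<bullet> ?s q" x UNIV P "\<lambda>h. p (x \<bullet> ?s q) * h"]
        P[of "x \<bullet> ?s q"]
      by (simp add: has_field_derivative_def bounded_linear_imp_has_derivative bounded_linear_inner_left)
    then show "((\<lambda>x. f x q) has_derivative blinfun_apply (f' x q)) (at x within UNIV)"
      unfolding f_def by (auto intro!: derivative_eq_intros simp: f'_apply)
  qed auto
  moreover have "blinfun_apply (integral ?R (f' x)) = (\<lambda>v. LINT y:S2|sphere_measure. (p (x \<bullet> y) * (v \<bullet> y)) *\<^sub>R V y)"
  proof
    fix v
    have "blinfun_apply (integral ?R (f' x)) v = integral ?R (\<lambda>q. blinfun_apply (f' x q) v)"
      by (rule blinfun_apply_integral) (intro integrable_continuous cf'x)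
    also have "\<dots> = (LINT y:S2|sphere_measure. (p (x \<bullet> y) * (v \<bullet> y)) *\<^sub>R V y)"
      unfolding f'_apply
      by (intro integral_sphere_continuous[symmetric] continuous_intros V continuous_on_compose2[OF p]) auto
    finally show "blinfun_apply (integral ?R (f' x)) v = (LINT y:S2|sphere_measure. (p (x \<bullet> y) * (v \<bullet> y)) *\<^sub>R V y)" .
  qed
  moreover have "integral ?R (f x) = (LINT y:S2|sphere_measure. P (x \<bullet> y) *\<^sub>R V y)" for x
    unfolding f_def
    by (intro integral_sphere_continuous[symmetric] continuous_intros V continuous_on_compose2[OF cP]) auto
  ultimately show ?thesis by simp
qed

lemma continuous_on_sphere_integral:
  fixes F :: "'a::metric_space \<Rightarrow> real^3 \<Rightarrow> real^3"
  assumes F: "continuous_on (U \<times> S2) (\<lambda>(x, y). F x y)"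
  shows "continuous_on U (\<lambda>x. LINT y:S2|sphere_measure. F x y)"
proof -
  let ?R = "cbox (0, 0) (pi, 2 * pi)"
  have c: "continuous_on (U \<times> ?R) (\<lambda>z. spherical_point (snd z))"
    by (rule continuous_on_compose2[OF continuous_on_spherical_point[of UNIV]]) (auto intro!: continuous_intros)
  have "continuous_on (U \<times> ?R) (\<lambda>z. (\<lambda>(x, y). F x y) (fst z, spherical_point (snd z)))"
    using spherical_point_in_S2 by (intro continuous_on_compose2[OF F] continuous_intros c) auto
  then have "continuous_on (U \<times> ?R) (\<lambda>(x, q). sin (fst q) *\<^sub>R F x (spherical_point q))"
    unfolding split_beta by (intro continuous_intros) simp
  then have "continuous_on U (\<lambda>x. integral ?R (\<lambda>q. sin (fst q) *\<^sub>R F x (spherical_point q)))"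
    by (rule integral_continuous_on_param)
  moreover have "integral ?R (\<lambda>q. sin (fst q) *\<^sub>R F x (spherical_point q)) = (LINT y:S2|sphere_measure. F x y)"
    if "x \<in> U" for x
  proof (rule integral_sphere_continuous[symmetric])
    have "continuous_on S2 (Pair x)" by (intro continuous_intros)
    from continuous_on_compose2[OF F this] that show "continuous_on S2 (F x)" by auto
  qed
  ultimately show ?thesis by (simp cong: continuous_on_cong)
qed

lemma continuous_on_zonal_integral:
  fixes p :: "real \<Rightarrow> real" and V :: "real^3 \<Rightarrow> real^3"
  assumes p: "continuous_on UNIV p" and V: "continuous_on S2 V"
  shows "continuous_on A (\<lambda>x. LINT y:S2|sphere_measure. (p (x \<bullet> y) * (v \<bullet> y)) *\<^sub>R V y)"
proof (rule continuous_on_sphere_integral)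
  have "continuous_on (A \<times> S2) (\<lambda>z::(real^3) \<times> (real^3). V (snd z))"
    by (rule continuous_on_compose2[OF V]) (auto intro!: continuous_intros)
  then show "continuous_on (A \<times> S2) (\<lambda>(x, y). (p (x \<bullet> y) * (v \<bullet> y)) *\<^sub>R V y)"
    unfolding split_beta by (intro continuous_intros continuous_on_compose2[OF p]) auto
qed

lemma Ck_on_1_zonal_integral:
  fixes P p :: "real \<Rightarrow> real" and V :: "real^3 \<Rightarrow> real^3"
  assumes P: "\<And>t. (P has_real_derivative p t) (at t)" and p: "continuous_on UNIV p"
    and V: "continuous_on S2 V"
  shows "Ck_on 1 (\<lambda>x. LINT y:S2|sphere_measure. P (x \<bullet> y) *\<^sub>R V y) UNIV"
proof -
  note D = has_derivative_zonal_integral[OF P p V]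
  show ?thesis
    unfolding One_nat_def Ck_on.simps frechet_derivative_at[OF D, symmetric]
    using D continuous_on_zonal_integral[OF p V] by (auto simp: differentiable_def)
qed

lemma integrable_sphere_measure_continuous:
  fixes F :: "real^3 \<Rightarrow> 'a::euclidean_space"
  assumes F: "continuous_on S2 F"
  shows "set_integrable sphere_measure S2 F"
  using integrable_sphere_continuous[OF F] continuous_on_sphere_measurable[OF F]
  unfolding sphere_measure_eq_completion set_integrable_def
  by (subst integrable_completion) auto

lemma set_integral_bounded_linear:
  assumes "bounded_linear T" and "set_integrable M A f"
  shows "T (LINT x:A|M. f x) = (LINT x:A|M. T (f x))"
proof -
  interpret T: bounded_linear T by fact
  show ?thesis
    using integral_bounded_linear[OF assms(1), of M "\<lambda>x. indicator A x *\<^sub>R f x"] assms(2)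
    by (simp add: set_lebesgue_integral_def set_integrable_def T.scaleR)
qed

text \<open>For fixed y the gradient of P (x \<bullet> y) in x is p (x \<bullet> y) y, and the curl
  of a scalar function times a constant vector is the gradient times that vector.\<close>

lemma curl_zonal_integral:
  fixes P p :: "real \<Rightarrow> real" and V :: "real^3 \<Rightarrow> real^3"
  assumes P: "\<And>t. (P has_real_derivative p t) (at t)" and p: "continuous_on UNIV p"
    and V: "continuous_on S2 V"
  shows "curl (\<lambda>x. LINT y:S2|sphere_measure. P (x \<bullet> y) *\<^sub>R V y) x
       = (LINT y:S2|sphere_measure. p (x \<bullet> y) *\<^sub>R cross3 y (V y))"
proof -
  note D = has_derivative_zonal_integral[OF P p V]
  have comp: "(LINT y:S2|sphere_measure. F y) $ i = (LINT y:S2|sphere_measure. F y $ i)"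
    if "continuous_on S2 F" for F :: "real^3 \<Rightarrow> real^3" and i
    by (rule set_integral_bounded_linear[OF bounded_linear_vec_nth integrable_sphere_measure_continuous[OF that]])
  have c: "continuous_on S2 (\<lambda>y. p (x \<bullet> y) *\<^sub>R cross3 y (V y))"
    and c': "continuous_on S2 (\<lambda>y. (p (x \<bullet> y) * (v \<bullet> y)) *\<^sub>R V y)"
    and c'': "continuous_on S2 (\<lambda>y. ((p (x \<bullet> y) * (v \<bullet> y)) *\<^sub>R V y) $ i)" for v i
    by (intro continuous_intros continuous_on_cross V continuous_on_compose2[OF p]; auto)+
  note int = integrable_sphere_measure_continuous[OF c'']
  \<comment> \<open>The index pairs (j, i) and (j', i') are the two partial derivatives that make up
    component k of a curl.\<close>
  have *: "(LINT y:S2|sphere_measure. ((p (x \<bullet> y) * (axis j 1 \<bullet> y)) *\<^sub>R V y) $ i)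
     - (LINT y:S2|sphere_measure. ((p (x \<bullet> y) * (axis j' 1 \<bullet> y)) *\<^sub>R V y) $ i')
     = (LINT y:S2|sphere_measure. (p (x \<bullet> y) *\<^sub>R cross3 y (V y)) $ k)"
    if "\<And>y. cross3 y (V y) $ k = y $ j * V y $ i - y $ j' * V y $ i'" for i j i' j' k :: 3
  proof -
    have "((p (x \<bullet> y) * (axis j 1 \<bullet> y)) *\<^sub>R V y) $ i - ((p (x \<bullet> y) * (axis j' 1 \<bullet> y)) *\<^sub>R V y) $ i'
        = (p (x \<bullet> y) *\<^sub>R cross3 y (V y)) $ k" for y
      by (simp add: that inner_axis' algebra_simps)
    then show ?thesis
      using set_integral_diff(2)[OF int[of "axis j 1" i] int[of "axis j' 1" i'], symmetric] by simp
  qed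
  show ?thesis
    unfolding curl_def Let_def frechet_derivative_at[OF D, symmetric] vec_eq_iff forall_3
      comp[OF c] comp[OF c'] vector_3
    by (intro conjI *) (simp_all add: cross3_def)
qed

section \<open>The distribution of \<open>x \<bullet> y\<close> on the sphere\<close>

text \<open>As a function J of x, the integral has derivative zero along every rotation, so J is
  constant on great circles. It is then evaluated at the pole, where \<open>x \<bullet> y\<close> is
  cos \<theta> and the substitution t = cos \<theta> absorbs the surface density.\<close>

lemma sphere_integral_zonal_const:
  fixes P p :: "real \<Rightarrow> real" and x :: "real^3"
  assumes P: "\<And>t. (P has_real_derivative p t) (at t)" and p: "continuous_on UNIV p"
    and x: "x \<in> S2"
  shows "(LINT y:S2|sphere_measure. P (x \<bullet> y)) = 2 * pi * integral {-1..1} P"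
proof -
  define e :: "real^3" where "e = axis 3 1"
  have cP: "continuous_on UNIV P"
    using P DERIV_isCont continuous_at_imp_continuous_on by blast
  define J where "J = (\<lambda>x::real^3. LINT y:S2|sphere_measure. P (x \<bullet> y))"
  \<comment> \<open>J is the third component of the zonal integral of the constant field e, so the
    vector-valued result applies.\<close>
  have DJ: "(J has_derivative (\<lambda>v. LINT y:S2|sphere_measure. p (x \<bullet> y) * (v \<bullet> y))) (at x)" for x
  proof -
    have c: "continuous_on S2 (\<lambda>y. P (x \<bullet> y) *\<^sub>R e)"
      and c': "continuous_on S2 (\<lambda>y. (p (x \<bullet> y) * (v \<bullet> y)) *\<^sub>R e)" for x v :: "real^3"
      by (intro continuous_intros continuous_on_compose2[OF p] continuous_on_compose2[OF cP]; auto)+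
    have "((\<lambda>x. (LINT y:S2|sphere_measure. P (x \<bullet> y) *\<^sub>R e) $ 3) has_derivative
      (\<lambda>v. (LINT y:S2|sphere_measure. (p (x \<bullet> y) * (v \<bullet> y)) *\<^sub>R e) $ 3)) (at x)"
      by (rule bounded_linear.has_derivative[OF bounded_linear_vec_nth
          has_derivative_zonal_integral[OF P p, of "\<lambda>_. e"]]) simp
    then show ?thesis
      by (simp add: J_def e_def
          set_integral_bounded_linear[OF bounded_linear_vec_nth integrable_sphere_measure_continuous[OF c[unfolded e_def]]]
          set_integral_bounded_linear[OF bounded_linear_vec_nth integrable_sphere_measure_continuous[OF c'[unfolded e_def]]])
  qed
  have DJ0: "(LINT y:S2|sphere_measure. p (x \<bullet> y) * (cross3 b x \<bullet> y)) = 0" for x b :: "real^3"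
  proof -
    have c: "continuous_on S2 (\<lambda>y. p (x \<bullet> y) *\<^sub>R cross3 y x)"
      by (intro continuous_intros continuous_on_cross continuous_on_compose2[OF p]) auto
    have "(LINT y:S2|sphere_measure. b \<bullet> (p (x \<bullet> y) *\<^sub>R cross3 y x)) = 0"
      using set_integral_bounded_linear[OF bounded_linear_inner_right integrable_sphere_measure_continuous[OF c], of b]
        integral_zonal_cross3_eq_0[OF P p, of x] by simp
    moreover have "b \<bullet> (p (x \<bullet> y) *\<^sub>R cross3 y x) = - (p (x \<bullet> y) * (cross3 b x \<bullet> y))" for y
      by (simp add: cross3_def inner_vec_def sum_3 algebra_simps)
    ultimately show ?thesis
      by (simp add: set_lebesgue_integral_def)
  qed
  have Jconst: "J x = J y" if "norm x = 1" "norm y = 1" "x \<bullet> y = 0" for x y :: "real^3"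
  proof -
    \<comment> \<open>A quarter of the great circle leads from x to y. Its velocity is b \<times> c
      s with the fixed axis b = x \<times> y, a direction in which J has derivative zero.\<close>
    define c where "c = (\<lambda>s. cos s *\<^sub>R x + sin s *\<^sub>R y)"
    have "((\<lambda>s. J (c s)) has_real_derivative 0) (at s)" for s
    proof -
      have dc: "(c has_vector_derivative - sin s *\<^sub>R x + cos s *\<^sub>R y) (at s)"
        unfolding c_def by (auto intro!: derivative_eq_intros simp: has_vector_derivative_def scaleR_diff_right)
      have "- sin s *\<^sub>R x + cos s *\<^sub>R y = cross3 (cross3 x y) (c s)"
      proof -
        have "cross3 (cross3 x y) z = (x \<bullet> z) *\<^sub>R y - (y \<bullet> z) *\<^sub>R x" for z
          using Lagrange[of z x y] by (simp add: cross_skew[of _ z] inner_commute)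
        then show ?thesis
          using that by (simp add: c_def inner_add_right inner_commute[of y x] dot_square_norm)
      qed
      moreover have "(LINT z:S2|sphere_measure. p (c s \<bullet> z) * (h *\<^sub>R cross3 (cross3 x y) (c s) \<bullet> z)) = 0" for h
        using DJ0[of "c s" "h *\<^sub>R cross3 x y"] by (simp add: cross_mult_left)
      ultimately show ?thesis
        using has_derivative_compose[OF dc[unfolded has_vector_derivative_def] DJ[of "c s"]]
        by (simp add: has_field_derivative_def lambda_zero)
    qed
    then have "J (c 0) = J (c (pi / 2))"
      by (rule DERIV_isconst_all[rule_format])
    then show ?thesis by (simp add: c_def)
  qed
  have "J x = J e"
  proof -
    have nx: "norm x = 1" and ne: "norm e = 1" using x by (auto simp: e_def)
    \<comment> \<open>\<open>Jconst\<close> covers orthogonal pairs, so x and the pole are linked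
      through a vector orthogonal to both: their normalised cross product, or the first axis when x
      lies on the polar axis.\<close>
    have "\<exists>z. norm z = 1 \<and> x \<bullet> z = 0 \<and> e \<bullet> z = 0"
    proof (cases "cross3 x e = 0")
      case False
      then show ?thesis
        by (intro exI[of _ "sgn (cross3 x e)"]) (simp add: norm_sgn sgn_div_norm dot_cross_self)
    next
      case True
      have axis_nth_0: "axis 3 1 $ (1::3) = (0::real)" by (simp add: axis_def)
      from True have "x $ 1 = 0"
        by (simp add: e_def cross3_def vec_eq_iff forall_3 axis_def)
      then show ?thesis
        using axis_nth_0 by (intro exI[of _ "axis 1 1"]) (simp add: e_def inner_axis)
    qed
    then show ?thesis using Jconst nx ne by metis
  qed
  also have "J e = integral (cbox (0, 0) (pi, 2 * pi)) (\<lambda>q. sin (fst q) *\<^sub>R P (cos (fst q)))"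
    unfolding J_def e_def
    by (subst integral_sphere_continuous) (auto intro!: continuous_intros continuous_on_compose2[OF cP] simp: inner_axis')
  also have "\<dots> = integral {0..pi} (\<lambda>\<theta>. integral {0..2 * pi} (\<lambda>\<phi>. sin \<theta> * P (cos \<theta>)))"
    by (subst integral_prod_continuous) (auto intro!: continuous_intros continuous_on_compose2[OF cP])
  also have "\<dots> = integral {0..pi} (\<lambda>\<theta>. (2 * pi) * (sin \<theta> * P (cos \<theta>)))"
    unfolding integral_const_real by simp
  also have "\<dots> = 2 * pi * integral {0..pi} (\<lambda>\<theta>. sin \<theta> * P (cos \<theta>))"
    by (rule integral_mult_right)
  also have "\<dots> = 2 * pi * integral {-1..1} P"
  proof -
    \<comment> \<open>Since cos decreases, \<open>{cos 0..cos pi}\<close> is empty and contributes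
      0; the other integral supplies the sign that cancels the minus of - sin.\<close>
    have "((\<lambda>\<theta>. (- sin \<theta>) *\<^sub>R P (cos \<theta>)) has_integral (integral {cos 0..cos pi} P - integral {cos pi..cos 0} P)) {0..pi}"
      by (rule has_integral_substitution_general[where s = "{}" and c = "-1" and d = 1])
         (auto intro!: derivative_eq_intros continuous_intros continuous_on_subset[OF cP])
    then have "((\<lambda>\<theta>. sin \<theta> * P (cos \<theta>)) has_integral (integral {-1..1} P)) {0..pi}"
      by (auto dest: has_integral_neg)
    then show ?thesis by (simp add: integral_unique)
  qed
  finally show ?thesis by (simp add: J_def)
qed

text \<open>Levy's uniqueness theorem concerns probability measures. The case k = 0 shows that the
  total masses agree, so both measures can be divided by the common mass c; mass zero is treated
  apart.\<close>

lemma measure_eqI_integral_iexp: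
  fixes M N :: "real measure"
  assumes fin: "finite_measure M" "finite_measure N" and sets: "sets M = sets borel" "sets N = sets borel"
    and eq: "\<And>k. (LINT t|M. iexp (k * t)) = (LINT t|N. iexp (k * t))"
  shows "M = N"
proof -
  interpret M: finite_measure M by fact
  interpret N: finite_measure N by fact
  have sp: "space M = UNIV" "space N = UNIV"
    using sets_eq_imp_space_eq[OF sets(1)] sets_eq_imp_space_eq[OF sets(2)] by auto
  have m: "measure M UNIV = measure N UNIV"
    using eq[of 0] sp by simp
  show ?thesis
  proof (cases "measure M UNIV = 0")
    case True
    then have "emeasure M UNIV = 0" "emeasure N UNIV = 0"
      using m by (auto simp: M.emeasure_eq_measure N.emeasure_eq_measure)
    then have "emeasure M A = 0" "emeasure N A = 0" for A
      using emeasure_mono[of A UNIV M] emeasure_mono[of A UNIV N] sets by auto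
    then show ?thesis
      by (intro measure_eqI) (simp_all add: sets)
  next
    case False
    define c where "c = measure M UNIV"
    have c: "c > 0" using False by (simp add: c_def order.not_eq_order_implies_strict)
    let ?s = "\<lambda>L. density L (\<lambda>_. ennreal (1 / c))"
    have rd: "real_distribution (?s L)" and char: "char (?s L) k = (LINT t|L. iexp (k * t)) / c"
      if "finite_measure L" and L [measurable_cong]: "sets L = sets borel" and "measure L UNIV = c" for L k
    proof -
      interpret L: finite_measure L by fact
      have spL: "space L = UNIV" using sets_eq_imp_space_eq[OF L] by simp
      have "emeasure (?s L) UNIV = ennreal (1 / c) * ennreal c"
        using that(3) L by (subst emeasure_density_const) (simp_all add: L.emeasure_eq_measure)
      also have "\<dots> = 1"
        using c by (simp flip: ennreal_mult)
      finally have "prob_space (?s L)"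
        by (intro prob_spaceI) (simp add: spL)
      then show "real_distribution (?s L)"
        by (simp add: real_distribution_def real_distribution_axioms_def L)
      show "char (?s L) k = (LINT t|L. iexp (k * t)) / c"
        unfolding char_def using c by (subst integral_density) (auto simp: scaleR_conv_of_real field_simps)
    qed
    have eqs: "?s M = ?s N"
    proof (rule Levy_uniqueness)
      have mc: "measure M UNIV = c" "measure N UNIV = c" by (simp_all add: c_def m)
      show "real_distribution (?s M)" "real_distribution (?s N)"
        by (rule rd[OF fin(1) sets(1) mc(1)], rule rd[OF fin(2) sets(2) mc(2)])
      show "char (?s M) = char (?s N)"
        by (rule ext) (simp only: char[OF fin(1) sets(1) mc(1)] char[OF fin(2) sets(2) mc(2)] eq)
    qed
    show ?thesis
    proof (rule measure_eqI)
      fix A assume "A \<in> sets M"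
      then have "ennreal (1 / c) * emeasure M A = ennreal (1 / c) * emeasure N A"
        using arg_cong[OF eqs, of "\<lambda>L. emeasure L A"] sets by (simp add: emeasure_density_const)
      then show "emeasure M A = emeasure N A"
        using c by (simp add: ennreal_mult_cancel_left)
    qed (simp add: sets)
  qed
qed

text \<open>Archimedes' theorem that the area of a spherical zone is proportional to its height. The
  integrals of cos (k t) and sin (k t), which are differentiable profiles, give the Fourier
  transform of the law, and this determines it; statements about measurable functions of
  \<open>x \<bullet> y\<close> follow.\<close>

lemma distr_sphere_borel_inner:
  assumes x: "x \<in> S2"
  shows "distr sphere_borel_measure borel (\<lambda>y. x \<bullet> y) = density lborel (\<lambda>t. ennreal (2 * pi * indicator {-1..1} t))"
proof (rule measure_eqI_integral_iexp)
  interpret finite_measure sphere_borel_measure by (rule finite_measure_sphere_borel)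
  show "finite_measure (distr sphere_borel_measure borel (\<lambda>y. x \<bullet> y))"
    by (rule finite_measure_distr) simp
  show "finite_measure (density lborel (\<lambda>t. ennreal (2 * pi * indicator {- 1..1::real} t)))"
  proof (rule finite_measureI)
    have "(\<integral>\<^sup>+t. ennreal (2 * pi * indicator {- 1..1::real} t) \<partial>lborel) = (\<integral>\<^sup>+t. ennreal (2 * pi) * indicator {- 1..1::real} t \<partial>lborel)"
      by (intro nn_integral_cong) (auto simp: indicator_def)
    then show "emeasure (density lborel (\<lambda>t. ennreal (2 * pi * indicator {- 1..1::real} t)))
       (space (density lborel (\<lambda>t. ennreal (2 * pi * indicator {- 1..1} t)))) \<noteq> \<infinity>"
      by (simp add: emeasure_density nn_integral_cmult ennreal_mult_eq_top_iff)
  qed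
  show "(LINT t|distr sphere_borel_measure borel ((\<bullet>) x). iexp (k * t))
      = (LINT t|density lborel (\<lambda>t. ennreal (2 * pi * indicator {- 1..1} t)). iexp (k * t))" for k
  proof -
    have real: "(LINT y|sphere_borel_measure. P (x \<bullet> y)) = 2 * pi * (LINT t:{-1..1}|lborel. P t)"
      and int: "integrable sphere_borel_measure (\<lambda>y. P (x \<bullet> y))"
      if P: "\<And>t. (P has_real_derivative p t) (at t)" and p: "continuous_on UNIV p" for P p
    proof -
      have cP: "continuous_on A P" for A
        using P DERIV_isCont continuous_at_imp_continuous_on by blast
      have [measurable]: "P \<in> borel_measurable borel"
        using cP by (rule borel_measurable_continuous_onI)
      have [measurable]: "S2 \<in> sets borel" by (simp add: borel_closed)
      have c: "continuous_on S2 (\<lambda>y. P (x \<bullet> y))"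
        by (intro continuous_on_compose2[OF cP[of UNIV]] continuous_intros) auto
      have "AE y in sphere_borel_measure. indicator S2 y *\<^sub>R P (x \<bullet> y) = P (x \<bullet> y)"
        using AE_sphere_borel by eventually_elim simp
      then show "integrable sphere_borel_measure (\<lambda>y. P (x \<bullet> y))"
        using integrable_sphere_continuous[OF c] unfolding set_integrable_def
        by (subst (asm) integrable_cong_AE) auto
      have "(LINT y|sphere_borel_measure. P (x \<bullet> y)) = (LINT y:S2|sphere_borel_measure. P (x \<bullet> y))"
        unfolding set_lebesgue_integral_def
        by (intro integral_cong_AE) (use AE_sphere_borel in \<open>auto elim!: eventually_mono\<close>)
      also have "\<dots> = (LINT y:S2|sphere_measure. P (x \<bullet> y))"
        unfolding set_lebesgue_integral_def sphere_measure_eq_completion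
        by (subst integral_completion) auto
      also have "\<dots> = 2 * pi * integral {-1..1} P"
        by (rule sphere_integral_zonal_const[OF P p x])
      also have "integral {-1..1} P = (LINT t:{-1..1}|lborel. P t)"
        by (intro set_borel_integral_eq_integral(2)[symmetric] borel_integrable_atLeastAtMost'  cP)
      finally show "(LINT y|sphere_borel_measure. P (x \<bullet> y)) = 2 * pi * (LINT t:{-1..1}|lborel. P t)" .
    qed
    have c: "((\<lambda>t. cos (k * t)) has_real_derivative - (k * sin (k * t))) (at t)"
      and s: "((\<lambda>t. sin (k * t)) has_real_derivative k * cos (k * t)) (at t)" for t
      by (auto intro!: derivative_eq_intros)
    have cc: "continuous_on UNIV (\<lambda>t. - (k * sin (k * t)))" and cs: "continuous_on UNIV (\<lambda>t. k * cos (k * t))"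
      by (intro continuous_intros)+
    have int1: "integrable lborel (\<lambda>t. indicator {-1..1} t * cos (k * t))" "integrable lborel (\<lambda>t. indicator {-1..1} t * sin (k * t))"
    proof -
      have "continuous_on {-1..1} (\<lambda>t. cos (k * t))" "continuous_on {-1..1} (\<lambda>t. sin (k * t))"
        by (intro continuous_intros)+
      from this[THEN borel_integrable_atLeastAtMost']
      show "integrable lborel (\<lambda>t. indicator {-1..1} t * cos (k * t))" "integrable lborel (\<lambda>t. indicator {-1..1} t * sin (k * t))"
        by (simp_all add: set_integrable_def)
    qed
    have e: "iexp (k * t) = complex_of_real (cos (k * t)) + \<i> * complex_of_real (sin (k * t))" for t
      by (simp add: exp_Euler cos_of_real sin_of_real flip: of_real_mult)
    have "(LINT t|distr sphere_borel_measure borel ((\<bullet>) x). iexp (k * t))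
        = (LINT y|sphere_borel_measure. complex_of_real (cos (k * (x \<bullet> y))) + \<i> * complex_of_real (sin (k * (x \<bullet> y))))"
      by (subst integral_distr, simp, simp, simp only: e)
    also have "\<dots> = complex_of_real (LINT y|sphere_borel_measure. cos (k * (x \<bullet> y))) + \<i> * complex_of_real (LINT y|sphere_borel_measure. sin (k * (x \<bullet> y)))"
      using int[OF c cc] int[OF s cs] by simp
    also have "\<dots> = complex_of_real (LINT t|lborel. 2 * pi * (indicator {-1..1} t * cos (k * t)))
        + \<i> * complex_of_real (LINT t|lborel. 2 * pi * (indicator {-1..1} t * sin (k * t)))"
      unfolding real[OF c cc] real[OF s cs] by (simp add: set_lebesgue_integral_def)
    also have "\<dots> = (LINT t|lborel. complex_of_real (2 * pi * (indicator {-1..1} t * cos (k * t)))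
        + \<i> * complex_of_real (2 * pi * (indicator {-1..1} t * sin (k * t))))"
      using int1 by (subst Bochner_Integration.integral_add) (auto simp del: of_real_mult)
    also have "\<dots> = (LINT t|density lborel (\<lambda>t. ennreal (2 * pi * indicator {- 1..1} t)). iexp (k * t))"
    proof -
      have "(LINT t|density lborel (\<lambda>t. ennreal (2 * pi * indicator {- 1..1} t)). iexp (k * t))
          = (LINT t|lborel. (2 * pi * indicator {- 1..1} t) *\<^sub>R iexp (k * t))"
        by (rule integral_density) auto
      then show ?thesis
        unfolding e scaleR_conv_of_real by (simp add: algebra_simps)
    qed
    finally show ?thesis .
  qed
qed simp_all

section \<open>Weak derivatives on an interval\<close>

text \<open>The derivative in direction v is v times f', so the induction closes only if constant
  multiples are carried along.\<close>

lemma Ck_on_closed_under_derivative: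
  fixes f :: "real \<Rightarrow> real"
  assumes closed: "\<And>f. S f \<Longrightarrow> \<exists>f'. S f' \<and> (\<forall>x. (f has_real_derivative f' x) (at x))"
    and f: "S f"
  shows "Ck_on k (\<lambda>x. f x * c) UNIV"
  using f
proof (induction k arbitrary: f c)
  case 0
  then obtain f' where "\<forall>x. (f has_real_derivative f' x) (at x)"
    using closed by blast
  then have "continuous_on UNIV f"
    by (intro continuous_at_imp_continuous_on) (auto intro: DERIV_isCont)
  then show ?case
    by (auto intro!: continuous_intros)
next
  case (Suc k)
  then obtain f' where f': "S f'" "\<And>x. (f has_real_derivative f' x) (at x)"
    using closed by blast
  have D: "((\<lambda>x. f x * c) has_derivative (\<lambda>v. f' x * (v * c))) (at x)" for x
    by (rule has_derivative_eq_rhs[OF DERIV_cmult_right[OF f'(2), of c, unfolded has_field_derivative_def]])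
       (simp add: fun_eq_iff)
  show ?case
    unfolding Ck_on.simps frechet_derivative_at[OF D, symmetric]
    using D Suc.IH[OF f'(1)] by (auto simp: differentiable_def)
qed

text \<open>The standard function exp (- 1 / t), extended by zero and divided by powers of t: these
  are the terms that its successive derivatives consist of.\<close>

definition flat :: "nat \<Rightarrow> real \<Rightarrow> real" where
  "flat k t = (if 0 < t then exp (- (1 / t)) / t ^ k else 0)"

lemma flat_tendsto_0: "(flat k \<longlongrightarrow> 0) (at 0)"
proof (rule filterlim_split_at)
  have "\<forall>\<^sub>F t in at_left 0. flat k t = 0"
    by (auto simp: flat_def eventually_at_filter)
  then show "(flat k \<longlongrightarrow> 0) (at_left 0)"
    by (rule tendsto_eventually)
  have "\<forall>\<^sub>F x in at_top. x ^ k / exp x = flat k (inverse x)"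
    using eventually_gt_at_top[of 0]
    by eventually_elim (simp add: flat_def exp_minus field_simps)
  then have "((\<lambda>x. flat k (inverse x)) \<longlongrightarrow> 0) at_top"
    using tendsto_power_div_exp_0[of k] by (rule Lim_transform_eventually[rotated])
  then show "(flat k \<longlongrightarrow> 0) (at_right 0)"
    by (simp add: filterlim_at_right_to_top)
qed

lemma DERIV_flat: "(flat k has_real_derivative - real k * flat (Suc k) t + flat (k + 2) t) (at t)"
proof (cases t "0::real" rule: linorder_cases)
  case less
  have "((\<lambda>_. 0) has_real_derivative 0) (at t)" by simp
  moreover have "\<forall>\<^sub>F x in nhds t. flat k x = 0"
    using eventually_nhds_in_open[of "{..<0}" t] less
    by (auto simp: flat_def elim: eventually_mono)
  ultimately show ?thesis
    using less by (subst DERIV_cong_ev) (auto simp: flat_def)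
next
  case equal
  \<comment> \<open>The difference quotient at 0 is the next flat function, so differentiability
    there is again a limit of the same kind.\<close>
  have "\<forall>\<^sub>F x in at 0. flat (Suc k) x = (flat k x - flat k 0) / (x - 0)"
    by (auto simp: flat_def eventually_at_filter field_simps)
  with flat_tendsto_0[of "Suc k"] have "((\<lambda>x. (flat k x - flat k 0) / (x - 0)) \<longlongrightarrow> 0) (at 0)"
    by (rule Lim_transform_eventually)
  then show ?thesis
    using equal by (simp add: has_field_derivative_iff flat_def)
next
  case greater
  have D: "((\<lambda>x. exp (- (1 / x)) / x ^ k) has_real_derivative - real k * flat (Suc k) t + flat (k + 2) t) (at t)"
  proof -
    have "((\<lambda>x. exp (- (1 / x)) * inverse (x ^ k)) has_real_derivative
       exp (- (1 / t)) * (1 / t\<^sup>2) * inverse (t ^ k) + exp (- (1 / t)) * - (inverse (t ^ k) * (real k * t ^ (k - 1)) * inverse (t ^ k))) (at t)"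
      using greater by (auto intro!: derivative_eq_intros simp: power2_eq_square field_simps)
    moreover have "exp (- (1 / t)) * (1 / t\<^sup>2) * inverse (t ^ k) + exp (- (1 / t)) * - (inverse (t ^ k) * (real k * t ^ (k - 1)) * inverse (t ^ k))
       = - real k * flat (Suc k) t + flat (k + 2) t"
      using greater by (cases k) (auto simp: flat_def power2_eq_square field_simps)
    ultimately show ?thesis by (simp add: divide_inverse)
  qed
  have "\<forall>\<^sub>F x in nhds t. flat k x = exp (- (1 / x)) / x ^ k"
    using eventually_nhds_in_open[of "{0<..}" t] greater
    by (auto simp: flat_def elim: eventually_mono)
  then show ?thesis
    using D by (subst DERIV_cong_ev) auto
qed

text \<open>Closed under differentiation, hence consisting of smooth functions; the antiderivatives provide
  smooth steps and ramps.\<close>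

inductive elementary_smooth :: "(real \<Rightarrow> real) \<Rightarrow> bool" where
  flat: "elementary_smooth (flat k)"
| const: "elementary_smooth (\<lambda>_. c)"
| add: "elementary_smooth f \<Longrightarrow> elementary_smooth g \<Longrightarrow> elementary_smooth (\<lambda>t. f t + g t)"
| mult: "elementary_smooth f \<Longrightarrow> elementary_smooth g \<Longrightarrow> elementary_smooth (\<lambda>t. f t * g t)"
| affine: "elementary_smooth f \<Longrightarrow> elementary_smooth (\<lambda>t. f (c * t + d))"
| antiderivative: "elementary_smooth f \<Longrightarrow> (\<And>t. (F has_real_derivative f t) (at t)) \<Longrightarrow> elementary_smooth F"

lemma elementary_smooth_derivative:
  assumes "elementary_smooth f"
  shows "\<exists>f'. elementary_smooth f' \<and> (\<forall>x. (f has_real_derivative f' x) (at x))"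
  using assms
proof induction
  case (flat k)
  show ?case
    using DERIV_flat elementary_smooth.add[OF elementary_smooth.mult[OF elementary_smooth.const elementary_smooth.flat] elementary_smooth.flat]
    by (intro exI[of _ "\<lambda>t. - real k * flat (Suc k) t + flat (k + 2) t"] conjI allI)
next
  case (const c)
  show ?case
    by (intro exI[of _ "\<lambda>_. 0"] conjI elementary_smooth.const) simp
next
  case (add f g)
  then obtain f' g' where *: "elementary_smooth f'" "elementary_smooth g'"
      "\<And>x. (f has_real_derivative f' x) (at x)" "\<And>x. (g has_real_derivative g' x) (at x)" by blast
  show ?case
    by (intro exI[of _ "\<lambda>t. f' t + g' t"] conjI allI elementary_smooth.add DERIV_add *)
next
  case (mult f g)
  then obtain f' g' where *: "elementary_smooth f'" "elementary_smooth g'"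
      "\<And>x. (f has_real_derivative f' x) (at x)" "\<And>x. (g has_real_derivative g' x) (at x)" by blast
  show ?case
    by (intro exI[of _ "\<lambda>t. f' t * g t + g' t * f t"] conjI allI DERIV_mult
        elementary_smooth.add elementary_smooth.mult mult.hyps *)
next
  case (affine f c d)
  then obtain f' where f': "elementary_smooth f'" "\<And>x. (f has_real_derivative f' x) (at x)" by blast
  have "((\<lambda>t. f (c * t + d)) has_real_derivative f' (c * x + d) * c) (at x)" for x
    by (rule DERIV_chain2[OF f'(2)]) (auto intro!: derivative_eq_intros)
  then show ?case
    by (intro exI[of _ "\<lambda>t. f' (c * t + d) * c"] conjI allI
        elementary_smooth.mult[OF elementary_smooth.affine[OF f'(1)] elementary_smooth.const])
next
  case (antiderivative f F)
  then show ?case by blast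
qed

lemma elementary_smooth_imp_smooth_on:
  assumes "elementary_smooth f"
  shows "smooth_on f UNIV"
  using Ck_on_closed_under_derivative[of elementary_smooth f _ 1] elementary_smooth_derivative assms
  by (simp add: smooth_on_def)

lemma continuous_antiderivative:
  fixes f :: "real \<Rightarrow> real"
  assumes "continuous_on UNIV f"
  shows "\<exists>F. F t0 = y0 \<and> (\<forall>t. (F has_real_derivative f t) (at t))"
proof -
  have "\<exists>F. \<forall>x. - \<infinity> < ereal x \<longrightarrow> ereal x < \<infinity> \<longrightarrow> (F has_vector_derivative f x) (at x)"
    by (rule einterval_antiderivative) (use assms in \<open>auto simp: continuous_on_eq_continuous_at\<close>)
  then obtain F where F: "\<And>t. (F has_real_derivative f t) (at t)"
    by (auto simp: has_real_derivative_iff_has_vector_derivative)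
  have "((\<lambda>t. F t - F t0 + y0) has_real_derivative f t) (at t)" for t
    using F[of t] by (auto intro!: derivative_eq_intros)
  then show ?thesis
    by (intro exI[of _ "\<lambda>t. F t - F t0 + y0"]) simp
qed

text \<open>A smooth step S, its derivative \<rho> and its primitive T, a ramp. The rescaled ramps
  \<eta> T ((t - u) / \<eta>) tend to max 0 (t - u) as \<eta> tends to 0, and their derivatives to
  the sharp step at u; test functions whose derivatives approximate the indicator of an interval are
  made from them.\<close>

lemma smooth_ramp_exists:
  obtains T S \<rho> :: "real \<Rightarrow> real"
  where "elementary_smooth T" "elementary_smooth S" "continuous_on UNIV \<rho>"
    and "\<And>t. (T has_real_derivative S t) (at t)" "\<And>t. (S has_real_derivative \<rho> t) (at t)"
    and "\<And>t. t \<le> 0 \<or> 1 \<le> t \<Longrightarrow> \<rho> t = 0"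
    and "\<And>t. t \<le> 0 \<Longrightarrow> S t = 0" "\<And>t. 1 \<le> t \<Longrightarrow> S t = 1" "\<And>t. 0 \<le> S t" "\<And>t. S t \<le> 1"
    and "\<And>t. t \<le> 0 \<Longrightarrow> T t = 0" "\<And>t. 1 \<le> t \<Longrightarrow> T t = T 1 + t - 1"
    and "\<And>t. 0 \<le> T t" "\<And>t. 0 \<le> t \<Longrightarrow> T t \<le> t"
proof -
  \<comment> \<open>A bump that is positive exactly on (0, 1), with 1 - t written in the shape of
    the rule \<open>affine\<close>. Its primitive, divided by the total mass F 1, becomes the
    step.\<close>
  define b where "b = (\<lambda>t. flat 0 t * flat 0 (-1 * t + 1))"
  have sb: "elementary_smooth b"
    unfolding b_def
    by (rule elementary_smooth.mult[OF elementary_smooth.flat elementary_smooth.affine[OF elementary_smooth.flat]])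
  have cont: "continuous_on UNIV f" if es: "elementary_smooth f" for f
    using elementary_smooth_derivative[OF es]
    by (auto intro!: continuous_at_imp_continuous_on intro: DERIV_isCont)
  obtain F where F0: "F 0 = 0" and F: "\<And>t. (F has_real_derivative b t) (at t)"
    using continuous_antiderivative[OF cont[OF sb]] by blast
  have b: "b t \<ge> 0" "t \<le> 0 \<or> 1 \<le> t \<Longrightarrow> b t = 0" "0 < t \<Longrightarrow> t < 1 \<Longrightarrow> 0 < b t" for t
    by (auto simp: b_def flat_def)
  have const: "f s = f t" if "\<And>z. (f has_real_derivative f' z) (at z)" "s \<le> t" "\<And>z. s \<le> z \<Longrightarrow> z \<le> t \<Longrightarrow> f' z = 0"
    for f f' :: "real \<Rightarrow> real" and s t
  proof (cases "s = t")
    case False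
    then show ?thesis
      using that by (intro DERIV_isconst_end[symmetric]) (auto intro!: continuous_at_imp_continuous_on DERIV_isCont, metis less_imp_le)
  qed simp
  have F1: "0 < F 1"
    using DERIV_pos_imp_increasing_open[of 0 1 F] F b(3) F0
    by (auto intro!: continuous_at_imp_continuous_on DERIV_isCont[OF F])
  define S where "S = (\<lambda>t. F t * (1 / F 1))"
  have S: "(S has_real_derivative b t * (1 / F 1)) (at t)" for t
    unfolding S_def by (intro DERIV_cmult_right F)
  have sS: "elementary_smooth S"
    unfolding S_def
    by (rule elementary_smooth.mult[OF elementary_smooth.antiderivative[OF sb F] elementary_smooth.const])
  have S0: "S t = 0" if "t \<le> 0" for t
    using const[OF F that] b(2) F0 by (simp add: S_def)
  have S1: "S t = 1" if "1 \<le> t" for t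
    using const[OF F that] b(2) F1 by (simp add: S_def)
  have mono: "f s \<le> f t" if "\<And>z. (f has_real_derivative f' z) (at z)" "\<And>z. 0 \<le> f' z" "s \<le> t"
    for f f' :: "real \<Rightarrow> real" and s t
    using that DERIV_nonneg_imp_nondecreasing[of s t f] by blast
  have Smono: "S s \<le> S t" if "s \<le> t" for s t
    using mono[OF S _ that] b(1) F1 by simp
  have Snn: "0 \<le> S t" and Sle: "S t \<le> 1" for t
    using Smono[of "min t 0" t] S0[of "min t 0"] Smono[of t "max t 1"] S1[of "max t 1"] by auto
  obtain T where T0: "T 0 = 0" and T: "\<And>t. (T has_real_derivative S t) (at t)"
    using continuous_antiderivative[OF cont[OF sS]] by blast
  have T0': "T t = 0" if "t \<le> 0" for t
    using const[OF T that] S0 T0 by simp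
  \<comment> \<open>The defect t - T t never decreases, and it is constant from 1 on: the first fact
    gives T t \<le> t, the second the exact form of T beyond 1.\<close>
  have D1: "((\<lambda>t. t - T t) has_real_derivative 1 - S t) (at t)" for t
    by (auto intro!: derivative_eq_intros T)
  show thesis
  proof (rule that[of T S "\<lambda>t. b t * (1 / F 1)"])
    show "elementary_smooth T" by (rule elementary_smooth.antiderivative[OF sS T])
    show "continuous_on UNIV (\<lambda>t. b t * (1 / F 1))" by (intro continuous_intros cont sb)
    show "b t * (1 / F 1) = 0" if "t \<le> 0 \<or> 1 \<le> t" for t
      using b(2)[OF that] by simp
    show "T t = T 1 + t - 1" if "1 \<le> t" for t
      using const[OF D1 that] S1 by simp
    show "0 \<le> T t" for t
      using mono[OF T Snn, of "min t 0" t] T0'[of "min t 0"] by simp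
    show "T t \<le> t" if "0 \<le> t" for t
      using mono[OF D1 _ that] Sle T0 by simp
  qed (fact sS S T S0 S1 Snn Sle T0')+
qed

section \<open>Recovering a function from its weak derivative\<close>

lemma AE_lebesgue_differentiation_right:
  fixes G :: "real \<Rightarrow> real"
  assumes G: "integrable lebesgue G"
  shows "AE x in lebesgue. ((\<lambda>\<eta>. (LINT t|lebesgue. indicator {x<..x + \<eta>} t * G t) / \<eta>) \<longlongrightarrow> G x) (at_right 0)"
proof -
  have "G integrable_on cbox a b" for a b
    using integrable_on_lebesgue[OF G] integrable_on_subcbox by blast
  then obtain N where N: "negligible N" and lim: "\<And>x e. x \<notin> N \<Longrightarrow> 0 < e \<Longrightarrow>
      \<exists>d>0. \<forall>h. 0 < h \<and> h < d \<longrightarrow> norm (integral (cbox x (x + h *\<^sub>R One)) G /\<^sub>R h ^ DIM(real) - G x) < e"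
    using integrable_ccontinuous_explicit[of G] by blast
  have eq: "(LINT t|lebesgue. indicator {x<..x + \<eta>} t * G t) = integral {x..x + \<eta>} G" for x \<eta>
  proof -
    have "AE t in lebesgue. t \<noteq> x"
      using AE_completion[OF AE_lborel_singleton[of x]] .
    then have "AE t in lebesgue. indicator {x<..x + \<eta>} t * G t = indicator {x..x + \<eta>} t *\<^sub>R G t"
      by eventually_elim (auto simp: indicator_def)
    then have "(LINT t|lebesgue. indicator {x<..x + \<eta>} t * G t) = (LINT t:{x..x + \<eta>}|lebesgue. G t)"
      unfolding set_lebesgue_integral_def
      by (intro integral_cong_AE borel_measurable_times borel_measurable_scaleR borel_measurable_indicator
          borel_measurable_integrable[OF G]) auto
    moreover have "set_integrable lebesgue {x..x + \<eta>} G"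
      using G by (simp add: set_integrable_def integrable_mult_indicator[of _ lebesgue G, simplified])
    ultimately show ?thesis
      using set_lebesgue_integral_eq_integral(2) by metis
  qed
  have "((\<lambda>\<eta>. (LINT t|lebesgue. indicator {x<..x + \<eta>} t * G t) / \<eta>) \<longlongrightarrow> G x) (at_right 0)" if "x \<notin> N" for x
  proof (rule tendstoI)
    fix e :: real assume "0 < e"
    from lim[OF that this] obtain d where d: "d > 0"
      "\<And>h. 0 < h \<Longrightarrow> h < d \<Longrightarrow> norm (integral {x..x + h} G / h - G x) < e"
      by (auto simp: divide_inverse mult.commute)
    then show "\<forall>\<^sub>F \<eta> in at_right 0. dist ((LINT t|lebesgue. indicator {x<..x + \<eta>} t * G t) / \<eta>) (G x) < e"
      unfolding eq eventually_at_right_field by (auto simp: dist_norm)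
  qed
  then show ?thesis
    using N by (intro AE_I'[of N]) (auto simp: negligible_iff_null_sets)
qed

text \<open>The bound on the multipliers is required only where G does not vanish: ramps are
  unbounded on the line, but G will be cut off to a compact interval.\<close>

lemma integral_lebesgue_dominated_mult:
  fixes G :: "real \<Rightarrow> real"
  assumes G: "integrable lebesgue G"
    and c: "\<And>n. \<psi> n \<in> borel_measurable borel" and c': "\<psi>' \<in> borel_measurable borel"
    and bound: "\<And>n t. G t \<noteq> 0 \<Longrightarrow> \<bar>\<psi> n t\<bar> \<le> M"
    and lim: "\<And>t. (\<lambda>n. \<psi> n t) \<longlonglongrightarrow> \<psi>' t"
  shows "(\<lambda>n. LINT t|lebesgue. G t * \<psi> n t) \<longlonglongrightarrow> (LINT t|lebesgue. G t * \<psi>' t)"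
proof (rule integral_dominated_convergence[where w = "\<lambda>t. \<bar>G t\<bar> * M"])
  note [measurable] = borel_measurable_integrable[OF G]
  have [measurable]: "\<psi> n \<in> borel_measurable lebesgue" "\<psi>' \<in> borel_measurable lebesgue" for n
    using c c' by (auto intro: measurable_completion)
  show "(\<lambda>t. G t * \<psi>' t) \<in> borel_measurable lebesgue" "(\<lambda>t. G t * \<psi> n t) \<in> borel_measurable lebesgue" for n
    by measurable
  show "integrable lebesgue (\<lambda>t. \<bar>G t\<bar> * M)"
    using G by auto
  show "AE t in lebesgue. (\<lambda>n. G t * \<psi> n t) \<longlonglongrightarrow> G t * \<psi>' t"
    by (intro AE_I2 tendsto_intros lim)
  have "norm (G t * \<psi> n t) \<le> \<bar>G t\<bar> * M" for n t
    using bound[of t n] by (cases "G t = 0") (auto simp: abs_mult intro!: mult_left_mono)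
  then show "AE t in lebesgue. norm (G t * \<psi> n t) \<le> \<bar>G t\<bar> * M" for n
    by simp
qed

text \<open>A test function has compact support, so its derivative has integral zero and cannot
  approximate the indicator of (x, y] itself; y - x times a fixed unit bump r is subtracted, and the
  pairing of g with r ends up in the constant. The signed indicator writes the oriented integral
  from m to x for both orders of the two points.\<close>

lemma weak_derivative_AE_eq_primitive:
  assumes W: "has_weak_derivative_on g h a b" and m: "a < m" "m < b"
  shows "\<exists>C. AE x in lebesgue. a < x \<and> x < b \<longrightarrow>
    g x = C + (LINT t|lebesgue. (indicator {m<..x} t - indicator {x<..m} t) * h t)"
proof -
  obtain T S \<rho> :: "real \<Rightarrow> real"
    where sT: "elementary_smooth T" and sS: "elementary_smooth S" and c\<rho>: "continuous_on UNIV \<rho>"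
    and DT: "\<And>t. (T has_real_derivative S t) (at t)" and DS: "\<And>t. (S has_real_derivative \<rho> t) (at t)"
    and \<rho>0: "\<And>t. t \<le> 0 \<or> 1 \<le> t \<Longrightarrow> \<rho> t = 0"
    and S0: "\<And>t. t \<le> 0 \<Longrightarrow> S t = 0" and S1: "\<And>t. 1 \<le> t \<Longrightarrow> S t = 1" and Snn: "\<And>t. 0 \<le> S t" and Sle: "\<And>t. S t \<le> 1"
    and T0: "\<And>t. t \<le> 0 \<Longrightarrow> T t = 0" and T1: "\<And>t. 1 \<le> t \<Longrightarrow> T t = T 1 + t - 1"
    and Tnn: "\<And>t. 0 \<le> T t" and Tle: "\<And>t. 0 \<le> t \<Longrightarrow> T t \<le> t"
    by (rule smooth_ramp_exists) blast
  have cS: "continuous_on UNIV S" and cT: "continuous_on UNIV T"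
    using DERIV_isCont[OF DS] DERIV_isCont[OF DT] by (auto intro: continuous_at_imp_continuous_on)
  \<comment> \<open>R is a smooth step from 0 to 1 on [m, m + d], half of the way from m to b, and r
    is its derivative, a bump of integral 1.\<close>
  define d where "d = (b - m) / 2"
  have d: "d > 0" "m + d < b" using m by (simp_all add: d_def field_simps)
  define R where "R = (\<lambda>t. S ((t - m) / d))"
  define r where "r = (\<lambda>t. \<rho> ((t - m) / d) / d)"
  have DR: "(R has_real_derivative r t) (at t)" for t
    unfolding R_def r_def by (rule DERIV_chain2[OF DS, THEN DERIV_cong]) (use d in \<open>auto intro!: derivative_eq_intros\<close>)
  have cR: "continuous_on UNIV R" and cr: "continuous_on UNIV r"
    unfolding R_def r_def
    by (auto intro!: continuous_intros continuous_on_compose2[OF cS] continuous_on_compose2[OF c\<rho>] simp: d less_imp_neq[OF d(1), symmetric])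
  have [measurable]: "R \<in> borel_measurable borel" "r \<in> borel_measurable borel"
      "S \<in> borel_measurable borel" "T \<in> borel_measurable borel"
    using cR cr cS cT by (auto intro: borel_measurable_continuous_onI)
  have sR: "elementary_smooth R"
    using elementary_smooth.affine[OF sS, of "1 / d" "- m / d"] d by (simp add: R_def diff_divide_distrib)
  have R0: "t \<le> m \<Longrightarrow> R t = 0" and R1: "m + d \<le> t \<Longrightarrow> R t = 1" and r0: "t \<le> m \<or> m + d \<le> t \<Longrightarrow> r t = 0" for t
    unfolding R_def r_def using d by (auto intro!: S0 S1 \<rho>0 simp: field_simps)
  have R01: "0 \<le> R t" "R t \<le> 1" for t
    by (auto simp: R_def Snn Sle)
  \<comment> \<open>Smooth test functions whose derivatives tend boundedly to the difference of the indicator of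
    an interval and a fixed bump of the same integral.\<close>
  have interval: "(LINT t|lebesgue. (indicator {\<alpha>..\<beta>} t * g t) * (indicator {x<..y} t - (y - x) * r t))
      = - (LINT t|lebesgue. (indicator {\<alpha>..\<beta>} t * h t) * (max 0 (t - x) - max 0 (t - y) - (y - x) * R t))"
    if \<alpha>: "a < \<alpha>" "\<alpha> \<le> m" "\<alpha> \<le> x" and xy: "x < y" and \<beta>: "y < \<beta>" "m + d \<le> \<beta>" "\<beta> < b" for \<alpha> \<beta> x y
  proof -
    have "set_integrable lebesgue {\<alpha>..\<beta>} g \<and> set_integrable lebesgue {\<alpha>..\<beta>} h"
      using W \<alpha> \<beta> unfolding has_weak_derivative_on_def by (auto dest!: conjunct1 spec[of _ "{\<alpha>..\<beta>}"])
    then have int: "integrable lebesgue (\<lambda>t. indicator {\<alpha>..\<beta>} t * g t)" "integrable lebesgue (\<lambda>t. indicator {\<alpha>..\<beta>} t * h t)"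
      by (auto simp: set_integrable_def)
    \<comment> \<open>Widths of the smooth transitions; with at most \<beta> - y, the one that
      starts at y is finished at \<beta>.\<close>
    define \<eta> where "\<eta> = (\<lambda>n. (\<beta> - y) * inverse (real (Suc n)))"
    have \<eta>: "0 < \<eta> n" "\<eta> n \<le> \<beta> - y" for n
    proof -
      show "0 < \<eta> n" using \<beta> by (simp add: \<eta>_def)
      show "\<eta> n \<le> \<beta> - y"
        unfolding \<eta>_def using \<beta> by (intro mult_left_le) (auto simp: inverse_le_1_iff)
    qed
    have \<eta>_lim: "\<eta> \<longlonglongrightarrow> 0"
      unfolding \<eta>_def using tendsto_mult_right_zero[OF LIMSEQ_inverse_real_of_nat] by blast
    define A where "A = (\<lambda>n u t. \<eta> n * T ((t - u) / \<eta> n))"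
    define B where "B = (\<lambda>n u t. S ((t - u) / \<eta> n))"
    have DA: "(A n u has_real_derivative B n u t) (at t)" for n u t
    proof -
      have "((\<lambda>t. T ((t - u) / \<eta> n)) has_real_derivative S ((t - u) / \<eta> n) * (1 / \<eta> n)) (at t)"
        by (rule DERIV_chain2[OF DT]) (use \<eta>(1)[of n] in \<open>auto intro!: derivative_eq_intros\<close>)
      from DERIV_cmult[OF this, of "\<eta> n"] \<eta>(1)[of n] show ?thesis
        by (simp add: A_def B_def)
    qed
    have sA: "elementary_smooth (A n u)" for n u
      using elementary_smooth.mult[OF elementary_smooth.const elementary_smooth.affine[OF sT, of "1 / \<eta> n" "- u / \<eta> n"], of "\<eta> n"]
      by (simp add: A_def diff_divide_distrib)
    have A_meas [measurable]: "A n u \<in> borel_measurable borel" and B_meas [measurable]: "B n u \<in> borel_measurable borel" for n u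
      unfolding A_def B_def by measurable
    have A0: "t \<le> u \<Longrightarrow> A n u t = 0" and A1: "u + \<eta> n \<le> t \<Longrightarrow> A n u t = \<eta> n * (T 1 - 1) + (t - u)"
      and B0: "t \<le> u \<Longrightarrow> B n u t = 0" and B1: "u + \<eta> n \<le> t \<Longrightarrow> B n u t = 1" for n u t
    proof -
      show "t \<le> u \<Longrightarrow> A n u t = 0" "t \<le> u \<Longrightarrow> B n u t = 0"
        using \<eta>(1)[of n] by (auto simp: A_def B_def divide_nonpos_pos intro: T0 S0)
      assume "u + \<eta> n \<le> t"
      then have 1: "1 \<le> (t - u) / \<eta> n" using \<eta>(1)[of n] by (simp add: field_simps)
      then show "B n u t = 1" by (simp add: B_def S1)
      show "A n u t = \<eta> n * (T 1 - 1) + (t - u)"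
        using \<eta>(1)[of n] unfolding A_def T1[OF 1] by (simp add: field_simps)
    qed
    have Abd: "0 \<le> A n u t" "A n u t \<le> max 0 (t - u)" for n u t
    proof -
      show "0 \<le> A n u t" using Tnn \<eta>(1)[of n] by (simp add: A_def)
      show "A n u t \<le> max 0 (t - u)"
      proof (cases "t \<le> u")
        case False
        then have "\<eta> n * T ((t - u) / \<eta> n) \<le> \<eta> n * ((t - u) / \<eta> n)"
          using \<eta>(1)[of n] by (intro mult_left_mono Tle) auto
        then show ?thesis using \<eta>(1)[of n] by (simp add: A_def)
      qed (simp add: A0)
    qed
    have ev: "\<forall>\<^sub>F n in sequentially. u + \<eta> n \<le> t" if "u < t" for u t
      using order_tendstoD(2)[OF \<eta>_lim, of "t - u"] that by (auto elim: eventually_mono)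
    have Alim: "(\<lambda>n. A n u t) \<longlonglongrightarrow> max 0 (t - u)" for u t
    proof (cases "t \<le> u")
      case False
      have "(\<lambda>n. \<eta> n * (T 1 - 1) + (t - u)) \<longlonglongrightarrow> 0 * (T 1 - 1) + (t - u)"
        by (intro tendsto_intros \<eta>_lim)
      moreover have "\<forall>\<^sub>F n in sequentially. \<eta> n * (T 1 - 1) + (t - u) = A n u t"
        using ev[of u t] False by (auto elim!: eventually_mono simp: A1)
      ultimately show ?thesis
        using False Lim_transform_eventually by fastforce
    qed (simp add: A0)
    have Blim: "(\<lambda>n. B n u t) \<longlonglongrightarrow> indicator {u<..} t" for u t
    proof (cases "t \<le> u")
      case False
      then have "\<forall>\<^sub>F n in sequentially. B n u t = 1"
        using ev[of u t] by (auto elim!: eventually_mono simp: B1)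
      then show ?thesis using False by (auto intro: tendsto_eventually)
    qed (simp add: B0)
    define \<phi> where "\<phi> = (\<lambda>n t. A n x t - A n y t - (y - x) * R t)"
    define \<phi>' where "\<phi>' = (\<lambda>n t. B n x t - B n y t - (y - x) * r t)"
    have D\<phi>: "(\<phi> n has_real_derivative \<phi>' n t) (at t)" for n t
      unfolding \<phi>_def \<phi>'_def by (intro DERIV_diff DERIV_cmult DA DR)
    have s\<phi>: "smooth_on (\<phi> n) UNIV" for n
    proof (rule elementary_smooth_imp_smooth_on)
      have "elementary_smooth (\<lambda>t. (A n x t + (-1) * A n y t) + (x - y) * R t)"
        by (rule elementary_smooth.add[OF elementary_smooth.add[OF sA elementary_smooth.mult[OF elementary_smooth.const sA]]
              elementary_smooth.mult[OF elementary_smooth.const sR]])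
      moreover have "(\<lambda>t. (A n x t + (-1) * A n y t) + (x - y) * R t) = \<phi> n"
        by (simp add: \<phi>_def fun_eq_iff algebra_simps)
      ultimately show "elementary_smooth (\<phi> n)" by simp
    qed
    \<comment> \<open>To the right of all transitions both ramps carry the same offset \<eta> n (T 1
      - 1). It cancels in their difference, which is exactly y - x there and is removed by (y - x)
      R: the support stays inside the compact interval.\<close>
    have out: "\<phi> n t = 0" "\<phi>' n t = 0" if "t \<notin> {\<alpha>..\<beta>}" for n t
    proof -
      have "t \<le> x \<and> t \<le> y \<and> t \<le> m \<or> x + \<eta> n \<le> t \<and> y + \<eta> n \<le> t \<and> m + d \<le> t"
        using that \<alpha> \<beta> xy \<eta>[of n] by auto
      then show "\<phi> n t = 0" "\<phi>' n t = 0"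
        by (auto simp: \<phi>_def \<phi>'_def A0 A1 B0 B1 R0 R1 r0)
    qed
    have supp: "closure {t. \<phi> n t \<noteq> 0} \<subseteq> {\<alpha>..\<beta>}" for n
      using out(1) by (intro closure_minimal) (blast, simp)
    then have "compact (closure {t. \<phi> n t \<noteq> 0})" for n
      by (metis closed_closure compact_Icc compact_Int_closed inf.absorb2)
    moreover have "closure {t. \<phi> n t \<noteq> 0} \<subseteq> {a<..<b}" for n
      using supp[of n] \<alpha> \<beta> by (auto simp: subset_iff)
    ultimately have "(LINT t:{a<..<b}|lebesgue. g t * deriv (\<phi> n) t) = - (LINT t:{a<..<b}|lebesgue. h t * \<phi> n t)" for n
      using W s\<phi> unfolding has_weak_derivative_on_def by blast
    moreover have "(LINT t:{a<..<b}|lebesgue. g t * deriv (\<phi> n) t) = (LINT t|lebesgue. (indicator {\<alpha>..\<beta>} t * g t) * \<phi>' n t)" for n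
      unfolding set_lebesgue_integral_def DERIV_imp_deriv[OF D\<phi>]
      using out(2) \<alpha> \<beta> by (intro Bochner_Integration.integral_cong) (auto simp: indicator_def)
    moreover have "(LINT t:{a<..<b}|lebesgue. h t * \<phi> n t) = (LINT t|lebesgue. (indicator {\<alpha>..\<beta>} t * h t) * \<phi> n t)" for n
      unfolding set_lebesgue_integral_def
      using out(1) \<alpha> \<beta> by (intro Bochner_Integration.integral_cong) (auto simp: indicator_def)
    ultimately have eq: "(LINT t|lebesgue. (indicator {\<alpha>..\<beta>} t * g t) * \<phi>' n t)
        = - (LINT t|lebesgue. (indicator {\<alpha>..\<beta>} t * h t) * \<phi> n t)" for n
      by simp
    have "compact (r ` {\<alpha>..\<beta>})"
      by (intro compact_continuous_image continuous_on_subset[OF cr]) auto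
    then have "bounded (r ` {\<alpha>..\<beta>})" by (rule compact_imp_bounded)
    then obtain Mr where "\<forall>z\<in>r ` {\<alpha>..\<beta>}. norm z \<le> Mr" unfolding bounded_iff by blast
    then have Mr: "\<bar>r t\<bar> \<le> Mr" if "t \<in> {\<alpha>..\<beta>}" for t using that by simp
    have lim1: "(\<lambda>n. LINT t|lebesgue. (indicator {\<alpha>..\<beta>} t * g t) * \<phi>' n t) \<longlonglongrightarrow>
       (LINT t|lebesgue. (indicator {\<alpha>..\<beta>} t * g t) * (indicator {x<..y} t - (y - x) * r t))"
    proof (rule integral_lebesgue_dominated_mult[OF int(1)])
      show "\<phi>' n \<in> borel_measurable borel" for n unfolding \<phi>'_def by measurable
      show "\<bar>\<phi>' n t\<bar> \<le> 2 + (y - x) * Mr" if "indicator {\<alpha>..\<beta>} t * g t \<noteq> 0" for n t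
      proof -
        have "t \<in> {\<alpha>..\<beta>}" using that by (auto split: split_indicator_asm)
        then have "\<bar>(y - x) * r t\<bar> \<le> (y - x) * Mr"
          using Mr xy by (simp add: abs_mult)
        moreover have "0 \<le> B n u t" "B n u t \<le> 1" for u by (auto simp: B_def Snn Sle)
        ultimately show ?thesis
          unfolding \<phi>'_def using \<open>\<And>u. 0 \<le> B n u t\<close>[of x] \<open>\<And>u. 0 \<le> B n u t\<close>[of y] \<open>\<And>u. B n u t \<le> 1\<close>[of x] \<open>\<And>u. B n u t \<le> 1\<close>[of y]
          by linarith
      qed
      have "indicator {x<..} t - indicator {y<..} t = (indicator {x<..y} t :: real)" for t
        using xy by (auto simp: indicator_def)
      then show "(\<lambda>n. \<phi>' n t) \<longlonglongrightarrow> indicator {x<..y} t - (y - x) * r t" for t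
        unfolding \<phi>'_def
        using tendsto_diff[OF tendsto_diff[OF Blim[of x t] Blim[of y t]] tendsto_const[of "(y - x) * r t"]] by simp
    qed measurable
    have lim2: "(\<lambda>n. LINT t|lebesgue. (indicator {\<alpha>..\<beta>} t * h t) * \<phi> n t) \<longlonglongrightarrow>
       (LINT t|lebesgue. (indicator {\<alpha>..\<beta>} t * h t) * (max 0 (t - x) - max 0 (t - y) - (y - x) * R t))"
    proof (rule integral_lebesgue_dominated_mult[OF int(2)])
      show "\<phi> n \<in> borel_measurable borel" for n unfolding \<phi>_def by measurable
      show "\<bar>\<phi> n t\<bar> \<le> 2 * (\<beta> - \<alpha>) + (y - x)" if "indicator {\<alpha>..\<beta>} t * h t \<noteq> 0" for n t
      proof -
        have t: "t \<in> {\<alpha>..\<beta>}" using that by (auto split: split_indicator_asm)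
        define z where "z = (y - x) * R t"
        have "0 \<le> z" "z \<le> y - x"
          unfolding z_def using R01[of t] xy by (auto intro: mult_left_le)
        moreover have "\<alpha> \<le> \<beta>" using t by simp
        moreover have "A n x t \<le> \<beta> - \<alpha>" "A n y t \<le> \<beta> - \<alpha>"
          using Abd(2)[of n x t] Abd(2)[of n y t] t \<alpha> xy by auto
        ultimately show ?thesis
          unfolding \<phi>_def z_def[symmetric] using Abd(1)[of n x t] Abd(1)[of n y t] xy by (smt (verit))
      qed
      show "(\<lambda>n. \<phi> n t) \<longlonglongrightarrow> max 0 (t - x) - max 0 (t - y) - (y - x) * R t" for t
        unfolding \<phi>_def by (intro tendsto_diff tendsto_const Alim)
    qed measurable
    show ?thesis
      using LIMSEQ_unique[OF lim1] tendsto_minus[OF lim2] unfolding eq by blast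
  qed
  \<comment> \<open>The terms without x that remain in the limit: the average of g against the bump,
    and the mismatch between R and the sharp step at m.\<close>
  define C where "C = (LINT t|lebesgue. indicator {m..m + d} t * g t * r t)
      + (LINT t|lebesgue. indicator {m<..m + d} t * h t * (R t - 1))"
  \<comment> \<open>Dividing by \<open>y - x\<close> and letting \<open>y\<close> tend to \<open>x\<close> yields \<open>g x\<close> at almost every \<open>x\<close>, by Lebesgue differentiation.\<close>
  have main: "AE x in lebesgue. \<alpha> < x \<and> x < \<beta> \<longrightarrow>
    g x = C + (LINT t|lebesgue. (indicator {m<..x} t - indicator {x<..m} t) * h t)"
    if \<alpha>: "a < \<alpha>" "\<alpha> \<le> m" and \<beta>: "m + d \<le> \<beta>" "\<beta> < b" for \<alpha> \<beta>
  proof -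
    have "set_integrable lebesgue {\<alpha>..\<beta>} g \<and> set_integrable lebesgue {\<alpha>..\<beta>} h"
      using W \<alpha> \<beta> unfolding has_weak_derivative_on_def by (auto dest!: conjunct1 spec[of _ "{\<alpha>..\<beta>}"])
    then have int: "integrable lebesgue (\<lambda>t. indicator {\<alpha>..\<beta>} t * g t)" "integrable lebesgue (\<lambda>t. indicator {\<alpha>..\<beta>} t * h t)"
      by (auto simp: set_integrable_def)
    have intmul: "integrable lebesgue (\<lambda>t. F t * \<psi> t)"
      if "integrable lebesgue F" "\<psi> \<in> borel_measurable borel" "\<And>t. F t \<noteq> 0 \<Longrightarrow> \<bar>\<psi> t\<bar> \<le> M" for F \<psi> :: "real \<Rightarrow> real" and M
    proof (rule Bochner_Integration.integrable_bound)
      show "integrable lebesgue (\<lambda>t. F t * M)" using that(1) by simp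
      have "norm (F t * \<psi> t) \<le> norm (F t * M)" for t
        using that(3)[of t] by (cases "F t = 0") (auto simp: abs_mult intro!: mult_left_mono)
      then show "AE t in lebesgue. norm (F t * \<psi> t) \<le> norm (F t * M)" by simp
      show "(\<lambda>t. F t * \<psi> t) \<in> borel_measurable lebesgue"
        using that(2) by (intro borel_measurable_times borel_measurable_integrable[OF that(1)]) (auto intro: measurable_completion)
    qed
    have "compact (r ` {\<alpha>..\<beta>})"
      by (intro compact_continuous_image continuous_on_subset[OF cr]) auto
    then have "bounded (r ` {\<alpha>..\<beta>})" by (rule compact_imp_bounded)
    then obtain Mr where "\<forall>z\<in>r ` {\<alpha>..\<beta>}. norm z \<le> Mr" unfolding bounded_iff by blast
    then have Mr: "\<bar>r t\<bar> \<le> Mr" if "t \<in> {\<alpha>..\<beta>}" for t using that by simp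
    note diff = AE_lebesgue_differentiation_right[OF int(1)]
    show ?thesis
      using diff
    proof eventually_elim
      case (elim x)
      show ?case
      proof (intro impI, elim conjE)
        assume x: "\<alpha> < x" "x < \<beta>"
        \<comment> \<open>Half of the distance keeps x + \<eta> n strictly below \<beta>, as
          \<open>interval\<close> demands of its right end point.\<close>
        define \<eta> where "\<eta> = (\<lambda>n. ((\<beta> - x) / 2) * inverse (real (Suc n)))"
        have \<eta>: "0 < \<eta> n" "\<eta> n < \<beta> - x" for n
        proof -
          show "0 < \<eta> n" using x by (auto simp: \<eta>_def)
          have "\<eta> n \<le> (\<beta> - x) / 2"
            unfolding \<eta>_def using x by (intro mult_left_le) (auto simp: inverse_le_1_iff)
          then show "\<eta> n < \<beta> - x" using x by simp
        qed
        have \<eta>_lim: "\<eta> \<longlonglongrightarrow> 0"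
          unfolding \<eta>_def using tendsto_mult_right_zero[OF LIMSEQ_inverse_real_of_nat] by blast
        have "filterlim \<eta> (at_right 0) sequentially"
          using \<eta>_lim \<eta>(1) by (auto simp: filterlim_at less_imp_neq[OF \<eta>(1), symmetric])
        from filterlim_compose[OF elim this]
        have L1: "(\<lambda>n. (LINT t|lebesgue. indicator {x<..x + \<eta> n} t * (indicator {\<alpha>..\<beta>} t * g t)) / \<eta> n) \<longlonglongrightarrow> g x"
          using x by simp
        \<comment> \<open>The multiplier of h in \<open>interval\<close>, divided by \<eta> n: a
          ramp of height 1 minus R. It is bounded by 1 and tends to the sharp step at x minus
          R.\<close>
        define q where "q = (\<lambda>n t. (max 0 (t - x) - max 0 (t - (x + \<eta> n))) / \<eta> n - R t)"
        have q_lim: "(\<lambda>n. q n t) \<longlonglongrightarrow> indicator {x<..} t - R t" for t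
        proof (cases "t \<le> x")
          case True
          then have "q n t = indicator {x<..} t - R t" for n
            using \<eta>(1)[of n] by (simp add: q_def)
          then show ?thesis by simp
        next
          case False
          then have "\<forall>\<^sub>F n in sequentially. \<eta> n < t - x"
            using order_tendstoD(2)[OF \<eta>_lim, of "t - x"] by simp
          then have "\<forall>\<^sub>F n in sequentially. q n t = indicator {x<..} t - R t"
          proof eventually_elim
            case (elim n)
            then show ?case using \<eta>(1)[of n] False by (simp add: q_def)
          qed
          then show ?thesis by (rule tendsto_eventually)
        qed
        have q_bound: "\<bar>q n t\<bar> \<le> 1" for n t
        proof -
          have "0 \<le> (max 0 (t - x) - max 0 (t - (x + \<eta> n))) / \<eta> n" "(max 0 (t - x) - max 0 (t - (x + \<eta> n))) / \<eta> n \<le> 1"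
            using \<eta>(1)[of n] by (auto simp: field_simps max_def)
          then show ?thesis unfolding q_def using R01[of t] by (simp add: abs_le_iff)
        qed
        have L2: "(\<lambda>n. LINT t|lebesgue. (indicator {\<alpha>..\<beta>} t * h t) * q n t) \<longlonglongrightarrow>
            (LINT t|lebesgue. (indicator {\<alpha>..\<beta>} t * h t) * (indicator {x<..} t - R t))"
          by (rule integral_lebesgue_dominated_mult[OF int(2) _ _ q_bound q_lim]) (unfold q_def, measurable)
        let ?G = "LINT t|lebesgue. (indicator {\<alpha>..\<beta>} t * g t) * r t"
        have "(LINT t|lebesgue. indicator {x<..x + \<eta> n} t * (indicator {\<alpha>..\<beta>} t * g t)) / \<eta> n
          = ?G - (LINT t|lebesgue. (indicator {\<alpha>..\<beta>} t * h t) * q n t)" for n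
        proof -
          have i1: "integrable lebesgue (\<lambda>t. (indicator {\<alpha>..\<beta>} t * g t) * indicator {x<..x + \<eta> n} t)"
            by (rule intmul[OF int(1), of _ 1]) (auto simp: indicator_def)
          have i2: "integrable lebesgue (\<lambda>t. (indicator {\<alpha>..\<beta>} t * g t) * r t)"
            by (rule intmul[OF int(1), of _ Mr]) (use Mr in \<open>auto split: split_indicator_asm\<close>)
          have "(LINT t|lebesgue. (indicator {\<alpha>..\<beta>} t * g t) * indicator {x<..x + \<eta> n} t - \<eta> n * ((indicator {\<alpha>..\<beta>} t * g t) * r t))
             = - (LINT t|lebesgue. \<eta> n * ((indicator {\<alpha>..\<beta>} t * h t) * q n t))"
          proof -
            have "(indicator {\<alpha>..\<beta>} t * h t) * (max 0 (t - x) - max 0 (t - (x + \<eta> n)) - \<eta> n * R t)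
               = \<eta> n * ((indicator {\<alpha>..\<beta>} t * h t) * q n t)" for t
              using \<eta>(1)[of n] by (simp add: q_def field_simps)
            then show ?thesis
              using interval[of \<alpha> x "x + \<eta> n" \<beta>] \<alpha> \<beta> x \<eta>[of n] by (simp add: algebra_simps)
          qed
          then have "(LINT t|lebesgue. (indicator {\<alpha>..\<beta>} t * g t) * indicator {x<..x + \<eta> n} t) - \<eta> n * ?G
             = - \<eta> n * (LINT t|lebesgue. (indicator {\<alpha>..\<beta>} t * h t) * q n t)"
            using i1 i2 by (subst (asm) Bochner_Integration.integral_diff) auto
          then show ?thesis
            using \<eta>(1)[of n] by (simp add: field_simps)
        qed
        with L1 have "(\<lambda>n. ?G - (LINT t|lebesgue. (indicator {\<alpha>..\<beta>} t * h t) * q n t)) \<longlonglongrightarrow> g x"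
          by simp
        then have gx: "g x = ?G - (LINT t|lebesgue. (indicator {\<alpha>..\<beta>} t * h t) * (indicator {x<..} t - R t))"
          using LIMSEQ_unique tendsto_diff[OF tendsto_const L2] by blast
        have "?G = (LINT t|lebesgue. indicator {m..m + d} t * g t * r t)"
          using \<alpha> \<beta> r0 by (intro Bochner_Integration.integral_cong) (auto simp: indicator_def)
        moreover have "- (LINT t|lebesgue. (indicator {\<alpha>..\<beta>} t * h t) * (indicator {x<..} t - R t))
          = (LINT t|lebesgue. indicator {m<..m + d} t * h t * (R t - 1))
            + (LINT t|lebesgue. (indicator {m<..x} t - indicator {x<..m} t) * h t)"
        proof -
          let ?H = "\<lambda>t. indicator {\<alpha>..\<beta>} t * h t"
          have i3: "integrable lebesgue (\<lambda>t. ?H t * (R t - indicator {m<..} t))"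
          proof (rule intmul[OF int(2), of _ 1])
            show "\<bar>R t - indicator {m<..} t\<bar> \<le> 1" for t
              using R01[of t] by (cases "m < t") auto
          qed measurable
          have i4: "integrable lebesgue (\<lambda>t. ?H t * (indicator {m<..x} t - indicator {x<..m} t))"
            by (intro intmul[OF int(2), of _ 1]) (auto simp: indicator_def)
          \<comment> \<open>The step at x is the step at m minus the signed indicator of the
            interval between m and x. This separates the part that depends on x.\<close>
          have "- (LINT t|lebesgue. ?H t * (indicator {x<..} t - R t))
              = (LINT t|lebesgue. ?H t * (R t - indicator {m<..} t) + ?H t * (indicator {m<..x} t - indicator {x<..m} t))"
            unfolding Bochner_Integration.integral_minus[symmetric]
            by (intro Bochner_Integration.integral_cong) (auto simp: indicator_def algebra_simps)
          also have "\<dots> = (LINT t|lebesgue. ?H t * (R t - indicator {m<..} t)) + (LINT t|lebesgue. ?H t * (indicator {m<..x} t - indicator {x<..m} t))"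
            by (rule Bochner_Integration.integral_add[OF i3 i4])
          also have "(LINT t|lebesgue. ?H t * (R t - indicator {m<..} t)) = (LINT t|lebesgue. indicator {m<..m + d} t * h t * (R t - 1))"
            using \<alpha> \<beta> by (intro Bochner_Integration.integral_cong) (auto simp: indicator_def R0 R1)
          also have "(LINT t|lebesgue. ?H t * (indicator {m<..x} t - indicator {x<..m} t)) = (LINT t|lebesgue. (indicator {m<..x} t - indicator {x<..m} t) * h t)"
            using \<alpha> \<beta> x d by (intro Bochner_Integration.integral_cong) (auto simp: indicator_def)
          finally show ?thesis .
        qed
        ultimately show "g x = C + (LINT t|lebesgue. (indicator {m<..x} t - indicator {x<..m} t) * h t)"
          using gx unfolding C_def by simp
      qed
    qed
  qed
  \<comment> \<open>The exceptional null set depends on the compact interval; countably many such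
    intervals, all containing [m, m + d], exhaust (a, b).\<close>
  define \<alpha> where "\<alpha> = (\<lambda>n. a + (m - a) * inverse (real (Suc (Suc n))))"
  define \<beta> where "\<beta> = (\<lambda>n. b - (b - (m + d)) * inverse (real (Suc n)))"
  have "AE x in lebesgue. \<forall>n. \<alpha> n < x \<and> x < \<beta> n \<longrightarrow>
    g x = C + (LINT t|lebesgue. (indicator {m<..x} t - indicator {x<..m} t) * h t)"
    unfolding AE_all_countable
  proof
    fix n
    show "AE x in lebesgue. \<alpha> n < x \<and> x < \<beta> n \<longrightarrow>
      g x = C + (LINT t|lebesgue. (indicator {m<..x} t - indicator {x<..m} t) * h t)"
    proof (rule main)
      show "a < \<alpha> n" "\<beta> n < b" using m d by (auto simp: \<alpha>_def \<beta>_def)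
      have "(m - a) * inverse (real (Suc (Suc n))) \<le> m - a"
        using m by (intro mult_left_le) (auto simp: inverse_le_1_iff)
      then show "\<alpha> n \<le> m" by (simp add: \<alpha>_def)
      have "(b - (m + d)) * inverse (real (Suc n)) \<le> b - (m + d)"
        using d by (intro mult_left_le) (auto simp: inverse_le_1_iff)
      then show "m + d \<le> \<beta> n" by (simp add: \<beta>_def)
    qed
  qed
  moreover have "\<exists>n. \<alpha> n < x \<and> x < \<beta> n" if "a < x" "x < b" for x
  proof -
    have "\<alpha> \<longlonglongrightarrow> a + (m - a) * 0" "\<beta> \<longlonglongrightarrow> b - (b - (m + d)) * 0"
      unfolding \<alpha>_def \<beta>_def
      by (intro tendsto_intros LIMSEQ_inverse_real_of_nat LIMSEQ_Suc[OF LIMSEQ_inverse_real_of_nat])+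
    then have "\<forall>\<^sub>F n in sequentially. \<alpha> n < x" "\<forall>\<^sub>F n in sequentially. x < \<beta> n"
      using that order_tendstoD by fastforce+
    then show ?thesis
      using eventually_happens'[OF _ eventually_conj] sequentially_bot by blast
  qed
  ultimately show ?thesis
    by (intro exI[of _ C]) (auto elim!: eventually_mono)
qed

section \<open>Approximation of the kernel\<close>

lemma clamp_tendsto:
  fixes z :: real
  shows "(\<lambda>n. max (- real n) (min (real n) z)) \<longlonglongrightarrow> z"
proof (rule tendsto_eventually)
  obtain k where "\<bar>z\<bar> \<le> real k" using real_arch_simple by blast
  then have "max (- real n) (min (real n) z) = z" if "k \<le> n" for n
    using that by (auto simp: max_def min_def)
  then show "\<forall>\<^sub>F n in sequentially. max (- real n) (min (real n) z) = z"
    using eventually_sequentially by blast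
qed

text \<open>Clamping h at a level B costs little, by dominated convergence with the integrable w
  |h|. Measurability then gives continuous functions that converge to h almost everywhere; after
  clamping they are still continuous and are dominated by 2 B w, which is integrable because w
  is.\<close>

lemma weighted_L1_continuous_approximation:
  fixes w h :: "real \<Rightarrow> real"
  assumes w [measurable]: "w \<in> borel_measurable borel" and w01: "\<And>t. 0 \<le> w t" and w: "integrable lborel w"
    and h [measurable]: "h \<in> borel_measurable borel" and int: "integrable lborel (\<lambda>t. w t * h t)" and e: "0 < e"
  shows "\<exists>p. continuous_on UNIV p \<and> integrable lborel (\<lambda>t. w t * \<bar>p t - h t\<bar>) \<and> (LINT t|lborel. w t * \<bar>p t - h t\<bar>) < e"
proof -
  define cl where "cl = (\<lambda>n z. max (- real n) (min (real n) z))"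
  have [measurable]: "cl n \<in> borel_measurable borel" for n unfolding cl_def by measurable
  have clb: "\<bar>cl n z\<bar> \<le> real n" "\<bar>cl n z - z\<bar> \<le> \<bar>z\<bar>" for n z
    by (auto simp: cl_def max_def min_def abs_if)
  have ccl: "continuous_on UNIV (cl n)" for n
    unfolding cl_def by (intro continuous_intros)
  have int1: "integrable lborel (\<lambda>t. w t * \<bar>cl n (h t) - h t\<bar>)" for n
  proof (rule Bochner_Integration.integrable_bound[OF int])
    show "AE t in lborel. norm (w t * \<bar>cl n (h t) - h t\<bar>) \<le> norm (w t * h t)"
      using clb(2) w01 by (intro AE_I2) (auto simp: abs_mult intro: mult_left_mono)
  qed measurable
  have "(\<lambda>n. LINT t|lborel. w t * \<bar>cl n (h t) - h t\<bar>) \<longlonglongrightarrow> (LINT t|(lborel::real measure). 0)"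
  proof (rule integral_dominated_convergence[where w = "\<lambda>t. \<bar>w t * h t\<bar>"])
    have "(\<lambda>n. w t * \<bar>cl n (h t) - h t\<bar>) \<longlonglongrightarrow> w t * \<bar>h t - h t\<bar>" for t
      unfolding cl_def by (intro tendsto_intros clamp_tendsto)
    then show "AE t in lborel. (\<lambda>n. w t * \<bar>cl n (h t) - h t\<bar>) \<longlonglongrightarrow> 0" by simp
    show "AE t in lborel. norm (w t * \<bar>cl n (h t) - h t\<bar>) \<le> \<bar>w t * h t\<bar>" for n
      using clb(2) w01 by (intro AE_I2) (auto simp: abs_mult intro: mult_left_mono)
  qed (use int in auto)
  then have "\<forall>\<^sub>F n in sequentially. (LINT t|lborel. w t * \<bar>cl n (h t) - h t\<bar>) < e / 2"
    using e by (intro order_tendstoD(2)) auto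
  then obtain B where B: "(LINT t|lborel. w t * \<bar>cl B (h t) - h t\<bar>) < e / 2"
    using eventually_happens'[OF sequentially_bot] by blast
  have "h measurable_on UNIV"
    by (rule lebesgue_measurable_imp_measurable_on) (auto intro: measurable_completion)
  then obtain N F where N: "negligible N" and cF: "\<And>n. continuous_on UNIV (F n)"
    and F: "\<And>t. t \<notin> N \<Longrightarrow> (\<lambda>n. F n t) \<longlonglongrightarrow> h t"
    unfolding measurable_on_def by auto
  have [measurable]: "F n \<in> borel_measurable borel" for n
    using cF by (rule borel_measurable_continuous_onI)
  have AE: "AE t in lborel. (\<lambda>n. F n t) \<longlonglongrightarrow> h t"
  proof -
    have "AE t in lebesgue. (\<lambda>n. F n t) \<longlonglongrightarrow> h t"
      using N F by (intro AE_I'[of N]) (auto simp: negligible_iff_null_sets)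
    then show ?thesis by (simp add: AE_completion_iff)
  qed
  have b2: "w t * \<bar>cl B (F n t) - cl B (h t)\<bar> \<le> w t * (2 * real B)" for n t
    using clb(1)[of B "F n t"] clb(1)[of B "h t"] w01[of t] by (intro mult_left_mono) auto
  have int2: "integrable lborel (\<lambda>t. w t * \<bar>cl B (F n t) - cl B (h t)\<bar>)" for n
  proof (rule Bochner_Integration.integrable_bound)
    show "integrable lborel (\<lambda>t. w t * (2 * real B))" using w by simp
    show "AE t in lborel. norm (w t * \<bar>cl B (F n t) - cl B (h t)\<bar>) \<le> norm (w t * (2 * real B))"
      using b2[of _ n] w01 by (intro AE_I2) (simp add: abs_mult)
  qed measurable
  have "(\<lambda>n. LINT t|lborel. w t * \<bar>cl B (F n t) - cl B (h t)\<bar>) \<longlonglongrightarrow> (LINT t|(lborel::real measure). 0)"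
  proof (rule integral_dominated_convergence[where w = "\<lambda>t. w t * (2 * real B)"])
    show "AE t in lborel. (\<lambda>n. w t * \<bar>cl B (F n t) - cl B (h t)\<bar>) \<longlonglongrightarrow> 0"
      using AE
    proof eventually_elim
      case (elim t)
      have "(\<lambda>n. cl B (F n t)) \<longlonglongrightarrow> cl B (h t)"
        unfolding cl_def by (intro tendsto_intros elim)
      then have "(\<lambda>n. w t * \<bar>cl B (F n t) - cl B (h t)\<bar>) \<longlonglongrightarrow> w t * \<bar>cl B (h t) - cl B (h t)\<bar>"
        by (intro tendsto_intros)
      then show ?case by simp
    qed
    show "AE t in lborel. norm (w t * \<bar>cl B (F n t) - cl B (h t)\<bar>) \<le> w t * (2 * real B)" for n
      using b2[of _ n] w01 by (intro AE_I2) (simp add: abs_mult)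
    show "integrable lborel (\<lambda>t. w t * (2 * real B))" using w by simp
  qed auto
  then have "\<forall>\<^sub>F n in sequentially. (LINT t|lborel. w t * \<bar>cl B (F n t) - cl B (h t)\<bar>) < e / 2"
    using e by (intro order_tendstoD(2)) auto
  then obtain n where n: "(LINT t|lborel. w t * \<bar>cl B (F n t) - cl B (h t)\<bar>) < e / 2"
    using eventually_happens'[OF sequentially_bot] by blast
  define p where "p = (\<lambda>t. cl B (F n t))"
  have b3: "w t * \<bar>p t - h t\<bar> \<le> w t * \<bar>cl B (F n t) - cl B (h t)\<bar> + w t * \<bar>cl B (h t) - h t\<bar>" for t
    unfolding distrib_left[symmetric] p_def using w01[of t] by (intro mult_left_mono) auto
  have [measurable]: "p \<in> borel_measurable borel" unfolding p_def by measurable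
  have int3: "integrable lborel (\<lambda>t. w t * \<bar>p t - h t\<bar>)"
  proof (rule Bochner_Integration.integrable_bound[OF Bochner_Integration.integrable_add[OF int2[of n] int1[of B]]])
    show "AE t in lborel. norm (w t * \<bar>p t - h t\<bar>)
        \<le> norm (w t * \<bar>cl B (F n t) - cl B (h t)\<bar> + w t * \<bar>cl B (h t) - h t\<bar>)"
      using b3 w01 by (intro AE_I2) (simp add: abs_mult)
  qed measurable
  have "(LINT t|lborel. w t * \<bar>p t - h t\<bar>)
      \<le> (LINT t|lborel. w t * \<bar>cl B (F n t) - cl B (h t)\<bar> + w t * \<bar>cl B (h t) - h t\<bar>)"
    using b3 by (intro integral_mono int3 Bochner_Integration.integrable_add int2 int1)
  also have "\<dots> < e"
    using n B by (simp add: int1 int2)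
  finally show ?thesis
    using int3 by (intro exI[of _ p]) (auto simp: p_def intro!: continuous_on_compose2[OF ccl cF])
qed

text \<open>By Tonelli. For fixed s, the points t such that s lies between 0 and t reach from s to
  the end of the interval on the same side; they have total length 1 - |s|, which is at most the
  weight.\<close>

lemma nn_integral_primitive_le:
  fixes q :: "real \<Rightarrow> real"
  assumes [measurable]: "q \<in> borel_measurable borel" and q: "\<And>s. 0 \<le> q s"
  shows "(\<integral>\<^sup>+t. indicator {-1<..<1} t * (\<integral>\<^sup>+s. ennreal ((indicator {0<..t} s + indicator {t<..0} s) * q s) \<partial>lborel) \<partial>lborel)
    \<le> (\<integral>\<^sup>+s. ennreal (indicator {-1<..<1} s * sqrt (1 - s\<^sup>2) * q s) \<partial>lborel)"
proof -
  have meas: "case_prod (\<lambda>s t. indicator {-1<..<1} t * ennreal ((indicator {0<..t} s + indicator {t<..0} s) * q s))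
      \<in> borel_measurable (lborel \<Otimes>\<^sub>M lborel)"
  proof -
    have [measurable]: "(fst :: real \<times> real \<Rightarrow> real) \<in> borel_measurable (lborel \<Otimes>\<^sub>M lborel)"
      "(snd :: real \<times> real \<Rightarrow> real) \<in> borel_measurable (lborel \<Otimes>\<^sub>M lborel)"
      using measurable_fst[of "lborel :: real measure" "lborel :: real measure"]
        measurable_snd[of "lborel :: real measure" "lborel :: real measure"] by simp_all
    have [measurable]: "Measurable.pred (lborel \<Otimes>\<^sub>M lborel) (\<lambda>z. fst z \<in> {0<..snd z :: real})"
       "Measurable.pred (lborel \<Otimes>\<^sub>M lborel) (\<lambda>z. fst z \<in> {snd z<..(0::real)})"
      unfolding greaterThanAtMost_iff by measurable
    show ?thesis
      unfolding split_beta indicator_def by measurable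
  qed
  have "(\<integral>\<^sup>+t. indicator {-1<..<1} t * (\<integral>\<^sup>+s. ennreal ((indicator {0<..t} s + indicator {t<..0} s) * q s) \<partial>lborel) \<partial>lborel)
    = (\<integral>\<^sup>+t. (\<integral>\<^sup>+s. indicator {-1<..<1} t * ennreal ((indicator {0<..t} s + indicator {t<..0} s) * q s) \<partial>lborel) \<partial>lborel)"
    by (intro nn_integral_cong nn_integral_cmult[symmetric]) measurable
  also have "\<dots> = (\<integral>\<^sup>+s. (\<integral>\<^sup>+t. indicator {-1<..<1} t * ennreal ((indicator {0<..t} s + indicator {t<..0} s) * q s) \<partial>lborel) \<partial>lborel)"
    by (rule lborel_pair.Fubini'[OF meas])
  also have "\<dots> \<le> (\<integral>\<^sup>+s. ennreal (indicator {-1<..<1} s * sqrt (1 - s\<^sup>2) * q s) \<partial>lborel)"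
  proof (rule nn_integral_mono)
    fix s :: real
    have "(\<integral>\<^sup>+t. indicator {-1<..<1} t * ennreal ((indicator {0<..t} s + indicator {t<..0} s) * q s) \<partial>lborel)
       = (\<integral>\<^sup>+t. ennreal (q s) * indicator (if 0 < s then {s..<1} else {-1<..<s}) t * indicator {-1<..<1} s \<partial>lborel)"
      by (intro nn_integral_cong) (auto simp: indicator_def)
    also have "\<dots> = ennreal (q s) * emeasure lborel (if 0 < s then {s..<1} else {-1<..<s}) * indicator {-1<..<1} s"
      by (subst nn_integral_multc) (auto simp: nn_integral_cmult)
    also have "\<dots> = ennreal (indicator {-1<..<1} s * (1 - \<bar>s\<bar>) * q s)"
      using q[of s] by (auto simp: indicator_def mult.commute simp flip: ennreal_mult)
    also have "\<dots> \<le> ennreal (indicator {-1<..<1} s * sqrt (1 - s\<^sup>2) * q s)"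
    proof (rule ennreal_leI, rule mult_right_mono[OF _ q])
      have "1 - \<bar>s\<bar> \<le> sqrt (1 - s\<^sup>2)" if "\<bar>s\<bar> < 1"
      proof (rule real_le_rsqrt)
        have "\<bar>s\<bar> * \<bar>s\<bar> \<le> \<bar>s\<bar> * 1" using that by (intro mult_left_mono) auto
        then show "(1 - \<bar>s\<bar>)\<^sup>2 \<le> 1 - s\<^sup>2"
          by (simp add: power2_eq_square algebra_simps)
      qed
      then show "indicator {-1<..<1} s * (1 - \<bar>s\<bar>) \<le> indicator {-1<..<1} s * sqrt (1 - s\<^sup>2)"
        by (auto simp: indicator_def)
    qed
    finally show "(\<integral>\<^sup>+t. indicator {-1<..<1} t * ennreal ((indicator {0<..t} s + indicator {t<..0} s) * q s) \<partial>lborel)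
       \<le> ennreal (indicator {-1<..<1} s * sqrt (1 - s\<^sup>2) * q s)" .
  qed
  finally show ?thesis .
qed

text \<open>The difference of two primitives with the same value at 0 is the oriented integral of p
  - h. The absolute value of the signed indicator is the sum of the two indicators, hence the sum in
  the bound.\<close>

lemma primitive_difference_le:
  fixes P p h :: "real \<Rightarrow> real"
  assumes P: "\<And>t. (P has_real_derivative p t) (at t)" and p: "continuous_on UNIV p"
    and h [measurable]: "h \<in> borel_measurable borel"
    and int: "integrable lborel (\<lambda>s. (indicator {0<..t} s + indicator {t<..0} s) * h s)"
  shows "ennreal \<bar>P t - (P 0 + (LINT s|lborel. (indicator {0<..t} s - indicator {t<..0} s) * h s))\<bar>
    \<le> (\<integral>\<^sup>+s. ennreal ((indicator {0<..t} s + indicator {t<..0} s) * \<bar>p s - h s\<bar>) \<partial>lborel)"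
proof -
  have [measurable]: "p \<in> borel_measurable borel"
    using p by (rule borel_measurable_continuous_onI)
  let ?J = "\<lambda>s. indicator {0<..t} s - indicator {t<..0} s :: real"
  let ?K = "\<lambda>s. indicator {0<..t} s + indicator {t<..0} s :: real"
  have FTC: "(LINT s|lborel. indicator {a<..b} s * p s) = P b - P a" "integrable lborel (\<lambda>s. indicator {a<..b} s * p s)"
    if "a \<le> b" for a b
  proof -
    have i: "integrable lborel (\<lambda>s. indicator {a..b} s *\<^sub>R p s)"
      using borel_integrable_atLeastAtMost'[OF continuous_on_subset[OF p]] by (simp add: set_integrable_def)
    have "AE s in lborel. s \<noteq> a" by (rule AE_lborel_singleton)
    then have ae: "AE s in lborel. indicator {a..b} s *\<^sub>R p s = indicator {a<..b} s * p s"
      by eventually_elim (auto simp: indicator_def)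
    show "integrable lborel (\<lambda>s. indicator {a<..b} s * p s)"
      by (rule integrable_cong_AE_imp[OF i _ ae]) measurable
    have "(LINT s|lborel. indicator {a<..b} s * p s) = (LINT s|lborel. indicator {a..b} s *\<^sub>R p s)"
      using ae by (intro integral_cong_AE) auto
    also have "\<dots> = P b - P a"
    proof (rule integral_FTC_atLeastAtMost[OF that])
      show "(P has_vector_derivative p s) (at s within {a..b})" for s
        using P[of s] by (simp add: has_real_derivative_iff_has_vector_derivative has_vector_derivative_at_within)
      show "continuous_on {a..b} p" using p continuous_on_subset by blast
    qed
    finally show "(LINT s|lborel. indicator {a<..b} s * p s) = P b - P a" .
  qed
  have intp: "integrable lborel (\<lambda>s. ?J s * p s)" and eq: "(LINT s|lborel. ?J s * p s) = P t - P 0"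
  proof -
    have "integrable lborel (\<lambda>s. ?J s * p s) \<and> (LINT s|lborel. ?J s * p s) = P t - P 0"
    proof (cases "0 \<le> t")
      case True
      then show ?thesis using FTC[of 0 t] True by simp
    next
      case False
      then show ?thesis using FTC[of t 0] False by simp
    qed
    then show "integrable lborel (\<lambda>s. ?J s * p s)" "(LINT s|lborel. ?J s * p s) = P t - P 0" by blast+
  qed
  have inth: "integrable lborel (\<lambda>s. ?J s * h s)"
  proof (rule Bochner_Integration.integrable_bound[OF int])
    show "AE s in lborel. norm (?J s * h s) \<le> norm (?K s * h s)"
      by (intro AE_I2) (auto simp: abs_mult split: split_indicator intro!: mult_right_mono)
  qed measurable
  have E: "P t - (P 0 + (LINT s|lborel. ?J s * h s)) = (LINT s|lborel. ?J s * p s - ?J s * h s)"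
    unfolding Bochner_Integration.integral_diff[OF intp inth] eq by (simp only: diff_diff_eq)
  have "ennreal \<bar>P t - (P 0 + (LINT s|lborel. ?J s * h s))\<bar> \<le> (\<integral>\<^sup>+s. ennreal \<bar>?J s * p s - ?J s * h s\<bar> \<partial>lborel)"
    using integral_norm_bound_ennreal[OF Bochner_Integration.integrable_diff[OF intp inth]]
    unfolding real_norm_def E .
  also have "\<dots> = (\<integral>\<^sup>+s. ennreal (?K s * \<bar>p s - h s\<bar>) \<partial>lborel)"
  proof (rule nn_integral_cong, rule arg_cong[where f = ennreal])
    fix s
    have "\<bar>?J s\<bar> = ?K s" by (auto split: split_indicator)
    then show "\<bar>?J s * p s - ?J s * h s\<bar> = ?K s * \<bar>p s - h s\<bar>"
      by (metis abs_mult right_diff_distrib)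
  qed
  finally show ?thesis .
qed

text \<open>Between 0 and t the weight is at least sqrt (1 - t^2), which is positive, so it can be
  divided out.\<close>

lemma integrable_interval_weight:
  fixes h :: "real \<Rightarrow> real"
  assumes h [measurable]: "h \<in> borel_measurable borel"
    and int: "integrable lborel (\<lambda>s. indicator {-1<..<1} s * sqrt (1 - s\<^sup>2) * h s)"
    and t: "-1 < t" "t < 1"
  shows "integrable lborel (\<lambda>s. (indicator {0<..t} s + indicator {t<..0} s) * h s)"
proof -
  have pos: "0 < sqrt (1 - t\<^sup>2)"
    using t by (simp add: abs_square_less_1 abs_less_iff)
  show ?thesis
  proof (rule Bochner_Integration.integrable_bound)
    show "integrable lborel (\<lambda>s. indicator {-1<..<1} s * sqrt (1 - s\<^sup>2) * h s / sqrt (1 - t\<^sup>2))"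
      using int by simp
    have "norm ((indicator {0<..t} s + indicator {t<..0} s) * h s)
        \<le> norm (indicator {-1<..<1} s * sqrt (1 - s\<^sup>2) * h s / sqrt (1 - t\<^sup>2))" for s
    proof (cases "s \<in> {0<..t} \<or> s \<in> {t<..0}")
      case True
      then have "\<bar>s\<bar> \<le> \<bar>t\<bar>" and s: "-1 < s" "s < 1" using t by auto
      then have "s\<^sup>2 \<le> t\<^sup>2" by (simp add: abs_le_square_iff)
      then have "sqrt (1 - t\<^sup>2) * \<bar>h s\<bar> \<le> sqrt (1 - s\<^sup>2) * \<bar>h s\<bar>"
        by (intro mult_right_mono) auto
      then have "\<bar>h s\<bar> \<le> sqrt (1 - s\<^sup>2) * \<bar>h s\<bar> / sqrt (1 - t\<^sup>2)"
        using pos by (simp add: pos_le_divide_eq mult.commute)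
      moreover have "\<bar>sqrt (1 - s\<^sup>2)\<bar> = sqrt (1 - s\<^sup>2)"
        using s by (simp add: abs_square_le_1 abs_le_iff)
      moreover have "(indicator {0<..t} s + indicator {t<..0} s :: real) = 1"
        using True by (auto simp: indicator_def)
      ultimately show ?thesis using s pos by (simp add: abs_mult)
    qed (auto simp: indicator_def)
    then show "AE s in lborel. norm ((indicator {0<..t} s + indicator {t<..0} s) * h s)
        \<le> norm (indicator {-1<..<1} s * sqrt (1 - s\<^sup>2) * h s / sqrt (1 - t\<^sup>2))"
      by (intro AE_I2)
  qed measurable
qed

text \<open>Borel representatives g0 and h0 appear because a merely Lebesgue measurable function
  need not stay Borel after composition with \<open>x \<bullet> y\<close>. The weighted L^1
  approximation of h0 also yields that of g0, by integration from 0.\<close>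

lemma kernel_approximation:
  fixes g h :: "real \<Rightarrow> real"
  assumes W: "has_weak_derivative_on g h (-1) 1"
    and g: "set_integrable lebesgue {-1<..<1} g"
    and h: "set_integrable lebesgue {-1<..<1} (\<lambda>t. sqrt (1 - t\<^sup>2) * h t)"
  shows "\<exists>g0 h0. g0 \<in> borel_measurable borel \<and> h0 \<in> borel_measurable borel
    \<and> (AE t in lborel. -1 < t \<and> t < 1 \<longrightarrow> g t = g0 t \<and> h t = h0 t)
    \<and> integrable lborel (\<lambda>t. indicator {-1<..<1} t * g0 t)
    \<and> integrable lborel (\<lambda>t. indicator {-1<..<1} t * sqrt (1 - t\<^sup>2) * h0 t)
    \<and> (\<forall>n. \<exists>P p. (\<forall>t. (P has_real_derivative p t) (at t)) \<and> continuous_on UNIV p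
      \<and> (\<integral>\<^sup>+t. ennreal (indicator {-1<..<1} t * \<bar>P t - g0 t\<bar>) \<partial>lborel) \<le> ennreal (inverse (real (Suc n)))
      \<and> (\<integral>\<^sup>+t. ennreal (indicator {-1<..<1} t * sqrt (1 - t\<^sup>2) * \<bar>p t - h0 t\<bar>) \<partial>lborel) \<le> ennreal (inverse (real (Suc n))))"
proof -
  let ?I = "indicator {-1<..<1::real} :: real \<Rightarrow> real"
  define w where "w = (\<lambda>t. ?I t * sqrt (1 - t\<^sup>2))"
  have [measurable]: "w \<in> borel_measurable borel" unfolding w_def by measurable
  have sq: "0 < sqrt (1 - t\<^sup>2)" if "-1 < t" "t < 1" for t
    using that by (simp add: abs_square_less_1 abs_less_iff)
  have w: "0 \<le> w t" "w t \<le> ?I t" for t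
    using sq[of t] by (auto simp: w_def split: split_indicator)
  have int_w: "integrable lborel w"
  proof (rule Bochner_Integration.integrable_bound)
    show "integrable lborel ?I" by simp
    show "AE t in lborel. norm (w t) \<le> norm (?I t)" using w by (intro AE_I2) simp
  qed measurable
  \<comment> \<open>Measurability of h comes from its weighted version, divided by the weight, which
    is positive on the open interval.\<close>
  have "(\<lambda>t. ?I t * h t) \<in> borel_measurable lebesgue"
  proof -
    have "(\<lambda>t. ?I t / sqrt (1 - t\<^sup>2)) \<in> borel_measurable lebesgue"
      by (rule measurable_completion) measurable
    then have "(\<lambda>t. (?I t / sqrt (1 - t\<^sup>2)) * (?I t *\<^sub>R (sqrt (1 - t\<^sup>2) * h t))) \<in> borel_measurable lebesgue"
      using borel_measurable_integrable[OF h[unfolded set_integrable_def]] by (rule borel_measurable_times)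
    moreover have "(?I t / sqrt (1 - t\<^sup>2)) * (?I t *\<^sub>R (sqrt (1 - t\<^sup>2) * h t)) = ?I t * h t" for t
      using sq[of t] by (auto split: split_indicator)
    ultimately show ?thesis by simp
  qed
  then obtain h0 where [measurable]: "h0 \<in> borel_measurable borel" and h0: "AE t in lborel. ?I t * h t = h0 t"
    using completion_ex_borel_measurable_real[of "\<lambda>t. ?I t * h t" lborel] by auto
  have "(\<lambda>t. ?I t * g t) \<in> borel_measurable lebesgue"
    using borel_measurable_integrable[OF g[unfolded set_integrable_def]] by simp
  then obtain g0 where [measurable]: "g0 \<in> borel_measurable borel" and g0: "AE t in lborel. ?I t * g t = g0 t"
    using completion_ex_borel_measurable_real[of "\<lambda>t. ?I t * g t" lborel] by auto
  have int_h: "integrable lborel (\<lambda>t. w t * h0 t)"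
  proof -
    have "AE t in lebesgue. ?I t *\<^sub>R (sqrt (1 - t\<^sup>2) * h t) = w t * h0 t"
      using AE_completion[OF h0] by eventually_elim (auto simp: w_def split: split_indicator_asm)
    moreover have m: "(\<lambda>t. w t * h0 t) \<in> borel_measurable lborel" by measurable
    ultimately have "integrable lebesgue (\<lambda>t. w t * h0 t)"
      by (intro integrable_cong_AE_imp[OF h[unfolded set_integrable_def] measurable_completion[OF m]])
    then show ?thesis using integrable_completion[OF m] by simp
  qed
  have int_g: "integrable lborel (\<lambda>t. ?I t * g0 t)"
  proof -
    have "AE t in lebesgue. ?I t *\<^sub>R g t = ?I t * g0 t"
      using AE_completion[OF g0] by eventually_elim (auto split: split_indicator_asm)
    moreover have m: "(\<lambda>t. ?I t * g0 t) \<in> borel_measurable lborel" by measurable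
    ultimately have "integrable lebesgue (\<lambda>t. ?I t * g0 t)"
      by (intro integrable_cong_AE_imp[OF g[unfolded set_integrable_def] measurable_completion[OF m]])
    then show ?thesis using integrable_completion[OF m] by simp
  qed
  have "\<exists>p. continuous_on UNIV p \<and> integrable lborel (\<lambda>t. w t * \<bar>p t - h0 t\<bar>)
      \<and> (LINT t|lborel. w t * \<bar>p t - h0 t\<bar>) < inverse (real (Suc n))" for n
    by (rule weighted_L1_continuous_approximation[OF _ w(1) int_w _ int_h]) auto
  then obtain p where p: "\<And>n. continuous_on UNIV (p n)" "\<And>n. integrable lborel (\<lambda>t. w t * \<bar>p n t - h0 t\<bar>)"
      "\<And>n. (LINT t|lborel. w t * \<bar>p n t - h0 t\<bar>) < inverse (real (Suc n))"
    by metis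
  have [measurable]: "p n \<in> borel_measurable borel" for n
    using p(1) by (rule borel_measurable_continuous_onI)
  have p_bound: "(\<integral>\<^sup>+t. ennreal (w t * \<bar>p n t - h0 t\<bar>) \<partial>lborel) \<le> ennreal (inverse (Suc n))" for n
    using p(2,3)[of n] w(1) by (subst nn_integral_eq_integral) (auto intro!: ennreal_leI less_imp_le)
  obtain C where C: "AE x in lebesgue. -1 < x \<and> x < 1 \<longrightarrow>
    g x = C + (LINT t|lebesgue. (indicator {0<..x} t - indicator {x<..0} t) * h t)"
    using weak_derivative_AE_eq_primitive[OF W, of 0] by auto
  have "(LINT t|lebesgue. (indicator {0<..x} t - indicator {x<..0} t) * h t)
      = (LINT t|lborel. (indicator {0<..x} t - indicator {x<..0} t) * h0 t)" if "-1 < x" "x < 1" for x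
  proof -
    let ?J = "\<lambda>t. indicator {0<..x} t - indicator {x<..0} t :: real"
    have J: "?J t * h t = ?J t * (?I t * h t)" for t
      using that by (auto split: split_indicator)
    have m: "(\<lambda>t. ?J t * h0 t) \<in> borel_measurable lborel" by measurable
    have "(LINT t|lebesgue. ?J t * h t) = (LINT t|lebesgue. ?J t * h0 t)"
    proof (rule integral_cong_AE)
      have "?J \<in> borel_measurable lebesgue" by (rule measurable_completion) measurable
      then show "(\<lambda>t. ?J t * h t) \<in> borel_measurable lebesgue"
        unfolding J using \<open>(\<lambda>t. ?I t * h t) \<in> borel_measurable lebesgue\<close> by (rule borel_measurable_times)
      show "(\<lambda>t. ?J t * h0 t) \<in> borel_measurable lebesgue" by (rule measurable_completion[OF m])
      show "AE t in lebesgue. ?J t * h t = ?J t * h0 t"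
        unfolding J using AE_completion[OF h0] by eventually_elim simp
    qed
    also have "\<dots> = (LINT t|lborel. ?J t * h0 t)" by (rule integral_completion[OF m])
    finally show ?thesis .
  qed
  with C have "AE x in lebesgue. -1 < x \<and> x < 1 \<longrightarrow>
    g x = C + (LINT t|lborel. (indicator {0<..x} t - indicator {x<..0} t) * h0 t)"
    by (auto elim!: eventually_mono)
  then have "AE x in lborel. -1 < x \<and> x < 1 \<longrightarrow>
    g x = C + (LINT t|lborel. (indicator {0<..x} t - indicator {x<..0} t) * h0 t)"
    by (simp add: AE_completion_iff)
  with g0 have g0_eq: "AE x in lborel. x \<in> {-1<..<1} \<longrightarrow>
    g0 x = C + (LINT t|lborel. (indicator {0<..x} t - indicator {x<..0} t) * h0 t)"
    by eventually_elim (auto split: split_indicator_asm)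
  \<comment> \<open>Starting at the constant C of the representation of g0 makes P n - g0 almost
    everywhere the integral of p n - h0 from 0, without an additive error.\<close>
  have "\<exists>P. P 0 = C \<and> (\<forall>t. (P has_real_derivative p n t) (at t))" for n
    by (rule continuous_antiderivative[OF p(1)])
  then obtain P where P0: "\<And>n. P n 0 = C" and P: "\<And>n t. (P n has_real_derivative p n t) (at t)"
    by metis
  have P_bound: "(\<integral>\<^sup>+t. ennreal (?I t * \<bar>P n t - g0 t\<bar>) \<partial>lborel) \<le> ennreal (inverse (Suc n))" for n
  proof -
    have "(\<integral>\<^sup>+t. ennreal (?I t * \<bar>P n t - g0 t\<bar>) \<partial>lborel)
       \<le> (\<integral>\<^sup>+t. indicator {-1<..<1} t * (\<integral>\<^sup>+s. ennreal ((indicator {0<..t} s + indicator {t<..0} s) * \<bar>p n s - h0 s\<bar>) \<partial>lborel) \<partial>lborel)"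
    proof (rule nn_integral_mono_AE)
      show "AE t in lborel. ennreal (?I t * \<bar>P n t - g0 t\<bar>)
         \<le> indicator {-1<..<1} t * (\<integral>\<^sup>+s. ennreal ((indicator {0<..t} s + indicator {t<..0} s) * \<bar>p n s - h0 s\<bar>) \<partial>lborel)"
        using g0_eq
      proof eventually_elim
        case (elim t)
        show ?case
        proof (cases "t \<in> {-1<..<1}")
          case True
          then have "integrable lborel (\<lambda>s. (indicator {0<..t} s + indicator {t<..0} s) * h0 s)"
            using int_h by (intro integrable_interval_weight) (auto simp: w_def)
          from primitive_difference_le[OF P p(1) _ this, of n] True elim show ?thesis
            by (simp add: P0)
        qed simp
      qed
    qed
    also have "\<dots> \<le> (\<integral>\<^sup>+s. ennreal (?I s * sqrt (1 - s\<^sup>2) * \<bar>p n s - h0 s\<bar>) \<partial>lborel)"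
      by (rule nn_integral_primitive_le) auto
    also have "\<dots> \<le> ennreal (inverse (Suc n))"
      using p_bound[of n] by (simp add: w_def)
    finally show ?thesis .
  qed
  show ?thesis
  proof (intro exI conjI allI)
    show "g0 \<in> borel_measurable borel" "h0 \<in> borel_measurable borel" by fact+
    show "AE t in lborel. -1 < t \<and> t < 1 \<longrightarrow> g t = g0 t \<and> h t = h0 t"
      using g0 h0
    proof eventually_elim
      case (elim t)
      then show ?case by (cases "-1 < t \<and> t < 1") auto
    qed
    show "integrable lborel (\<lambda>t. ?I t * g0 t)" by (rule int_g)
    show "integrable lborel (\<lambda>t. ?I t * sqrt (1 - t\<^sup>2) * h0 t)" using int_h by (simp only: w_def)
    fix n
    show "(P n has_real_derivative p n t) (at t)" for t by (rule P)
    show "continuous_on UNIV (p n)" by (rule p(1))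
    show "(\<integral>\<^sup>+t. ennreal (?I t * \<bar>P n t - g0 t\<bar>) \<partial>lborel) \<le> ennreal (inverse (Suc n))" by (rule P_bound)
    show "(\<integral>\<^sup>+t. ennreal (?I t * sqrt (1 - t\<^sup>2) * \<bar>p n t - h0 t\<bar>) \<partial>lborel) \<le> ennreal (inverse (Suc n))"
      using p_bound[of n] by (simp only: w_def)
  qed
qed

section \<open>Circulation along boundary curves\<close>

text \<open>The speed cancels the normalisation of the unit tangent, which leaves W \<bullet> c'.
  One partition and one family of derivatives serve all continuous W, so that a whole sequence of
  fields can be treated at once.\<close>

lemma piecewise_regular_curve_circulation:
  assumes "piecewise_regular_curve c" and c: "continuous_on {0..1} c"
  obtains n :: nat and q :: "nat \<Rightarrow> real" and D :: "nat \<Rightarrow> real \<Rightarrow> real^3"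
  where "\<And>i. i < n \<Longrightarrow> continuous_on {q i..q (Suc i)} (D i)" "\<And>i. i < n \<Longrightarrow> {q i..q (Suc i)} \<subseteq> {0..1}"
    and "\<And>W. continuous_on (path_image c) W \<Longrightarrow>
      curve_circulation c W = (\<Sum>i<n. integral {q i..q (Suc i)} (\<lambda>t. W (c t) \<bullet> D i t))"
proof -
  from assms(1) obtain n q where q0: "q 0 = 0" and qn: "q n = 1" and q: "\<forall>i<n. q i < q (Suc i) \<and>
      (\<exists>D. continuous_on {q i..q (Suc i)} D \<and> (\<forall>t\<in>{q i..q (Suc i)}. D t \<noteq> 0 \<and>
        (c has_vector_derivative D t) (at t within {q i..q (Suc i)})))"
    unfolding piecewise_regular_curve_def by blast
  then have "\<forall>i. \<exists>D. i < n \<longrightarrow> q i < q (Suc i) \<and> continuous_on {q i..q (Suc i)} D \<and>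
      (\<forall>t\<in>{q i..q (Suc i)}. (c has_vector_derivative D t) (at t within {q i..q (Suc i)}))"
    by blast
  then obtain D where "\<forall>i. i < n \<longrightarrow> q i < q (Suc i) \<and> continuous_on {q i..q (Suc i)} (D i) \<and>
      (\<forall>t\<in>{q i..q (Suc i)}. (c has_vector_derivative D i t) (at t within {q i..q (Suc i)}))"
    by (rule choice[THEN exE])
  then have less: "q i < q (Suc i)" and cD: "continuous_on {q i..q (Suc i)} (D i)"
    and D: "\<And>t. t \<in> {q i..q (Suc i)} \<Longrightarrow> (c has_vector_derivative D i t) (at t within {q i..q (Suc i)})"
    if "i < n" for i
    using that by blast+
  have mono: "q i \<le> q j" if "i \<le> j" "j \<le> n" for i j
    using that
  proof (induction j rule: dec_induct)
    case (step j)
    then show ?case using less[of j] by simp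
  qed simp
  have sub: "{q i..q (Suc i)} \<subseteq> {0..1}" if "i < n" for i
    using mono[of 0 i] mono[of "Suc i" n] q0 qn that by auto
  have "curve_circulation c W = (\<Sum>i<n. integral {q i..q (Suc i)} (\<lambda>t. W (c t) \<bullet> D i t))"
    if W: "continuous_on (path_image c) W" for W :: "real^3 \<Rightarrow> real^3"
  proof -
    let ?F = "\<lambda>t. (W (c t) \<bullet> unit_tangent c t) * norm (vector_derivative c (at t))"
    have F: "?F t = W (c t) \<bullet> vector_derivative c (at t)" for t
    proof -
      have "norm (vector_derivative c (at t)) *\<^sub>R unit_tangent c t = vector_derivative c (at t)"
        by (cases "vector_derivative c (at t) = 0") (simp_all add: unit_tangent_def sgn_div_norm)
      then show ?thesis by (metis inner_scaleR_right mult.commute)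
    qed
    have piece: "(?F has_integral integral {q i..q (Suc i)} (\<lambda>t. W (c t) \<bullet> D i t)) {q i..q (Suc i)}" if i: "i < n" for i
    \<comment> \<open>At a break point the two-sided derivative may not exist and
      \<open>vector_derivative\<close> is then unspecified; finitely many points do not affect the
      integral.\<close>
    proof (rule has_integral_spike_finite)
      show "finite {q i, q (Suc i)}" by simp
      show "?F t = W (c t) \<bullet> D i t" if "t \<in> {q i..q (Suc i)} - {q i, q (Suc i)}" for t
      proof -
        have t: "q i < t" "t < q (Suc i)" using that by auto
        then have "(c has_vector_derivative D i t) (at t)"
          using D[OF i, of t] by (simp add: at_within_Icc_at)
        then show ?thesis unfolding F by (simp add: vector_derivative_at)
      qed
      have "continuous_on {q i..q (Suc i)} (\<lambda>t. W (c t) \<bullet> D i t)"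
      proof (intro continuous_intros cD[OF i])
        show "continuous_on {q i..q (Suc i)} (\<lambda>t. W (c t))"
          by (rule continuous_on_compose2[OF W continuous_on_subset[OF c sub[OF i]]])
            (use sub[OF i] in \<open>auto simp: path_image_def\<close>)
      qed
      then show "((\<lambda>t. W (c t) \<bullet> D i t) has_integral integral {q i..q (Suc i)} (\<lambda>t. W (c t) \<bullet> D i t)) {q i..q (Suc i)}"
        by (intro integrable_integral integrable_continuous_interval)
    qed
    have "k \<le> n \<Longrightarrow> (?F has_integral (\<Sum>i<k. integral {q i..q (Suc i)} (\<lambda>t. W (c t) \<bullet> D i t))) {q 0..q k}" for k
    proof (induction k)
      case (Suc k)
      then show ?case
        using has_integral_combine[OF _ _ Suc.IH piece[of k]] mono[of 0 k] less[of k] by simp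
    qed (simp add: has_integral_refl)
    from this[of n] show ?thesis
      unfolding curve_circulation_def q0 qn by (simp add: integral_unique)
  qed
  then show thesis
    using that[of n q D] cD sub by blast
qed

text \<open>The velocity D i is bounded on each piece, so uniform convergence on the curve survives
  the inner product with it and passes through finitely many integrals.\<close>

lemma curve_circulation_uniform_limit:
  assumes c: "piecewise_regular_curve c" "path c"
    and W: "\<And>k. continuous_on (path_image c) (W k)"
    and lim: "uniform_limit (path_image c) W W' sequentially"
  shows "(\<lambda>k. curve_circulation c (W k)) \<longlonglongrightarrow> curve_circulation c W'"
proof -
  have cc: "continuous_on {0..1} c" using c(2) by (simp add: path_def)
  obtain n q D where cD: "\<And>i. i < n \<Longrightarrow> continuous_on {q i..q (Suc i)} (D i)"
    and sub: "\<And>i. i < n \<Longrightarrow> {q i..q (Suc i)} \<subseteq> {0..1}"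
    and circ: "\<And>W. continuous_on (path_image c) W \<Longrightarrow>
      curve_circulation c W = (\<Sum>i<n. integral {q i..q (Suc i)} (\<lambda>t. W (c t) \<bullet> D i t))"
    by (rule piecewise_regular_curve_circulation[OF c(1) cc]) blast
  have W': "continuous_on (path_image c) W'"
    using uniform_limit_theorem[OF _ lim] W by simp
  show ?thesis
    unfolding circ[OF W] circ[OF W']
  proof (rule tendsto_sum)
    fix i assume "i \<in> {..<n}"
    then have i: "i < n" by simp
    have im: "c t \<in> path_image c" if "t \<in> {q i..q (Suc i)}" for t
      using that sub[OF i] by (auto simp: path_image_def)
    have cont: "continuous_on (cbox (q i) (q (Suc i))) (\<lambda>t. W k (c t))" for k
      unfolding cbox_interval
      by (rule continuous_on_compose2[OF W continuous_on_subset[OF cc sub[OF i]]]) (use im in blast)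
    have "uniform_limit {q i..q (Suc i)} (\<lambda>k t. W k (c t)) (\<lambda>t. W' (c t)) sequentially"
      using lim im unfolding uniform_limit_iff by (auto elim!: eventually_mono)
    moreover have "bounded (D i ` {q i..q (Suc i)})"
      by (intro compact_imp_bounded compact_continuous_image cD i) simp
    moreover have "bounded ((\<lambda>t. W' (c t)) ` {q i..q (Suc i)})"
      by (intro compact_imp_bounded compact_continuous_image
          continuous_on_compose2[OF W' continuous_on_subset[OF cc sub[OF i]]]) (use im in auto)
    ultimately have "uniform_limit (cbox (q i) (q (Suc i))) (\<lambda>k t. W k (c t) \<bullet> D i t) (\<lambda>t. W' (c t) \<bullet> D i t) sequentially"
      unfolding cbox_interval
      by (intro bounded_bilinear.bounded_uniform_limit[OF bounded_bilinear_inner] uniform_limit_const)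
    then obtain I J where IJ: "\<And>k. ((\<lambda>t. W k (c t) \<bullet> D i t) has_integral I k) (cbox (q i) (q (Suc i)))"
      "((\<lambda>t. W' (c t) \<bullet> D i t) has_integral J) (cbox (q i) (q (Suc i)))" "I \<longlonglongrightarrow> J"
      by (rule uniform_limit_integral_cbox) (auto intro!: continuous_intros cont[unfolded cbox_interval] cD[OF i])
    show "(\<lambda>k. integral {q i..q (Suc i)} (\<lambda>t. W k (c t) \<bullet> D i t)) \<longlonglongrightarrow> integral {q i..q (Suc i)} (\<lambda>t. W' (c t) \<bullet> D i t)"
      using IJ(3) unfolding integral_unique[OF IJ(1)[unfolded cbox_interval]] integral_unique[OF IJ(2)[unfolded cbox_interval]] .
  qed
qed

section \<open>Zonal integrals with integrable profiles\<close>

text \<open>In a completed measure, agreement almost everywhere with a measurable function already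
  gives measurability. The integrands containing the original kernel get theirs in this way.\<close>

lemma borel_measurable_completion_cong_AE:
  assumes f [measurable]: "f \<in> M \<rightarrow>\<^sub>M N" and ae: "AE x in completion M. f' x = f x" and sp: "\<And>x. x \<in> space M \<Longrightarrow> f' x \<in> space N"
  shows "f' \<in> completion M \<rightarrow>\<^sub>M N"
proof (rule measurableI)
  fix A assume A: "A \<in> sets N"
  show "f' -` A \<inter> space (completion M) \<in> sets (completion M)"
  proof (rule completion.in_sets_AE)
    show "f -` A \<inter> space M \<in> sets (completion M)"
      using A by (intro sets_completionI_sets measurable_sets[OF f])
    show "AE x in completion M. x \<in> f -` A \<inter> space M \<longleftrightarrow> x \<in> f' -` A \<inter> space (completion M)"
      using ae by eventually_elim simp
  qed simp
qed (use sp in simp)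

lemma integral_sphere_measure_cong_AE:
  fixes F F0 :: "real^3 \<Rightarrow> 'a::euclidean_space"
  assumes F0: "F0 \<in> borel_measurable borel" and ae: "AE y in sphere_borel_measure. y \<in> S2 \<longrightarrow> F y = F0 y"
  shows "(LINT y:S2|sphere_measure. F y) = (LINT y|sphere_borel_measure. F0 y)"
proof -
  have m: "F0 \<in> borel_measurable sphere_borel_measure" using F0 by simp
  have "AE y in sphere_borel_measure. indicator S2 y *\<^sub>R F y = F0 y"
    using ae AE_sphere_borel by eventually_elim simp
  then have eq: "AE y in sphere_measure. indicator S2 y *\<^sub>R F y = F0 y"
    unfolding sphere_measure_eq_completion by (rule AE_completion)
  have "(LINT y:S2|sphere_measure. F y) = (LINT y|sphere_measure. F0 y)"
    unfolding set_lebesgue_integral_def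
  proof (rule integral_cong_AE[OF _ _ eq])
    show "(\<lambda>y. indicator S2 y *\<^sub>R F y) \<in> borel_measurable sphere_measure"
      using borel_measurable_completion_cong_AE[OF m] eq unfolding sphere_measure_eq_completion by auto
    show "F0 \<in> borel_measurable sphere_measure"
      unfolding sphere_measure_eq_completion by (rule measurable_completion[OF m])
  qed
  then show ?thesis
    unfolding sphere_measure_eq_completion by (simp only: integral_completion[OF m])
qed

text \<open>The law of \<open>x \<bullet> y\<close> is a multiple of Lebesgue measure on [-1, 1], so
  null sets of t pull back to null sets on the sphere; t = 1 and t = -1, where nothing is known
  about the kernel, form such a set.\<close>

lemma AE_zonal:
  assumes x: "x \<in> S2" and Q: "AE t in lborel. -1 < t \<and> t < 1 \<longrightarrow> Q t"
  shows "AE y in sphere_borel_measure. Q (x \<bullet> y)"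
proof -
  have "AE t in lborel. t \<noteq> (1::real)" "AE t in lborel. t \<noteq> (-1::real)"
    by (rule AE_lborel_singleton)+
  with Q have "AE t in lborel. 0 < ennreal (2 * pi * indicator {-1..1} t) \<longrightarrow> Q t"
    by eventually_elim (auto split: split_indicator_asm)
  then have "AE t in distr sphere_borel_measure borel (\<lambda>y. x \<bullet> y). Q t"
    unfolding distr_sphere_borel_inner[OF x] by (subst AE_density) auto
  then show ?thesis by (rule AE_distrD[rotated]) simp
qed

lemma nn_integral_zonal:
  assumes x: "x \<in> S2" and f [measurable]: "f \<in> borel_measurable borel"
  shows "(\<integral>\<^sup>+y. f (x \<bullet> y) \<partial>sphere_borel_measure) = ennreal (2 * pi) * (\<integral>\<^sup>+t. indicator {-1<..<1} t * f t \<partial>lborel)"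
proof -
  have "(\<integral>\<^sup>+y. f (x \<bullet> y) \<partial>sphere_borel_measure) = (\<integral>\<^sup>+t. f t \<partial>distr sphere_borel_measure borel (\<lambda>y. x \<bullet> y))"
    by (subst nn_integral_distr) auto
  also have "\<dots> = (\<integral>\<^sup>+t. ennreal (2 * pi * indicator {-1..1} t) * f t \<partial>lborel)"
    unfolding distr_sphere_borel_inner[OF x] by (subst nn_integral_density) auto
  also have "\<dots> = (\<integral>\<^sup>+t. ennreal (2 * pi) * (indicator {-1<..<1} t * f t) \<partial>lborel)"
  proof (rule nn_integral_cong_AE)
    have "AE t in lborel. t \<noteq> (1::real)" "AE t in lborel. t \<noteq> (-1::real)"
      by (rule AE_lborel_singleton)+
    then show "AE t in lborel. ennreal (2 * pi * indicator {-1..1} t) * f t = ennreal (2 * pi) * (indicator {-1<..<1} t * f t)"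
      by eventually_elim (auto split: split_indicator)
  qed
  also have "\<dots> = ennreal (2 * pi) * (\<integral>\<^sup>+t. indicator {-1<..<1} t * f t \<partial>lborel)"
    by (rule nn_integral_cmult) measurable
  finally show ?thesis .
qed

text \<open>Used with three weights u: 1 for averages, sqrt (1 - t^2) for integrands containing x
  \<times> y, and 1 - t for the integrand of the nonlocal curl. The bound does not contain x, which
  makes the approximation uniform on the sphere.\<close>

lemma zonal_integral_estimate:
  fixes G :: "real^3 \<Rightarrow> 'a::euclidean_space" and k u :: "real \<Rightarrow> real"
  assumes x: "x \<in> S2" and [measurable]: "k \<in> borel_measurable borel" "u \<in> borel_measurable borel" "G \<in> borel_measurable borel"
    and G: "\<And>y. y \<in> S2 \<Longrightarrow> norm (G y) \<le> M * u (x \<bullet> y)" and M: "0 \<le> M"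
    and r: "(\<integral>\<^sup>+t. ennreal (indicator {-1<..<1} t * u t * \<bar>k t\<bar>) \<partial>lborel) \<le> ennreal r" "0 \<le> r"
  shows "integrable sphere_borel_measure (\<lambda>y. k (x \<bullet> y) *\<^sub>R G y)"
    and "norm (LINT y|sphere_borel_measure. k (x \<bullet> y) *\<^sub>R G y) \<le> 2 * pi * M * r"
proof -
  have "(\<integral>\<^sup>+y. ennreal (norm (k (x \<bullet> y) *\<^sub>R G y)) \<partial>sphere_borel_measure)
      \<le> (\<integral>\<^sup>+y. ennreal (M * (u (x \<bullet> y) * \<bar>k (x \<bullet> y)\<bar>)) \<partial>sphere_borel_measure)"
  proof (rule nn_integral_mono_AE)
    show "AE y in sphere_borel_measure. ennreal (norm (k (x \<bullet> y) *\<^sub>R G y)) \<le> ennreal (M * (u (x \<bullet> y) * \<bar>k (x \<bullet> y)\<bar>))"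
      using AE_sphere_borel
    proof eventually_elim
      case (elim y)
      then have "\<bar>k (x \<bullet> y)\<bar> * norm (G y) \<le> \<bar>k (x \<bullet> y)\<bar> * (M * u (x \<bullet> y))"
        using G by (intro mult_left_mono) auto
      then show ?case by (intro ennreal_leI) (simp add: mult_ac)
    qed
  qed
  also have "\<dots> = ennreal (2 * pi) * (\<integral>\<^sup>+t. indicator {-1<..<1} t * ennreal (M * (u t * \<bar>k t\<bar>)) \<partial>lborel)"
    by (rule nn_integral_zonal[OF x]) measurable
  also have "(\<integral>\<^sup>+t. indicator {-1<..<1} t * ennreal (M * (u t * \<bar>k t\<bar>)) \<partial>lborel)
     = (\<integral>\<^sup>+t. ennreal M * ennreal (indicator {-1<..<1} t * u t * \<bar>k t\<bar>) \<partial>lborel)"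
    using M by (intro nn_integral_cong) (auto simp: ennreal_mult' split: split_indicator)
  also have "\<dots> = ennreal M * (\<integral>\<^sup>+t. ennreal (indicator {-1<..<1} t * u t * \<bar>k t\<bar>) \<partial>lborel)"
    by (rule nn_integral_cmult) measurable
  also have "ennreal (2 * pi) * (ennreal M * (\<integral>\<^sup>+t. ennreal (indicator {-1<..<1} t * u t * \<bar>k t\<bar>) \<partial>lborel))
      \<le> ennreal (2 * pi) * (ennreal M * ennreal r)"
    by (intro mult_left_mono r) auto
  also have "\<dots> = ennreal (2 * pi * M * r)"
    using M r(2) by (simp add: mult.assoc flip: ennreal_mult)
  finally have bound: "(\<integral>\<^sup>+y. ennreal (norm (k (x \<bullet> y) *\<^sub>R G y)) \<partial>sphere_borel_measure) \<le> ennreal (2 * pi * M * r)" .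
  show int: "integrable sphere_borel_measure (\<lambda>y. k (x \<bullet> y) *\<^sub>R G y)"
    using le_less_trans[OF bound ennreal_less_top] by (intro integrableI_bounded) auto
  have "ennreal (norm (LINT y|sphere_borel_measure. k (x \<bullet> y) *\<^sub>R G y)) \<le> ennreal (2 * pi * M * r)"
    using integral_norm_bound_ennreal[OF int] bound by (rule order_trans)
  then show "norm (LINT y|sphere_borel_measure. k (x \<bullet> y) *\<^sub>R G y) \<le> 2 * pi * M * r"
    using M r(2) by (subst (asm) ennreal_le_iff) auto
qed

lemma norm_cross3_sphere:
  assumes "x \<in> S2" "y \<in> S2"
  shows "norm (cross3 x y) = sqrt (1 - (x \<bullet> y)\<^sup>2)"
proof -
  have "(norm (cross3 x y))\<^sup>2 = 1 - (x \<bullet> y)\<^sup>2"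
    using norm_cross[of x y] assms by simp
  then show ?thesis by (metis norm_ge_zero real_sqrt_unique)
qed

lemma uniform_limit_inverse_Suc:
  assumes "\<And>n x. x \<in> K \<Longrightarrow> norm (f n x - f' x :: 'a::real_normed_vector) \<le> M * inverse (real (Suc n))"
  shows "uniform_limit K f f' sequentially"
proof (rule uniform_limitI)
  fix e :: real assume "0 < e"
  have "(\<lambda>n. M * inverse (real (Suc n))) \<longlonglongrightarrow> 0"
    using tendsto_mult_right_zero[OF LIMSEQ_inverse_real_of_nat] by blast
  then have "\<forall>\<^sub>F n in sequentially. M * inverse (real (Suc n)) < e"
    using \<open>0 < e\<close> by (rule order_tendstoD)
  then show "\<forall>\<^sub>F n in sequentially. \<forall>x\<in>K. dist (f n x) (f' x) < e"
    by eventually_elim (use assms in \<open>auto simp: dist_norm intro: le_less_trans\<close>)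
qed

text \<open>The limit f' is continuous on K as a uniform limit, hence measurable and bounded by some
  B. Every error is at most the one for n = 0, namely M, so |B| + M dominates on a finite
  measure.\<close>

lemma tendsto_sphere_integral:
  fixes f :: "nat \<Rightarrow> real^3 \<Rightarrow> real"
  assumes K: "closed K" "K \<subseteq> S2" and f: "\<And>n. continuous_on K (f n)"
    and lim: "\<And>n x. x \<in> K \<Longrightarrow> norm (f n x - f' x) \<le> M * inverse (real (Suc n))" and M: "0 \<le> M"
  shows "(\<lambda>n. LINT x:K|sphere_measure. f n x) \<longlonglongrightarrow> (LINT x:K|sphere_measure. f' x)"
proof -
  interpret finite_measure sphere_borel_measure by (rule finite_measure_sphere_borel)
  have ul: "uniform_limit K f f' sequentially"
    by (rule uniform_limit_inverse_Suc) (rule lim)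
  have f': "continuous_on K f'"
    using uniform_limit_theorem[OF _ ul] f by simp
  have m: "(\<lambda>x. indicator K x *\<^sub>R F x) \<in> borel_measurable sphere_borel_measure" if "continuous_on K F" for F :: "real^3 \<Rightarrow> real"
    using borel_measurable_continuous_on_indicator[OF _ that] K by (simp add: borel_closed)
  have "compact K" using K by (metis compact_Int_closed compact_sphere inf.absorb_iff2)
  then have "bounded (f' ` K)"
    by (intro compact_imp_bounded compact_continuous_image f')
  then obtain B where "\<forall>z\<in>f' ` K. norm z \<le> B" unfolding bounded_iff by blast
  then have B: "norm (f' x) \<le> B" if "x \<in> K" for x using that by simp
  have bd: "norm (indicator K x *\<^sub>R f n x) \<le> \<bar>B\<bar> + M" for n x
  proof (cases "x \<in> K")
    case True
    have "M * inverse (real (Suc n)) \<le> M"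
      using M by (intro mult_left_le) (auto simp: inverse_le_1_iff)
    then show ?thesis
      using lim[OF True, of n] B[OF True] True norm_triangle_sub[of "f n x" "f' x"] by simp
  qed (use M in simp)
  have "(\<lambda>n. LINT x|sphere_borel_measure. indicator K x *\<^sub>R f n x) \<longlonglongrightarrow> (LINT x|sphere_borel_measure. indicator K x *\<^sub>R f' x)"
  proof (rule integral_dominated_convergence[where w = "\<lambda>_. \<bar>B\<bar> + M"])
    have "(\<lambda>n. indicator K x *\<^sub>R f n x) \<longlonglongrightarrow> indicator K x *\<^sub>R f' x" for x
    proof (cases "x \<in> K")
      case True
      then show ?thesis using tendsto_uniform_limitI[OF ul True] by simp
    qed simp
    then show "AE x in sphere_borel_measure. (\<lambda>n. indicator K x *\<^sub>R f n x) \<longlonglongrightarrow> indicator K x *\<^sub>R f' x"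
      by (intro AE_I2)
    show "AE x in sphere_borel_measure. norm (indicator K x *\<^sub>R f n x) \<le> \<bar>B\<bar> + M" for n
      using bd by (intro AE_I2)
  qed (use m[OF f] m[OF f'] in simp_all)
  then show ?thesis
    unfolding set_lebesgue_integral_def sphere_measure_eq_completion
      integral_completion[OF m[OF f]] integral_completion[OF m[OF f']] .
qed

section \<open>Regularity of fields on the sphere\<close>

lemma smooth_field_on_sphere_differentiable:
  assumes "smooth_field_on_sphere V"
  obtains F where "\<And>x. x \<in> S2 \<Longrightarrow> F differentiable (at x)" "\<And>x. x \<in> S2 \<Longrightarrow> F x = V x"
proof -
  from assms obtain U F where U: "S2 \<subseteq> U" "smooth_on F U" "\<And>x. x \<in> S2 \<Longrightarrow> F x = V x"
    unfolding smooth_field_on_sphere_def by blast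
  then have "Ck_on (Suc 0) F U" unfolding smooth_on_def by blast
  then have "F differentiable (at x)" if "x \<in> S2" for x
    using U(1) that by auto
  then show thesis using that U(3) by blast
qed

lemma smooth_field_on_sphere_continuous:
  assumes "smooth_field_on_sphere V"
  shows "continuous_on S2 V"
proof -
  obtain F where F: "\<And>x. x \<in> S2 \<Longrightarrow> F differentiable (at x)" "\<And>x. x \<in> S2 \<Longrightarrow> F x = V x"
    using smooth_field_on_sphere_differentiable[OF assms] by blast
  then have "continuous_on S2 F"
    by (intro continuous_at_imp_continuous_on ballI differentiable_imp_continuous_within)
  then show ?thesis using F(2) by (rule continuous_on_eq)
qed

text \<open>Lipschitz at one point, with L depending on that point: it serves to integrate the
  nonlocal curl at a fixed x, and no uniformity is asked for there.\<close>

lemma pointwise_lipschitz: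
  fixes V F :: "'a::real_normed_vector \<Rightarrow> 'b::real_normed_vector"
  assumes F: "F differentiable (at x)" "\<And>y. y \<in> K \<Longrightarrow> F y = V y" and x: "x \<in> K"
    and B: "\<And>y. y \<in> K \<Longrightarrow> norm (V y) \<le> B"
  obtains L where "0 \<le> L" "\<And>y. y \<in> K \<Longrightarrow> norm (V y - V x) \<le> L * norm (y - x)"
proof -
  from F(1) obtain D where D: "(F has_derivative D) (at x)" unfolding differentiable_def by blast
  then have bl: "bounded_linear D" by (rule has_derivative_bounded_linear)
  from D obtain d where d: "d > 0" "\<And>y. norm (y - x) < d \<Longrightarrow> norm (F y - F x - D (y - x)) \<le> 1 * norm (y - x)"
    unfolding has_derivative_at_alt by (metis zero_less_one)
  have B0: "0 \<le> B" using B[OF x] norm_ge_zero order_trans by blast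
  \<comment> \<open>The slope onorm D + 1 works within distance d of x; farther away the difference
    is at most 2 B, which is at most 2 B / d times the distance.\<close>
  define L where "L = onorm D + 1 + 2 * B / d"
  have L0: "0 \<le> onorm D" by (rule onorm_pos_le[OF bl])
  show thesis
  proof
    show "0 \<le> L" using L0 B0 d by (simp add: L_def)
    fix y assume y: "y \<in> K"
    show "norm (V y - V x) \<le> L * norm (y - x)"
    proof (cases "norm (y - x) < d")
      case True
      have "norm (V y - V x) \<le> norm (F y - F x - D (y - x)) + norm (D (y - x))"
        using F(2)[OF y] F(2)[OF x] norm_triangle_sub[of "F y - F x" "D (y - x)"] by simp
      also have "\<dots> \<le> norm (y - x) + onorm D * norm (y - x)"
        using d(2)[OF True] onorm[OF bl, of "y - x"] by simp
      also have "\<dots> = (onorm D + 1) * norm (y - x)" by (simp add: algebra_simps)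
      also have "\<dots> \<le> L * norm (y - x)"
        using B0 d by (intro mult_right_mono) (auto simp: L_def)
      finally show ?thesis .
    next
      case False
      have "norm (V y - V x) \<le> 2 * B"
        using B[OF x] B[OF y] norm_triangle_ineq4[of "V y" "V x"] by linarith
      also have "\<dots> = 2 * B / d * d" using d by simp
      also have "\<dots> \<le> 2 * B / d * norm (y - x)"
        using False B0 d by (intro mult_left_mono) auto
      also have "\<dots> \<le> L * norm (y - x)"
        using L0 by (intro mult_right_mono) (auto simp: L_def)
      finally show ?thesis .
    qed
  qed
qed

lemma norm_cross3_le: "norm (cross3 x y) \<le> norm x * norm y"
proof (rule power2_le_imp_le)
  show "(norm (cross3 x y))\<^sup>2 \<le> (norm x * norm y)\<^sup>2"
    by (simp add: norm_cross power_mult_distrib)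
qed simp

lemma sqrt_1_minus_square_nonneg: "-1 < t \<Longrightarrow> t < 1 \<Longrightarrow> 0 \<le> sqrt (1 - t\<^sup>2)" for t :: real
  by (simp add: abs_square_le_1 abs_le_iff)

text \<open>Supplies a finite r for \<open>zonal_integral_estimate\<close> where integrability alone
  is wanted.\<close>

lemma nn_integral_weighted_abs_le:
  fixes u k :: "real \<Rightarrow> real"
  assumes int: "integrable lborel (\<lambda>t. indicator {-1<..<1} t * u t * k t)" and u: "\<And>t. -1 < t \<Longrightarrow> t < 1 \<Longrightarrow> 0 \<le> u t"
  shows "(\<integral>\<^sup>+t. ennreal (indicator {-1<..<1} t * u t * \<bar>k t\<bar>) \<partial>lborel)
    \<le> ennreal (LINT t|lborel. \<bar>indicator {-1<..<1} t * u t * k t\<bar>)"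
proof -
  have "(\<integral>\<^sup>+t. ennreal (indicator {-1<..<1} t * u t * \<bar>k t\<bar>) \<partial>lborel) = (\<integral>\<^sup>+t. ennreal \<bar>indicator {-1<..<1} t * u t * k t\<bar> \<partial>lborel)"
    using u by (intro nn_integral_cong) (auto simp: abs_mult split: split_indicator)
  also have "\<dots> = ennreal (LINT t|lborel. \<bar>indicator {-1<..<1} t * u t * k t\<bar>)"
    using int by (intro nn_integral_eq_integral) auto
  finally show ?thesis by simp
qed

text \<open>The integral vanishes for each p n, and |x \<times> y| is exactly the weight in which p
  n approximates h0, so the error is at most 2 pi / (n + 1).\<close>

lemma integral_zonal_cross3_weak_eq_0:
  fixes h0 :: "real \<Rightarrow> real" and p P :: "nat \<Rightarrow> real \<Rightarrow> real"
  assumes x: "x \<in> S2" and h0 [measurable]: "h0 \<in> borel_measurable borel"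
    and int: "integrable lborel (\<lambda>t. indicator {-1<..<1} t * sqrt (1 - t\<^sup>2) * h0 t)"
    and P: "\<And>n t. (P n has_real_derivative p n t) (at t)" and p: "\<And>n. continuous_on UNIV (p n)"
    and lim: "\<And>n. (\<integral>\<^sup>+t. ennreal (indicator {-1<..<1} t * sqrt (1 - t\<^sup>2) * \<bar>p n t - h0 t\<bar>) \<partial>lborel) \<le> ennreal (inverse (Suc n))"
  shows "(LINT y|sphere_borel_measure. h0 (x \<bullet> y) *\<^sub>R cross3 x y) = 0"
proof -
  let ?w = "\<lambda>t::real. sqrt (1 - t\<^sup>2)"
  have [measurable]: "p n \<in> borel_measurable borel" for n
    using p by (rule borel_measurable_continuous_onI)
  have m [measurable]: "cross3 x \<in> borel_measurable borel"
    by (intro borel_measurable_continuous_onI continuous_on_cross continuous_intros)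
  have bound: "norm (cross3 x y) \<le> 1 * ?w (x \<bullet> y)" if "y \<in> S2" for y
    using norm_cross3_sphere[OF x that] by simp
  have c: "continuous_on S2 (\<lambda>y. p n (x \<bullet> y) *\<^sub>R cross3 x y)" for n
    by (intro continuous_intros continuous_on_cross continuous_on_compose2[OF p]) auto
  have zero: "(LINT y|sphere_borel_measure. p n (x \<bullet> y) *\<^sub>R cross3 x y) = 0" for n
  proof -
    have "(LINT y|sphere_borel_measure. p n (x \<bullet> y) *\<^sub>R cross3 x y) = (LINT y:S2|sphere_measure. p n (x \<bullet> y) *\<^sub>R cross3 x y)"
      by (rule integral_sphere_measure_cong_AE[symmetric]) auto
    also have "\<dots> = - (LINT y:S2|sphere_measure. p n (x \<bullet> y) *\<^sub>R cross3 y x)"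
      by (simp add: set_lebesgue_integral_def cross_skew[of x])
    also have "\<dots> = 0" using integral_zonal_cross3_eq_0[OF P p] by simp
    finally show ?thesis .
  qed
  have intp: "integrable sphere_borel_measure (\<lambda>y. p n (x \<bullet> y) *\<^sub>R cross3 x y)" for n
  proof (rule integrable_cong_AE_imp[OF integrable_sphere_continuous[OF c[of n], unfolded set_integrable_def]])
    show "AE y in sphere_borel_measure. indicator S2 y *\<^sub>R (p n (x \<bullet> y) *\<^sub>R cross3 x y) = p n (x \<bullet> y) *\<^sub>R cross3 x y"
      using AE_sphere_borel by eventually_elim simp
  qed measurable
  have inth: "integrable sphere_borel_measure (\<lambda>y. h0 (x \<bullet> y) *\<^sub>R cross3 x y)"
    by (rule zonal_integral_estimate(1)[OF x h0 _ m bound _ nn_integral_weighted_abs_le[OF int sqrt_1_minus_square_nonneg]]) simp_all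
  have "norm (LINT y|sphere_borel_measure. h0 (x \<bullet> y) *\<^sub>R cross3 x y) \<le> 2 * pi * 1 * inverse (real (Suc n))" for n
  proof -
    have "(LINT y|sphere_borel_measure. (\<lambda>t. p n t - h0 t) (x \<bullet> y) *\<^sub>R cross3 x y) = - (LINT y|sphere_borel_measure. h0 (x \<bullet> y) *\<^sub>R cross3 x y)"
      using Bochner_Integration.integral_diff[OF intp inth, of n] zero[of n] by (simp add: scaleR_diff_left)
    moreover have "norm (LINT y|sphere_borel_measure. (\<lambda>t. p n t - h0 t) (x \<bullet> y) *\<^sub>R cross3 x y) \<le> 2 * pi * 1 * inverse (real (Suc n))"
      by (rule zonal_integral_estimate(2)[OF x _ _ m bound]) (use lim[of n] in simp_all)
    ultimately show ?thesis by simp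
  qed
  moreover have "(\<lambda>n. 2 * pi * 1 * inverse (real (Suc n))) \<longlonglongrightarrow> 0"
    using tendsto_mult_right_zero[OF LIMSEQ_inverse_real_of_nat] by blast
  ultimately have "norm (LINT y|sphere_borel_measure. h0 (x \<bullet> y) *\<^sub>R cross3 x y) \<le> 0"
    by (intro LIMSEQ_le_const) blast+
  then show ?thesis by simp
qed

section \<open>The nonlocal Stokes theorem\<close>

theorem theorem3p3:
  fixes \<delta> :: real and \<gamma> \<gamma>' :: "real \<Rightarrow> real" and V :: "real^3 \<Rightarrow> real^3"
    and \<Sigma> :: "(real^3) set" and C :: "(real \<Rightarrow> real^3) set"
  assumes "0 < \<delta>" and "\<delta> \<le> 2"
    and "set_integrable lebesgue {-1<..<1} (truncated_kernel \<delta> \<gamma>)"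
    and "has_weak_derivative_on (truncated_kernel \<delta> \<gamma>) \<gamma>' (-1) 1"
    and "set_integrable lebesgue {-1<..<1} (\<lambda>t. sqrt (1 - t\<^sup>2) * \<gamma>' t)"
    and "set_integrable lebesgue {-1<..<1} (\<lambda>t. (1 - t) * \<gamma>' t)"
    and "smooth_field_on_sphere V"
    and "spherical_patch \<Sigma> C"
  shows "(LINT x:\<Sigma>|sphere_measure. nonlocal_curl \<gamma>' V x \<bullet> x)
       = boundary_circulation C (nonlocal_average (truncated_kernel \<delta> \<gamma>) V)"
proof -
  define g where "g = truncated_kernel \<delta> \<gamma>"
  obtain g0 h0 where ae: "AE t in lborel. -1 < t \<and> t < 1 \<longrightarrow> g t = g0 t \<and> \<gamma>' t = h0 t"
    and g0 [measurable]: "g0 \<in> borel_measurable borel" and h0 [measurable]: "h0 \<in> borel_measurable borel"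
    and int_g: "integrable lborel (\<lambda>t. indicator {-1<..<1} t * g0 t)"
    and int_h: "integrable lborel (\<lambda>t. indicator {-1<..<1} t * sqrt (1 - t\<^sup>2) * h0 t)"
    and approx: "\<forall>n. \<exists>P p. (\<forall>t. (P has_real_derivative p t) (at t)) \<and> continuous_on UNIV p
      \<and> (\<integral>\<^sup>+t. ennreal (indicator {-1<..<1} t * \<bar>P t - g0 t\<bar>) \<partial>lborel) \<le> ennreal (inverse (real (Suc n)))
      \<and> (\<integral>\<^sup>+t. ennreal (indicator {-1<..<1} t * sqrt (1 - t\<^sup>2) * \<bar>p t - h0 t\<bar>) \<partial>lborel) \<le> ennreal (inverse (real (Suc n)))"
    using kernel_approximation[OF assms(4)[folded g_def] assms(3)[folded g_def] assms(5)] by (elim exE conjE) (rule that, assumption+)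
  from approx obtain P where "\<forall>n. \<exists>p. (\<forall>t. (P n has_real_derivative p t) (at t)) \<and> continuous_on UNIV p
      \<and> (\<integral>\<^sup>+t. ennreal (indicator {-1<..<1} t * \<bar>P n t - g0 t\<bar>) \<partial>lborel) \<le> ennreal (inverse (real (Suc n)))
      \<and> (\<integral>\<^sup>+t. ennreal (indicator {-1<..<1} t * sqrt (1 - t\<^sup>2) * \<bar>p t - h0 t\<bar>) \<partial>lborel) \<le> ennreal (inverse (real (Suc n)))"
    by (rule choice[THEN exE])
  then obtain p where Pp: "\<forall>n. (\<forall>t. (P n has_real_derivative p n t) (at t)) \<and> continuous_on UNIV (p n)
      \<and> (\<integral>\<^sup>+t. ennreal (indicator {-1<..<1} t * \<bar>P n t - g0 t\<bar>) \<partial>lborel) \<le> ennreal (inverse (real (Suc n)))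
      \<and> (\<integral>\<^sup>+t. ennreal (indicator {-1<..<1} t * sqrt (1 - t\<^sup>2) * \<bar>p n t - h0 t\<bar>) \<partial>lborel) \<le> ennreal (inverse (real (Suc n)))"
    by (rule choice[THEN exE])
  have P: "(P n has_real_derivative p n t) (at t)" for n t
    using Pp[THEN spec, of n, THEN conjunct1] by (rule spec)
  note Pp' = Pp[THEN spec, THEN conjunct2]
  note p = Pp'[THEN conjunct1] and P_lim = Pp'[THEN conjunct2, THEN conjunct1] and p_lim = Pp'[THEN conjunct2, THEN conjunct2]
  have cP: "continuous_on A (P n)" for A n
    by (intro continuous_at_imp_continuous_on ballI DERIV_isCont[OF P])
  have [measurable]: "p n \<in> borel_measurable borel" "P n \<in> borel_measurable borel" for n
    using p cP by (auto intro: borel_measurable_continuous_onI)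
  have int_h': "integrable lborel (\<lambda>t. indicator {-1<..<1} t * (1 - t) * h0 t)"
  proof -
    have "AE t in lebesgue. indicator {-1<..<1} t *\<^sub>R ((1 - t) * \<gamma>' t) = indicator {-1<..<1} t * (1 - t) * h0 t"
      using AE_completion[OF ae] by eventually_elim (simp split: split_indicator)
    moreover have m: "(\<lambda>t. indicator {-1<..<1} t * (1 - t) * h0 t) \<in> borel_measurable lborel" by measurable
    ultimately have "integrable lebesgue (\<lambda>t. indicator {-1<..<1} t * (1 - t) * h0 t)"
      by (intro integrable_cong_AE_imp[OF assms(6)[unfolded set_integrable_def] measurable_completion[OF m]])
    then show ?thesis using integrable_completion[OF m] by simp
  qed
  have cV: "continuous_on S2 V" by (rule smooth_field_on_sphere_continuous[OF assms(7)])
  \<comment> \<open>V is arbitrary off the sphere; its cut-off is Borel on the whole space and can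
    be integrated against the Borel surface measure.\<close>
  define V0 where "V0 = (\<lambda>y. indicator S2 y *\<^sub>R V y)"
  have V0 [measurable]: "V0 \<in> borel_measurable borel"
    unfolding V0_def by (rule continuous_on_sphere_measurable[OF cV])
  have V0_eq: "V0 y = V y" if "y \<in> S2" for y using that by (simp add: V0_def)
  have "bounded (V ` S2)" by (intro compact_imp_bounded compact_continuous_image cV) simp
  then obtain M where M': "\<forall>z\<in>V ` S2. norm z \<le> M" unfolding bounded_iff by blast
  then have M: "norm (V y) \<le> M" if "y \<in> S2" for y using that by blast
  have M0: "0 \<le> M" using M[OF spherical_point_in_S2] norm_ge_zero order_trans by blast
  let ?w = "\<lambda>t::real. sqrt (1 - t\<^sup>2)"
  have cross_bound: "norm (cross3 x y \<bullet> V0 y) \<le> M * ?w (x \<bullet> y)" if "x \<in> S2" "y \<in> S2" for x y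
  proof -
    have "norm (cross3 x y \<bullet> V0 y) \<le> norm (cross3 x y) * norm (V0 y)"
      using Cauchy_Schwarz_ineq2 by simp
    also have "\<dots> \<le> norm (cross3 x y) * M"
      using M[OF that(2)] V0_eq[OF that(2)] by (intro mult_left_mono) auto
    finally show ?thesis
      unfolding norm_cross3_sphere[OF that] by (simp only: mult.commute)
  qed
  have mc [measurable]: "cross3 x \<in> borel_measurable borel" for x :: "real^3"
    by (intro borel_measurable_continuous_onI continuous_on_cross continuous_intros)
  have mc2 [measurable]: "(\<lambda>y. cross3 x y \<bullet> V0 y) \<in> borel_measurable borel" for x :: "real^3"
    by measurable
  have avg: "nonlocal_average g V x = (LINT y|sphere_borel_measure. g0 (x \<bullet> y) *\<^sub>R V0 y)" if x: "x \<in> S2" for x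
    unfolding nonlocal_average_def
  proof (rule integral_sphere_measure_cong_AE)
    show "AE y in sphere_borel_measure. y \<in> S2 \<longrightarrow> g (x \<bullet> y) *\<^sub>R V y = g0 (x \<bullet> y) *\<^sub>R V0 y"
      using AE_zonal[OF x ae] by eventually_elim (simp add: V0_eq)
  qed measurable
  define W where "W = (\<lambda>n x. LINT y:S2|sphere_measure. P n (x \<bullet> y) *\<^sub>R V y)"
  have W_eq: "W n x = (LINT y|sphere_borel_measure. P n (x \<bullet> y) *\<^sub>R V0 y)" for n x
    unfolding W_def by (rule integral_sphere_measure_cong_AE) (auto simp: V0_eq)
  have intP: "integrable sphere_borel_measure (\<lambda>y. P n (x \<bullet> y) *\<^sub>R V0 y)" for n x
  proof -
    have "continuous_on S2 (\<lambda>y. P n (x \<bullet> y) *\<^sub>R V y)"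
      by (intro continuous_intros cV continuous_on_compose2[OF cP[of UNIV]]) auto
    from integrable_sphere_continuous[OF this] show ?thesis
      unfolding set_integrable_def V0_def by (simp add: mult.commute)
  qed
  have W_lim: "norm (W n x - nonlocal_average g V x) \<le> (2 * pi * M) * inverse (real (Suc n))" if x: "x \<in> S2" for n x
  proof -
    have b: "norm (V0 y) \<le> M * (\<lambda>_. 1) (x \<bullet> y)" if "y \<in> S2" for y using M[OF that] V0_eq[OF that] by simp
    have intg: "integrable sphere_borel_measure (\<lambda>y. g0 (x \<bullet> y) *\<^sub>R V0 y)"
      using zonal_integral_estimate(1)[OF x g0 _ V0 b M0 nn_integral_weighted_abs_le] int_g by simp
    have "W n x - nonlocal_average g V x = (LINT y|sphere_borel_measure. (\<lambda>t. P n t - g0 t) (x \<bullet> y) *\<^sub>R V0 y)"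
      unfolding W_eq avg[OF x] by (simp add: scaleR_diff_left Bochner_Integration.integral_diff[OF intP intg])
    also have "norm \<dots> \<le> 2 * pi * M * inverse (real (Suc n))"
      by (rule zonal_integral_estimate(2)[OF x _ _ V0 b M0]) (use P_lim[of n] in simp_all)
    finally show ?thesis .
  qed
  define c where "c = (\<lambda>n x. (LINT y:S2|sphere_measure. p n (x \<bullet> y) *\<^sub>R cross3 y (V y)) \<bullet> x)"
  have curl_W: "curl (W n) x \<bullet> x = c n x" for n x
    unfolding W_def c_def by (simp only: curl_zonal_integral[OF P p cV])
  have cc: "continuous_on UNIV (c n)" for n
    unfolding c_def
  proof (intro continuous_on_inner continuous_on_sphere_integral continuous_on_id)
    have "continuous_on (UNIV \<times> S2) (\<lambda>z::(real^3) \<times> (real^3). V (snd z))"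
      by (rule continuous_on_compose2[OF cV]) (auto intro!: continuous_intros)
    then show "continuous_on (UNIV \<times> S2) (\<lambda>(x, y). p n (x \<bullet> y) *\<^sub>R cross3 y (V y))"
      unfolding split_beta
      by (intro continuous_intros continuous_on_cross continuous_on_compose2[OF p]) auto
  qed
  have c_eq: "c n x = (LINT y|sphere_borel_measure. p n (x \<bullet> y) *\<^sub>R (cross3 x y \<bullet> V0 y))"
    and intp: "integrable sphere_borel_measure (\<lambda>y. p n (x \<bullet> y) *\<^sub>R (cross3 x y \<bullet> V0 y))" for n x
  proof -
    have cont: "continuous_on S2 (\<lambda>y. p n (x \<bullet> y) *\<^sub>R cross3 y (V y))"
      and cont': "continuous_on S2 (\<lambda>y. p n (x \<bullet> y) *\<^sub>R (cross3 x y \<bullet> V y))"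
      by (intro continuous_intros cV continuous_on_cross continuous_on_compose2[OF p]; auto)+
    have triple: "(p n (x \<bullet> y) *\<^sub>R cross3 y (V y)) \<bullet> x = p n (x \<bullet> y) *\<^sub>R (cross3 x y \<bullet> V y)" for y
    proof -
      have "cross3 y (V y) \<bullet> x = cross3 x y \<bullet> V y"
        by (simp add: cross3_def inner_vec_def sum_3 algebra_simps)
      then show ?thesis by simp
    qed
    have "c n x = (LINT y:S2|sphere_measure. (p n (x \<bullet> y) *\<^sub>R cross3 y (V y)) \<bullet> x)"
      unfolding c_def
      by (rule set_integral_bounded_linear[OF bounded_linear_inner_left integrable_sphere_measure_continuous[OF cont]])
    also have "\<dots> = (LINT y|sphere_borel_measure. p n (x \<bullet> y) *\<^sub>R (cross3 x y \<bullet> V0 y))"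
      unfolding triple by (rule integral_sphere_measure_cong_AE) (auto simp: V0_eq)
    finally show "c n x = (LINT y|sphere_borel_measure. p n (x \<bullet> y) *\<^sub>R (cross3 x y \<bullet> V0 y))" .
    show "integrable sphere_borel_measure (\<lambda>y. p n (x \<bullet> y) *\<^sub>R (cross3 x y \<bullet> V0 y))"
      using integrable_sphere_continuous[OF cont']
      unfolding set_integrable_def V0_def by (simp add: mult_ac)
  qed
  have curl: "nonlocal_curl \<gamma>' V x \<bullet> x = (LINT y|sphere_borel_measure. h0 (x \<bullet> y) *\<^sub>R (cross3 x y \<bullet> V0 y))"
    and inth: "integrable sphere_borel_measure (\<lambda>y. h0 (x \<bullet> y) *\<^sub>R (cross3 x y \<bullet> V0 y))" if x: "x \<in> S2" for x
  proof -
    obtain F where F: "\<And>x. x \<in> S2 \<Longrightarrow> F differentiable (at x)" "\<And>x. x \<in> S2 \<Longrightarrow> F x = V x"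
      using smooth_field_on_sphere_differentiable[OF assms(7)] by blast
    obtain L where L0: "0 \<le> L" and L: "\<And>y. y \<in> S2 \<Longrightarrow> norm (V y - V x) \<le> L * norm (y - x)"
      by (rule pointwise_lipschitz[where K = S2 and F = F and V = V and B = M, OF F(1)[OF x] F(2) x M]) (assumption | blast)+
    \<comment> \<open>The unsplit integrand is shown integrable first, since the Bochner integral
      commutes with \<open>\<bullet> x\<close> for integrable functions. Each factor of the cross
      product contributes |y - x|, together a multiple of 1 - x \<bullet> y.\<close>
    define E where "E = (\<lambda>y. cross3 (y - x) (V0 y - V x))"
    have E [measurable]: "E \<in> borel_measurable borel"
    proof -
      have "(\<lambda>z::(real^3) \<times> (real^3). cross3 (fst z - x) (snd z - V x)) \<in> borel_measurable borel"
        by (intro borel_measurable_continuous_onI continuous_on_cross continuous_intros)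
      then have "(\<lambda>z::(real^3) \<times> (real^3). cross3 (fst z - x) (snd z - V x)) \<in> borel_measurable (borel \<Otimes>\<^sub>M borel)"
        by (simp add: borel_prod)
      moreover have "(\<lambda>y. (y, V0 y)) \<in> borel \<rightarrow>\<^sub>M borel \<Otimes>\<^sub>M borel"
        by (intro measurable_Pair V0) simp
      ultimately have "(\<lambda>y. cross3 (fst (y, V0 y) - x) (snd (y, V0 y) - V x)) \<in> borel_measurable borel"
        by (rule measurable_compose[rotated])
      then show ?thesis unfolding E_def by (simp only: fst_conv snd_conv)
    qed
    have E_bound: "norm (E y) \<le> (2 * L) * (\<lambda>t. 1 - t) (x \<bullet> y)" if y: "y \<in> S2" for y
    proof -
      have "norm (E y) \<le> norm (y - x) * norm (V y - V x)"
        unfolding E_def V0_eq[OF y] by (rule norm_cross3_le)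
      also have "\<dots> \<le> norm (y - x) * (L * norm (y - x))"
        by (intro mult_left_mono L y) simp
      also have "\<dots> = L * (norm (y - x))\<^sup>2" by (simp add: power2_eq_square)
      also have "(norm (y - x))\<^sup>2 = 2 * (1 - x \<bullet> y)"
        using x y dot_norm_neg[of x y] by (simp add: norm_minus_commute[of y x])
      finally show ?thesis by (simp add: algebra_simps)
    qed
    have intE: "integrable sphere_borel_measure (\<lambda>y. h0 (x \<bullet> y) *\<^sub>R E y)"
      by (rule zonal_integral_estimate(1)[where u = "\<lambda>t. 1 - t", OF x h0 _ E E_bound _ nn_integral_weighted_abs_le]) (use L0 int_h' in simp_all)
    have i1: "integrable sphere_borel_measure (\<lambda>y. h0 (x \<bullet> y) *\<^sub>R (cross3 x y \<bullet> V0 y))"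
      by (rule zonal_integral_estimate(1)[where u = ?w, OF x h0 _ mc2 cross_bound[OF x] M0
            nn_integral_weighted_abs_le[OF int_h sqrt_1_minus_square_nonneg]]) simp_all
    show "integrable sphere_borel_measure (\<lambda>y. h0 (x \<bullet> y) *\<^sub>R (cross3 x y \<bullet> V0 y))" by (rule i1)
    have bnd: "norm (cross3 x y) \<le> 1 * ?w (x \<bullet> y)" if "y \<in> S2" for y
      using norm_cross3_sphere[OF x that] by simp
    have i2: "integrable sphere_borel_measure (\<lambda>y. h0 (x \<bullet> y) *\<^sub>R cross3 x y)"
      by (rule zonal_integral_estimate(1)[where u = ?w, OF x h0 _ mc bnd _ nn_integral_weighted_abs_le[OF int_h sqrt_1_minus_square_nonneg]]) simp_all
    have zero: "(LINT y|sphere_borel_measure. h0 (x \<bullet> y) *\<^sub>R cross3 x y) = 0"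
      by (rule integral_zonal_cross3_weak_eq_0[OF x h0 int_h P p p_lim])
    have "nonlocal_curl \<gamma>' V x = (LINT y|sphere_borel_measure. h0 (x \<bullet> y) *\<^sub>R E y)"
      unfolding nonlocal_curl_def
    proof (rule integral_sphere_measure_cong_AE)
      show "AE y in sphere_borel_measure. y \<in> S2 \<longrightarrow> \<gamma>' (x \<bullet> y) *\<^sub>R cross3 (y - x) (V y - V x) = h0 (x \<bullet> y) *\<^sub>R E y"
        using AE_zonal[OF x ae] by eventually_elim (simp add: V0_eq E_def)
    qed measurable
    then have "nonlocal_curl \<gamma>' V x \<bullet> x = (LINT y|sphere_borel_measure. (h0 (x \<bullet> y) *\<^sub>R E y) \<bullet> x)"
      using integral_bounded_linear[OF bounded_linear_inner_left intE, of x] by simp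
    also have "\<dots> = (LINT y|sphere_borel_measure. h0 (x \<bullet> y) *\<^sub>R (cross3 x y \<bullet> V0 y) - (h0 (x \<bullet> y) *\<^sub>R cross3 x y) \<bullet> V x)"
    proof -
      \<comment> \<open>The part of E with x in the first slot is perpendicular to x; what remains
        is a cyclic permutation of a triple product.\<close>
      have "E y \<bullet> x = cross3 x y \<bullet> (V0 y - V x)" for y
        unfolding E_def by (simp add: cross3_def inner_vec_def sum_3 algebra_simps)
      then show ?thesis by (simp add: inner_diff_right right_diff_distrib)
    qed
    also have "\<dots> = (LINT y|sphere_borel_measure. h0 (x \<bullet> y) *\<^sub>R (cross3 x y \<bullet> V0 y)) - (LINT y|sphere_borel_measure. (h0 (x \<bullet> y) *\<^sub>R cross3 x y) \<bullet> V x)"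
      by (rule Bochner_Integration.integral_diff[OF i1 integrable_bounded_linear[OF bounded_linear_inner_left i2]])
    also have "(LINT y|sphere_borel_measure. (h0 (x \<bullet> y) *\<^sub>R cross3 x y) \<bullet> V x) = 0"
      using integral_bounded_linear[OF bounded_linear_inner_left i2, of "V x"] zero by simp
    finally show "nonlocal_curl \<gamma>' V x \<bullet> x = (LINT y|sphere_borel_measure. h0 (x \<bullet> y) *\<^sub>R (cross3 x y \<bullet> V0 y))"
      by simp
  qed
  have c_lim: "norm (c n x - nonlocal_curl \<gamma>' V x \<bullet> x) \<le> (2 * pi * M) * inverse (real (Suc n))" if x: "x \<in> S2" for n x
  proof -
    have "c n x - nonlocal_curl \<gamma>' V x \<bullet> x = (LINT y|sphere_borel_measure. (\<lambda>t. p n t - h0 t) (x \<bullet> y) *\<^sub>R (cross3 x y \<bullet> V0 y))"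
      unfolding c_eq curl[OF x]
      using Bochner_Integration.integral_diff[OF intp inth[OF x], of n x] by (simp add: left_diff_distrib)
    also have "norm \<dots> \<le> 2 * pi * M * inverse (real (Suc n))"
      by (rule zonal_integral_estimate(2)[where u = ?w, OF x _ _ mc2 cross_bound[OF x] M0]) (use p_lim[of n] in simp_all)
    finally show ?thesis .
  qed
  note patch = assms(8)[unfolded spherical_patch_def Let_def]
  have \<Sigma>: "\<Sigma> \<subseteq> S2" and oriented: "positively_oriented_boundary \<Sigma> C"
    and boundary: "\<forall>c\<in>C. simple_path c \<and> pathfinish c = pathstart c \<and> piecewise_regular_curve c"
      "top_of_set S2 frontier_of \<Sigma> = (\<Union>c\<in>C. path_image c)"
    by (rule patch[THEN conjunct1], (rule patch[THEN conjunct2, THEN conjunct2, THEN conjunct2, THEN conjunct2, THEN conjunct2, THEN conjunct2]),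
      (rule patch[THEN conjunct2, THEN conjunct2, THEN conjunct2, THEN conjunct2, THEN conjunct1]),
      (rule patch[THEN conjunct2, THEN conjunct2, THEN conjunct2, THEN conjunct2, THEN conjunct2, THEN conjunct1]))
  have "\<Sigma> = closure (top_of_set S2 interior_of \<Sigma>)"
    by (rule patch[THEN conjunct2, THEN conjunct1, THEN conjunct2, THEN conjunct2])
  then have closed: "closed \<Sigma>" by (rule ssubst) (rule closed_closure)
  have curves: "path c" "piecewise_regular_curve c" "path_image c \<subseteq> S2" if "c \<in> C" for c
  proof -
    have "top_of_set S2 frontier_of \<Sigma> \<subseteq> S2"
      using frontier_of_subset_topspace[of "top_of_set S2" \<Sigma>] by simp
    then show "path_image c \<subseteq> S2" unfolding boundary(2) using that by blast
    show "path c" "piecewise_regular_curve c" using boundary(1) that simple_path_imp_path by blast+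
  qed
  have stokes: "(LINT x:\<Sigma>|sphere_measure. c n x) = boundary_circulation C (W n)" for n
  proof -
    have "Ck_on 1 (W n) UNIV" unfolding W_def by (rule Ck_on_1_zonal_integral[OF P p cV])
    then have "open UNIV \<and> \<Sigma> \<subseteq> UNIV \<and> Ck_on 1 (W n) UNIV" by (intro conjI open_UNIV subset_UNIV)
    then have "(LINT x:\<Sigma>|sphere_measure. curl (W n) x \<bullet> x) = boundary_circulation C (W n)"
      by (rule oriented[unfolded positively_oriented_boundary_def, THEN spec, THEN spec, THEN mp])
    then show ?thesis by (simp only: curl_W)
  qed
  have "(\<lambda>n. LINT x:\<Sigma>|sphere_measure. c n x) \<longlonglongrightarrow> (LINT x:\<Sigma>|sphere_measure. nonlocal_curl \<gamma>' V x \<bullet> x)"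
  proof (rule tendsto_sphere_integral[OF closed \<Sigma>])
    show "continuous_on \<Sigma> (c n)" for n using cc continuous_on_subset by blast
    show "norm (c n x - nonlocal_curl \<gamma>' V x \<bullet> x) \<le> (2 * pi * M) * inverse (real (Suc n))" if "x \<in> \<Sigma>" for n x
      using c_lim \<Sigma> that by blast
  qed (use M0 in simp)
  moreover have "(\<lambda>n. boundary_circulation C (W n)) \<longlonglongrightarrow> boundary_circulation C (nonlocal_average g V)"
    unfolding boundary_circulation_def
  proof (rule tendsto_sum)
    fix \<kappa> assume \<kappa>: "\<kappa> \<in> C"
    show "(\<lambda>n. curve_circulation \<kappa> (W n)) \<longlonglongrightarrow> curve_circulation \<kappa> (nonlocal_average g V)"
    proof (rule curve_circulation_uniform_limit)
      show "piecewise_regular_curve \<kappa>" "path \<kappa>" by (fact curves[OF \<kappa>])+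
      show "continuous_on (path_image \<kappa>) (W n)" for n
        unfolding W_def using has_derivative_zonal_integral[OF P p cV]
        by (intro continuous_at_imp_continuous_on ballI has_derivative_continuous) blast
      show "uniform_limit (path_image \<kappa>) W (nonlocal_average g V) sequentially"
        by (rule uniform_limit_inverse_Suc[of _ _ _ "2 * pi * M"]) (use W_lim curves(3)[OF \<kappa>] in blast)
    qed
  qed
  ultimately show ?thesis
    unfolding stokes g_def by (rule LIMSEQ_unique)
qed

end
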